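(* Let $\lambda \in \mathbb{R}\setminus[-1,1]$, let $m\ge 1$, let $a_1,\dots,a_m \in \mathbb{C}\setminus\{0\}$ with $a_1+\cdots+a_m = |\lambda|$, and let $\tau_1<\cdots<\tau_m$ be real numbers. Let $f$ be the unique compactly supported distribution on $\mathbb{R}$ satisfying $\int f(x)\,dx=1$ and $f(x)=\sum_{j=1}^m a_j f(\lambda x-\tau_j)$, and let $A(y)=|\lambda|^{-1}\sum_{j=1}^m a_j e^{2\pi i\tau_j y}$. Define $$\rho(f) = -\frac{\ln M(A)}{\ln|\lambda|}.$$ Then $$\lim_{L\to\infty}\frac{1}{2L\ln L}\int_{-L}^{L}\ln|\widehat f(y)|\,dy = -\rho(f).$$
   Context: The Fourier transform is $\widehat f(y)=\int_{-\infty}^{\infty} f(x)e^{2\pi i xy}\,dx$; it satisfies $\widehat f(0)=1$ and $\widehat f(y)=\prod_{k=1}^\infty A(y\lambda^{-k})$. The Mahler measure $M(A)$ is defined as follows. Let $d$ be the maximal number of elements of $\{\tau_1,\dots,\tau_m\}$ linearly independent over $\mathbb{Q}$. There exist a Laurent polynomial $P(z_1,\dots,z_d)$ and real numbers $r_1,\dots,r_d$ (necessarily linearly independent over $\mathbb{Q}$) with $A(y)=P(e^{2\pi i r_1y},\dots,e^{2\pi i r_dy})$ for all $y\in\mathbb{R}$, and $$M(A)=M(P)=\exp\int_0^1\cdots\int_0^1\ln|P(e^{2\pi i t_1},\dots,e^{2\pi i t_d})|\,dt_1\cdots dt_d;$$ this does not depend on the choice of $P$ and $r_1,\dots,r_d$.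 *)

theory Defs
  imports "HOL-Analysis.Analysis" "HOL-Library.Poly_Mapping"
begin

section \<open>Compactly supported distributions on the real line\<close>

definition iter_deriv :: "nat \<Rightarrow> (real \<Rightarrow> complex) \<Rightarrow> real \<Rightarrow> complex" where
  "iter_deriv n \<phi> = ((\<lambda>g x. vector_derivative g (at x)) ^^ n) \<phi>"

definition smooth :: "(real \<Rightarrow> complex) \<Rightarrow> bool" where
  "smooth \<phi> \<longleftrightarrow> (\<forall>n x. iter_deriv n \<phi> differentiable (at x))"

definition fun_support :: "(real \<Rightarrow> complex) \<Rightarrow> real set" where
  "fun_support \<phi> = closure {x. \<phi> x \<noteq> 0}"

definition test_fun :: "(real \<Rightarrow> complex) \<Rightarrow> bool" where
  "test_fun \<phi> \<longleftrightarrow> smooth \<phi> \<and> compact (fun_support \<phi>)"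

text \<open>
  A distribution is a linear functional on test functions that on every compact \<open>K\<close> is bounded by
  finitely many of the seminorms \<open>\<phi> \<mapsto> sup \<bar>\<phi>\<^sup>(\<^sup>n\<^sup>)\<bar>\<close>.  Its values at functions that are
  not test functions are junk and are never used.
\<close>

type_synonym functional = "(real \<Rightarrow> complex) \<Rightarrow> complex"

definition distribution :: "functional \<Rightarrow> bool" where
  "distribution T \<longleftrightarrow>
     (\<forall>\<phi> \<psi>. test_fun \<phi> \<longrightarrow> test_fun \<psi> \<longrightarrow> T (\<lambda>x. \<phi> x + \<psi> x) = T \<phi> + T \<psi>) \<and>
     (\<forall>c \<phi>. test_fun \<phi> \<longrightarrow> T (\<lambda>x. c * \<phi> x) = c * T \<phi>) \<and>
     (\<forall>K. compact K \<longrightarrow>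
        (\<exists>C N. \<forall>\<phi>. test_fun \<phi> \<longrightarrow> fun_support \<phi> \<subseteq> K \<longrightarrow>
           cmod (T \<phi>) \<le> C * (\<Sum>n\<le>N. SUP x. cmod (iter_deriv n \<phi> x))))"

definition vanishes_on :: "functional \<Rightarrow> real set \<Rightarrow> bool" where
  "vanishes_on T U \<longleftrightarrow> (\<forall>\<phi>. test_fun \<phi> \<longrightarrow> fun_support \<phi> \<subseteq> U \<longrightarrow> T \<phi> = 0)"

text \<open>
  The support of \<open>T\<close> is the complement of the largest open set on which \<open>T\<close> vanishes.  It is
  contained in a closed set \<open>K\<close> if and only if \<open>T\<close> vanishes on \<open>- K\<close>.
\<close>

definition compactly_supported_distribution :: "functional \<Rightarrow> bool" where
  "compactly_supported_distribution T \<longleftrightarrow>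
     distribution T \<and> (\<exists>K. compact K \<and> vanishes_on T (- K))"

text \<open>
  The usual extension of a compactly supported distribution to arbitrary smooth functions:
  \<open>T \<psi>\<close> is \<open>T (\<eta> \<psi>)\<close> for any test function \<open>\<eta>\<close> that equals 1 on a neighbourhood of a compact set
  containing the support of \<open>T\<close>.  The value does not depend on \<open>K\<close> and \<open>\<eta>\<close>.
\<close>

definition pairing :: "functional \<Rightarrow> (real \<Rightarrow> complex) \<Rightarrow> complex" where
  "pairing T \<psi> =
     (THE c. \<exists>K \<eta> U. compact K \<and> vanishes_on T (- K) \<and>
        test_fun \<eta> \<and> open U \<and> K \<subseteq> U \<and> (\<forall>x\<in>U. \<eta> x = 1) \<and> c = T (\<lambda>x. \<eta> x * \<psi> x))"

definition total_integral :: "functional \<Rightarrow> complex" where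
  "total_integral T = pairing T (\<lambda>x. 1)"

definition fourier :: "functional \<Rightarrow> real \<Rightarrow> complex" where
  "fourier T y = pairing T (\<lambda>x. cis (2 * pi * x * y))"

text \<open>
  The distribution \<open>f (\<lambda> x - \<tau>)\<close>.  For a function \<open>f\<close>, substituting \<open>u = \<lambda> x - \<tau>\<close> gives
  \<open>\<integral> f (\<lambda> x - \<tau>) \<phi> x dx = \<bar>\<lambda>\<bar>\<^sup>-\<^sup>1 \<integral> f u \<phi> ((u + \<tau>) / \<lambda>) du\<close>.
\<close>

definition affine_comp :: "functional \<Rightarrow> real \<Rightarrow> real \<Rightarrow> functional" where
  "affine_comp T lam tau = (\<lambda>\<phi>. T (\<lambda>u. \<phi> ((u + tau) / lam)) / complex_of_real \<bar>lam\<bar>)"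

definition satisfies_refinement ::
    "functional \<Rightarrow> real \<Rightarrow> nat \<Rightarrow> (nat \<Rightarrow> complex) \<Rightarrow> (nat \<Rightarrow> real) \<Rightarrow> bool" where
  "satisfies_refinement T lam m a tau \<longleftrightarrow>
     (\<forall>\<phi>. test_fun \<phi> \<longrightarrow> T \<phi> = (\<Sum>j=1..m. a j * affine_comp T lam (tau j) \<phi>))"


section \<open>Mahler measure\<close>

text \<open>
  Laurent polynomials in the variables \<open>z 0, \<dots>, z (d - 1)\<close>: finitely supported families of complex
  coefficients indexed by exponent vectors, which are finitely supported integer sequences.
  The case \<open>d = 0\<close> does occur (for \<open>m = 1\<close> and \<open>\<tau>\<^sub>1 = 0\<close>); the Mahler measure of a constant is then
  its modulus.
\<close>

type_synonym laurent_poly = "(nat \<Rightarrow>\<^sub>0 int) \<Rightarrow>\<^sub>0 complex"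

definition laurent_in_vars :: "nat \<Rightarrow> laurent_poly \<Rightarrow> bool" where
  "laurent_in_vars d P \<longleftrightarrow> (\<forall>e\<in>Poly_Mapping.keys P. Poly_Mapping.keys e \<subseteq> {..<d})"

definition laurent_eval :: "laurent_poly \<Rightarrow> (nat \<Rightarrow> complex) \<Rightarrow> complex" where
  "laurent_eval P z =
     (\<Sum>e\<in>Poly_Mapping.keys P. Poly_Mapping.lookup P e *
        (\<Prod>i\<in>Poly_Mapping.keys e. z i powi Poly_Mapping.lookup e i))"

definition laurent_mahler :: "nat \<Rightarrow> laurent_poly \<Rightarrow> real" where
  "laurent_mahler d P =
     exp (LINT t : (\<Pi>\<^sub>E i\<in>{..<d}. {0..1}) | (\<Pi>\<^sub>M i\<in>{..<d}. lborel).
            ln (cmod (laurent_eval P (\<lambda>i. cis (2 * pi * t i)))))"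

abbreviation Q_independent :: "real set \<Rightarrow> bool" where
  "Q_independent \<equiv> module.independent (\<lambda>q x. real_of_rat q * x)"

definition Q_rank :: "real set \<Rightarrow> nat" where
  "Q_rank S = Max {card B | B. B \<subseteq> S \<and> Q_independent B}"

text \<open>
  Mahler measure of an exponential sum \<open>A\<close> whose (finite) set of frequencies is \<open>S\<close>.  The value
  of \<open>laurent_mahler d P\<close> is the same for all admissible \<open>P\<close> and \<open>r\<close>.
\<close>

definition mahler_measure :: "real set \<Rightarrow> (real \<Rightarrow> complex) \<Rightarrow> real" where
  "mahler_measure S A =
     (let d = Q_rank S in
      THE M. \<exists>P r. laurent_in_vars d P \<and> inj_on r {..<d} \<and> Q_independent (r ` {..<d}) \<and>
        (\<forall>y. A y = laurent_eval P (\<lambda>i. cis (2 * pi * r i * y))) \<and>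
        M = laurent_mahler d P)"

definition mask :: "real \<Rightarrow> nat \<Rightarrow> (nat \<Rightarrow> complex) \<Rightarrow> (nat \<Rightarrow> real) \<Rightarrow> real \<Rightarrow> complex" where
  "mask lam m a tau y = (\<Sum>j=1..m. a j * cis (2 * pi * tau j * y)) / complex_of_real \<bar>lam\<bar>"

definition rho :: "real \<Rightarrow> nat \<Rightarrow> (nat \<Rightarrow> complex) \<Rightarrow> (nat \<Rightarrow> real) \<Rightarrow> real" where
  "rho lam m a tau = - ln (mahler_measure (tau ` {1..m}) (mask lam m a tau)) / ln \<bar>lam\<bar>"

end

theory Submission
  imports Defs "HOL-Probability.Probability" "HOL-Computational_Algebra.Polynomial"
begin

text \<open>
  Pairing the refinement equation with characters turns it into
  \<open>F y = A (y / \<lambda>) * F (y / \<lambda>)\<close> for the Fourier transform \<open>F\<close> of the distribution and its mask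
  \<open>A\<close> (\<open>fourier_refinement\<close>).  Let \<open>J L\<close> and \<open>G L\<close> be the means of \<open>ln \<bar>F\<bar>\<close> and \<open>ln \<bar>A\<bar>\<close> over
  \<open>[-L, L]\<close>.  The functional equation says \<open>J (\<bar>\<lambda>\<bar> L) = G L + J L\<close>.  If \<open>G L\<close> tends to \<open>\<mu>\<close>, then
  each multiplication of \<open>L\<close> by \<open>\<bar>\<lambda>\<bar>\<close> adds about \<open>\<mu>\<close> to \<open>J\<close>, and it takes about
  \<open>ln L / ln \<bar>\<lambda>\<bar>\<close> multiplications to reach \<open>L\<close> from a bounded range; hence \<open>J L\<close> is asymptotic to
  \<open>\<mu> ln L / ln \<bar>\<lambda>\<bar>\<close> (\<open>mean_ln_of_refinement\<close>).  The recursion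
  starts from a neighbourhood of \<open>0\<close>, on which \<open>ln \<bar>F\<bar>\<close> is bounded because \<open>F\<close> is continuous at \<open>0\<close>
  with \<open>F 0 = 1\<close> (\<open>fourier_tendsto_at_0\<close>).

  The main point is that \<open>\<mu>\<close> exists and is the logarithm of the Mahler measure
  (\<open>mean_ln_tendsto_mahler_measure\<close>).  Write \<open>A y = P (r\<^sub>1 y, \<dots>, r\<^sub>d y)\<close> with a Laurent polynomial \<open>P\<close>
  on the torus and rationally independent \<open>r\<^sub>i\<close>.  Trigonometric polynomials on the torus have the
  same mean over the torus as along the line through \<open>(r\<^sub>1, \<dots>, r\<^sub>d)\<close> (\<open>mean_trig_poly\<close>).  Applied to
  the powers of \<open>\<bar>P\<bar>\<^sup>2\<close>, this says that all moments of \<open>\<bar>A\<bar>\<^sup>2\<close> over \<open>[-R, R]\<close> converge to those of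
  \<open>\<bar>P\<bar>\<^sup>2\<close>, so by the Weierstrass theorem in one variable the mean of every continuous function of
  \<open>\<bar>A\<bar>\<^sup>2\<close> converges.

  The logarithm is unbounded near \<open>0\<close>, so a uniform bound on the measure of the set where \<open>\<bar>A\<bar>\<close> is
  small is needed as well (\<open>exp_sum_thin_sublevels\<close>).  At every point one of the first \<open>m\<close>
  derivatives of a sum of \<open>m\<close> exponentials is bounded below, since the terms can be recovered from
  these derivatives by Lagrange interpolation; a function with a large derivative of order \<open>k\<close> is
  small only on a small set (\<open>emeasure_sublevel_le\<close>).  The bound passes to the limit, so it also holds
  for \<open>\<bar>P\<bar>\<close> on the torus, and it controls the error made by truncating the logarithm on both sides
  (\<open>tendsto_integral_ln_of_moments\<close>).
\<close>

section \<open>Smooth functions and plateau functions\<close>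

lemma has_vector_derivative_cis_mult:
  "((\<lambda>x. cis (\<omega> * x)) has_vector_derivative (\<i> * \<omega>) * cis (\<omega> * x)) (at x)"
proof -
  have "((\<lambda>z. exp ((\<i> * \<omega>) * z)) has_field_derivative
      (\<i> * \<omega>) * exp ((\<i> * \<omega>) * of_real x)) (at (of_real x))"
    by (rule derivative_eq_intros refl)+ simp
  then have "((\<lambda>x. exp ((\<i> * \<omega>) * of_real x)) has_vector_derivative
      (\<i> * \<omega>) * exp ((\<i> * \<omega>) * of_real x)) (at x)"
    by (rule has_vector_derivative_real_field)
  then show ?thesis by (simp add: cis_conv_exp mult_ac)
qed

lemma cmod_cis_diff_le: "cmod (cis s - cis t) \<le> \<bar>s - t\<bar>"
proof -
  have "cis s - cis t = cis t * (cis (s - t) - 1)" by (simp add: right_diff_distrib cis_mult)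
  then show ?thesis
    using iexp_approx1[of "s - t" 0] by (simp add: norm_mult cis_conv_exp[of "s - t"])
qed

text \<open>
  Closing a set \<open>G\<close> of functions under the operations of calculus makes a coinduction up to closure
  possible: to see that all of them are smooth, it suffices to find the derivative of each function
  in \<open>G\<close> inside the closure.  With \<open>G = smooth\<close> this gives the closure properties of smooth functions;
  with other \<open>G\<close> it shows that concrete functions are smooth.
\<close>

inductive smooth_algebra :: "((real \<Rightarrow> complex) \<Rightarrow> bool) \<Rightarrow> (real \<Rightarrow> complex) \<Rightarrow> bool"
  for G :: "(real \<Rightarrow> complex) \<Rightarrow> bool" where
  generator: "G f \<Longrightarrow> smooth_algebra G f"
| const: "smooth_algebra G (\<lambda>x. c)"
| mult: "smooth_algebra G f \<Longrightarrow> smooth_algebra G g \<Longrightarrow> smooth_algebra G (\<lambda>x. f x * g x)"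
| add: "smooth_algebra G f \<Longrightarrow> smooth_algebra G g \<Longrightarrow> smooth_algebra G (\<lambda>x. f x + g x)"
| inverse: "smooth_algebra G f \<Longrightarrow> (\<And>x. f x \<noteq> 0) \<Longrightarrow> smooth_algebra G (\<lambda>x. inverse (f x))"
| affine: "smooth_algebra G f \<Longrightarrow> smooth_algebra G (\<lambda>x. f (b * x + c))"

lemma iter_deriv_0 [simp]: "iter_deriv 0 \<phi> = \<phi>"
  by (simp add: iter_deriv_def)

lemma iter_deriv_Suc: "iter_deriv (Suc n) \<phi> = iter_deriv n (\<lambda>x. vector_derivative \<phi> (at x))"
  by (simp add: iter_deriv_def funpow_Suc_right del: funpow.simps)

lemma iter_deriv_Suc_eq:
  assumes "\<And>x. (\<phi> has_vector_derivative \<phi>' x) (at x)"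
  shows "iter_deriv (Suc n) \<phi> = iter_deriv n \<phi>'"
proof -
  have "(\<lambda>x. vector_derivative \<phi> (at x)) = \<phi>'"
    using assms by (intro ext vector_derivative_at)
  then show ?thesis by (simp add: iter_deriv_Suc)
qed

text \<open>
  The rules for sums, products, inverses and affine substitutions express the derivative of a member
  of the closure by members and their derivatives, so the closure is stable under differentiation.
\<close>

lemma smooth_algebra_imp_smooth:
  assumes "\<And>f. G f \<Longrightarrow> \<exists>f'. (\<forall>x. (f has_vector_derivative f' x) (at x)) \<and> smooth_algebra G f'"
    and "smooth_algebra G f"
  shows "smooth f"
proof -
  have step: "\<exists>f'. (\<forall>x. (f has_vector_derivative f' x) (at x)) \<and> smooth_algebra G f'"
    if "smooth_algebra G f" for f
    using that
  proof induction
    case (generator f) then show ?case using assms(1) by blast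
  next
    case (const c)
    show ?case by (rule exI[of _ "\<lambda>x. 0"]) (auto intro: smooth_algebra.const)
  next
    case (mult f g)
    then obtain f' g' where
      "\<forall>x. (f has_vector_derivative f' x) (at x)" "smooth_algebra G f'"
      "\<forall>x. (g has_vector_derivative g' x) (at x)" "smooth_algebra G g'" by blast
    then show ?case using mult.hyps
      by (intro exI[of _ "\<lambda>x. f x * g' x + f' x * g x"])
        (auto intro!: smooth_algebra.add smooth_algebra.mult has_vector_derivative_mult)
  next
    case (add f g)
    then obtain f' g' where
      "\<forall>x. (f has_vector_derivative f' x) (at x)" "smooth_algebra G f'"
      "\<forall>x. (g has_vector_derivative g' x) (at x)" "smooth_algebra G g'" by blast
    then show ?case
      by (intro exI[of _ "\<lambda>x. f' x + g' x"])
        (auto intro!: smooth_algebra.add has_vector_derivative_add)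
  next
    case (inverse f)
    then obtain f' where
      f': "\<forall>x. (f has_vector_derivative f' x) (at x)" "smooth_algebra G f'" by blast
    have "((\<lambda>x. inverse (f x)) has_vector_derivative - 1 * (f' x * (inverse (f x) * inverse (f x)))) (at x)" for x
      using f'(1) inverse.hyps(2)[of x]
      by (auto simp: has_vector_derivative_def intro!: derivative_eq_intros)
    moreover have "smooth_algebra G (\<lambda>x. - 1 * (f' x * (inverse (f x) * inverse (f x))))"
      by (intro smooth_algebra.mult smooth_algebra.const f' smooth_algebra.inverse inverse.hyps)
    ultimately show ?case
      by (intro exI[of _ "\<lambda>x. - 1 * (f' x * (inverse (f x) * inverse (f x)))"]) simp
  next
    case (affine f b c)
    then obtain f' where
      f': "\<forall>x. (f has_vector_derivative f' x) (at x)" "smooth_algebra G f'" by blast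
    have "((\<lambda>x. f (b * x + c)) has_vector_derivative of_real b * f' (b * x + c)) (at x)" for x
    proof -
      have "((f \<circ> (\<lambda>x. b * x + c)) has_vector_derivative b *\<^sub>R f' (b * x + c)) (at x)"
      proof (rule vector_diff_chain_at)
        show "((\<lambda>x. b * x + c) has_vector_derivative b) (at x)"
          unfolding has_real_derivative_iff_has_vector_derivative[symmetric]
          by (auto intro!: derivative_eq_intros)
      qed (use f'(1) in simp)
      then show ?thesis by (simp add: o_def scaleR_conv_of_real)
    qed
    moreover have "smooth_algebra G (\<lambda>x. of_real b * f' (b * x + c))"
      by (intro smooth_algebra.mult smooth_algebra.const f' smooth_algebra.affine)
    ultimately show ?case
      by (intro exI[of _ "\<lambda>x. of_real b * f' (b * x + c)"]) simp
  qed
  have iter: "smooth_algebra G (iter_deriv n f)" if "smooth_algebra G f" for n f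
    using that
  proof (induction n arbitrary: f)
    case (Suc n)
    then obtain f' where f': "\<And>x. (f has_vector_derivative f' x) (at x)" "smooth_algebra G f'"
      using step by blast
    show ?case using Suc.IH[OF f'(2)] by (simp add: iter_deriv_Suc_eq[OF f'(1)])
  qed simp
  have "iter_deriv n f differentiable (at x)" for n x
  proof -
    obtain f' where "\<forall>x. (iter_deriv n f has_vector_derivative f' x) (at x)"
      using step[OF iter[OF assms(2)]] by blast
    then show ?thesis by (blast intro: differentiableI_vector)
  qed
  then show ?thesis by (simp add: smooth_def)
qed

lemma smooth_has_vector_derivative:
  assumes "smooth \<phi>"
  shows "(\<phi> has_vector_derivative vector_derivative \<phi> (at x)) (at x)"
  using assms[unfolded smooth_def, rule_format, of 0 x] by (simp add: vector_derivative_works)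

lemma smooth_vector_derivative:
  assumes "smooth \<phi>"
  shows "smooth (\<lambda>x. vector_derivative \<phi> (at x))"
  using assms unfolding smooth_def iter_deriv_Suc[symmetric] by blast

lemma smooth_algebra_of_smooth:
  assumes "smooth_algebra smooth f" shows "smooth f"
proof (rule smooth_algebra_imp_smooth[OF _ assms])
  fix g assume "smooth g"
  then show "\<exists>f'. (\<forall>x. (g has_vector_derivative f' x) (at x)) \<and> smooth_algebra smooth f'"
    by (intro exI[of _ "\<lambda>x. vector_derivative g (at x)"] conjI allI smooth_has_vector_derivative
        smooth_algebra.generator smooth_vector_derivative)
qed

lemma smooth_const: "smooth (\<lambda>x. c)"
  by (rule smooth_algebra_of_smooth) (rule smooth_algebra.const)

lemma smooth_mult: "smooth f \<Longrightarrow> smooth g \<Longrightarrow> smooth (\<lambda>x. f x * g x)"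
  by (rule smooth_algebra_of_smooth) (intro smooth_algebra.mult smooth_algebra.generator)

lemma smooth_add: "smooth f \<Longrightarrow> smooth g \<Longrightarrow> smooth (\<lambda>x. f x + g x)"
  by (rule smooth_algebra_of_smooth) (intro smooth_algebra.add smooth_algebra.generator)

lemma smooth_inverse: "smooth f \<Longrightarrow> (\<And>x. f x \<noteq> 0) \<Longrightarrow> smooth (\<lambda>x. inverse (f x))"
  by (rule smooth_algebra_of_smooth) (intro smooth_algebra.inverse smooth_algebra.generator)

lemma smooth_affine: "smooth f \<Longrightarrow> smooth (\<lambda>x. f (b * x + c))"
  by (rule smooth_algebra_of_smooth) (rule smooth_algebra.affine[OF smooth_algebra.generator])

lemma smooth_cmult: "smooth f \<Longrightarrow> smooth (\<lambda>x. c * f x)"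
  by (intro smooth_mult smooth_const)

lemma smooth_diff: "smooth f \<Longrightarrow> smooth g \<Longrightarrow> smooth (\<lambda>x. f x - g x)"
  using smooth_add[of f "\<lambda>x. - 1 * g x"] smooth_cmult[of g "- 1"] by simp

lemma has_vector_derivative_character:
  "((\<lambda>x. cis (2 * pi * x * y)) has_vector_derivative (2 * pi * \<i> * y) * cis (2 * pi * x * y)) (at x)"
  using has_vector_derivative_cis_mult[of "2 * pi * y" x] by (simp add: mult_ac)

lemma smooth_character: "smooth (\<lambda>x. cis (2 * pi * x * y))"
proof (rule smooth_algebra_imp_smooth[where G = "\<lambda>f. f = (\<lambda>x. cis (2 * pi * x * y))"])
  fix f :: "real \<Rightarrow> complex" assume f: "f = (\<lambda>x. cis (2 * pi * x * y))"
  show "\<exists>f'. (\<forall>x. (f has_vector_derivative f' x) (at x)) \<and>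
      smooth_algebra (\<lambda>f. f = (\<lambda>x. cis (2 * pi * x * y))) f'"
  proof (intro exI conjI allI)
    show "(f has_vector_derivative (2 * pi * \<i> * y) * cis (2 * pi * x * y)) (at x)" for x
      unfolding f by (rule has_vector_derivative_character)
    show "smooth_algebra (\<lambda>f. f = (\<lambda>x. cis (2 * pi * x * y))) (\<lambda>x. (2 * pi * \<i> * y) * cis (2 * pi * x * y))"
      by (intro smooth_algebra.mult smooth_algebra.const smooth_algebra.generator refl)
  qed
qed (simp add: smooth_algebra.generator)

text \<open>
  These functions span a space that is stable under differentiation and contains \<open>exp (- 1 / x)\<close>
  extended by \<open>0\<close>.
\<close>

definition flat_exp :: "nat \<Rightarrow> real \<Rightarrow> complex" where
  "flat_exp k x = (if x > 0 then of_real ((1 / x) ^ k * exp (- (1 / x))) else 0)"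

lemma flat_exp_tendsto_0: "(flat_exp k \<longlongrightarrow> 0) (at 0)"
proof -
  have "((\<lambda>x. (1 / x) ^ k * exp (- (1 / x))) \<longlongrightarrow> 0) (at_right (0::real))"
  proof -
    have "((\<lambda>z. z ^ k * exp (- z)) \<longlongrightarrow> 0) (at_top :: real filter)"
      using tendsto_power_div_exp_0[of k] by (simp add: exp_minus divide_inverse)
    moreover have "filterlim (\<lambda>x::real. 1 / x) at_top (at_right 0)"
      using filterlim_inverse_at_top_right by (simp add: inverse_eq_divide)
    ultimately show ?thesis by (rule filterlim_compose)
  qed
  then have "((\<lambda>x. complex_of_real ((1 / x) ^ k * exp (- (1 / x)))) \<longlongrightarrow> of_real 0) (at_right (0::real))"
    by (rule tendsto_of_real)
  then have "(flat_exp k \<longlongrightarrow> 0) (at_right 0)"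
    by (rule filterlim_cong[THEN iffD1, rotated -1])
      (auto simp: flat_exp_def eventually_at_filter)
  moreover have "(flat_exp k \<longlongrightarrow> 0) (at_left 0)"
    by (rule Lim_transform_eventually[OF tendsto_const[of 0]])
      (auto simp: flat_exp_def eventually_at_filter)
  ultimately show ?thesis by (simp add: filterlim_at_split)
qed

lemma flat_exp_has_vector_derivative:
  "(flat_exp k has_vector_derivative flat_exp (k + 2) x + - of_nat k * flat_exp (k + 1) x) (at x)"
proof -
  consider "x > 0" | "x < 0" | "x = 0" by linarith
  then show ?thesis
  proof cases
    case 1
    have "((\<lambda>x. (1 / x) ^ k * exp (- (1 / x))) has_real_derivative
       ((1 / x) ^ (k + 2) * exp (- (1 / x)) - k * ((1 / x) ^ (k + 1) * exp (- (1 / x))))) (at x)"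
      using 1
      by (auto intro!: derivative_eq_intros simp: field_simps power2_eq_square)
        (cases k; simp)
    then have "((\<lambda>x. complex_of_real ((1 / x) ^ k * exp (- (1 / x)))) has_vector_derivative
       of_real ((1 / x) ^ (k + 2) * exp (- (1 / x)) - k * ((1 / x) ^ (k + 1) * exp (- (1 / x))))) (at x)"
      by (rule has_vector_derivative_of_real)
    then show ?thesis
      by (rule has_vector_derivative_transform_within_open[where S = "{0<..}", THEN has_vector_derivative_eq_rhs])
        (use 1 in \<open>auto simp: flat_exp_def\<close>)
  next
    case 2
    have "((\<lambda>x. 0 :: complex) has_vector_derivative 0) (at x)" by simp
    then show ?thesis
      by (rule has_vector_derivative_transform_within_open[where S = "{..<0}", THEN has_vector_derivative_eq_rhs])
        (use 2 in \<open>auto simp: flat_exp_def\<close>)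
  next
    case 3
    have "((\<lambda>h. (flat_exp k (0 + h) - flat_exp k 0) /\<^sub>R h) \<longlongrightarrow> 0) (at 0)"
      by (rule Lim_transform_eventually[OF flat_exp_tendsto_0[of "k + 1"]])
        (auto simp: flat_exp_def eventually_at_filter scaleR_conv_of_real field_simps)
    from tendsto_norm_zero[OF this]
    have "(flat_exp k has_vector_derivative 0) (at 0)"
      by (simp add: has_vector_derivative_def has_derivative_at divide_inverse mult.commute)
    then show ?thesis using 3 by (simp add: flat_exp_def)
  qed
qed

lemma smooth_flat_exp: "smooth (flat_exp k)"
proof (rule smooth_algebra_imp_smooth[where G = "\<lambda>f. \<exists>k. f = flat_exp k"])
  fix f assume "\<exists>k. f = flat_exp k"
  then obtain k where f: "f = flat_exp k" by blast
  show "\<exists>f'. (\<forall>x. (f has_vector_derivative f' x) (at x)) \<and> smooth_algebra (\<lambda>f. \<exists>k. f = flat_exp k) f'"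
  proof (intro exI conjI allI)
    show "(f has_vector_derivative flat_exp (k + 2) x + - of_nat k * flat_exp (k + 1) x) (at x)" for x
      unfolding f by (rule flat_exp_has_vector_derivative)
    show "smooth_algebra (\<lambda>f. \<exists>k. f = flat_exp k) (\<lambda>x. flat_exp (k + 2) x + - of_nat k * flat_exp (k + 1) x)"
      by (intro smooth_algebra.add smooth_algebra.mult smooth_algebra.const smooth_algebra.generator exI)
        (rule refl)+
  qed
qed (auto intro: smooth_algebra.generator)

text \<open>
  The classical quotient \<open>h x / (h x + h (1 - x))\<close> with \<open>h x = exp (- 1 / x)\<close>.
\<close>

definition smooth_step :: "real \<Rightarrow> complex" where
  "smooth_step x = flat_exp 0 x * inverse (flat_exp 0 x + flat_exp 0 (- 1 * x + 1))"

lemma smooth_smooth_step: "smooth smooth_step"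
proof -
  have nz: "flat_exp 0 x + flat_exp 0 (- 1 * x + 1) \<noteq> 0" for x
  proof -
    have "exp (- (1 / x)) + exp (- (1 / (1 - x))) \<noteq> 0"
      using add_pos_pos[of "exp (- (1 / x))" "exp (- (1 / (1 - x)))"] by simp
    then have "complex_of_real (exp (- (1 / x)) + exp (- (1 / (1 - x)))) \<noteq> 0"
      by (simp only: of_real_eq_0_iff not_False_eq_True)
    then show ?thesis by (auto simp: flat_exp_def)
  qed
  have "smooth (\<lambda>x. flat_exp 0 x * inverse (flat_exp 0 x + flat_exp 0 (- 1 * x + 1)))"
    by (intro smooth_mult smooth_inverse smooth_add smooth_flat_exp nz
        smooth_affine[OF smooth_flat_exp])
  then show ?thesis unfolding smooth_step_def[abs_def] .
qed

lemma smooth_step_eq_0: "x \<le> 0 \<Longrightarrow> smooth_step x = 0"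
  by (simp add: smooth_step_def flat_exp_def)

lemma smooth_step_eq_1: "x \<ge> 1 \<Longrightarrow> smooth_step x = 1"
  by (auto simp: smooth_step_def flat_exp_def)

definition plateau :: "real \<Rightarrow> real \<Rightarrow> complex" where
  "plateau R x = smooth_step (1 * x + (R + 1)) * smooth_step (- 1 * x + (R + 1))"

lemma plateau_eq_1: "\<bar>x\<bar> \<le> R \<Longrightarrow> plateau R x = 1"
  by (auto simp: plateau_def smooth_step_eq_1)

lemma plateau_eq_0: "\<bar>x\<bar> \<ge> R + 1 \<Longrightarrow> plateau R x = 0"
  unfolding plateau_def using smooth_step_eq_0[of "1 * x + (R + 1)"] smooth_step_eq_0[of "- 1 * x + (R + 1)"]
  by (cases "x \<ge> 0") auto

lemma compact_fun_supportI:
  assumes "\<And>x. \<bar>x\<bar> > R \<Longrightarrow> \<phi> x = 0"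
  shows "compact (fun_support \<phi>)" "fun_support \<phi> \<subseteq> {-R..R}"
proof -
  have "{x. \<phi> x \<noteq> 0} \<subseteq> {-R..R}" using assms by (force simp: abs_le_iff not_less[symmetric])
  then show sub: "fun_support \<phi> \<subseteq> {-R..R}"
    unfolding fun_support_def by (intro closure_minimal closed_real_atLeastAtMost)
  show "compact (fun_support \<phi>)"
    using compact_Int_closed[OF compact_Icc[of "-R" R], of "fun_support \<phi>"] sub
    by (simp add: fun_support_def Int_absorb1)
qed

lemma test_fun_plateau: "test_fun (plateau R)"
  unfolding test_fun_def
proof
  show "smooth (plateau R)"
    unfolding plateau_def[abs_def]
    by (intro smooth_mult smooth_affine[OF smooth_smooth_step])
  show "compact (fun_support (plateau R))"
    by (rule compact_fun_supportI[of "R + 1"]) (simp add: plateau_eq_0)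
qed

lemma test_fun_smooth: "test_fun \<phi> \<Longrightarrow> smooth \<phi>"
  by (simp add: test_fun_def)

lemma test_fun_bound:
  assumes "test_fun \<phi>"
  obtains R where "R > 0" "\<And>x. \<bar>x\<bar> > R \<Longrightarrow> \<phi> x = 0"
proof -
  have "bounded (fun_support \<phi>)" using assms by (simp add: test_fun_def compact_imp_bounded)
  then obtain R where R: "R > 0" "\<And>x. x \<in> fun_support \<phi> \<Longrightarrow> norm x \<le> R"
    unfolding bounded_pos by blast
  have "\<phi> x = 0" if "\<bar>x\<bar> > R" for x
    using R(2)[of x] that closure_subset[of "{x. \<phi> x \<noteq> 0}"] by (force simp: fun_support_def)
  then show thesis using R(1) that by blast
qed

lemma test_funI:
  assumes "smooth \<phi>" "\<And>x. \<bar>x\<bar> > R \<Longrightarrow> \<phi> x = 0"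
  shows "test_fun \<phi>"
  using assms compact_fun_supportI(1)[of R \<phi>] by (simp add: test_fun_def)

lemma test_fun_mult_smooth:
  assumes "test_fun \<phi>" "smooth \<psi>"
  shows "test_fun (\<lambda>x. \<phi> x * \<psi> x)"
proof -
  obtain R where R: "R > 0" "\<And>x. \<bar>x\<bar> > R \<Longrightarrow> \<phi> x = 0" using test_fun_bound[OF assms(1)] by blast
  show ?thesis
    by (rule test_funI[where R = R])
      (simp_all add: R smooth_mult test_fun_smooth assms)
qed

lemma test_fun_diff:
  assumes "test_fun \<phi>" "test_fun \<psi>"
  shows "test_fun (\<lambda>x. \<phi> x - \<psi> x)"
proof -
  obtain R where R: "R > 0" "\<And>x. \<bar>x\<bar> > R \<Longrightarrow> \<phi> x = 0" using test_fun_bound[OF assms(1)] by blast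
  obtain S where S: "S > 0" "\<And>x. \<bar>x\<bar> > S \<Longrightarrow> \<psi> x = 0" using test_fun_bound[OF assms(2)] by blast
  show ?thesis
    by (rule test_funI[where R = "max R S"])
      (simp_all add: R S smooth_diff test_fun_smooth assms)
qed

lemma test_fun_affine:
  assumes "test_fun \<phi>" "b \<noteq> 0"
  shows "test_fun (\<lambda>x. \<phi> (b * x + c))"
proof -
  obtain R where R: "R > 0" "\<And>x. \<bar>x\<bar> > R \<Longrightarrow> \<phi> x = 0" using test_fun_bound[OF assms(1)] by blast
  show ?thesis
  proof (rule test_funI)
    fix x assume "\<bar>x\<bar> > (R + \<bar>c\<bar>) / \<bar>b\<bar>"
    then have "\<bar>b * x\<bar> > R + \<bar>c\<bar>" using assms(2) by (simp add: field_simps abs_mult)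
    then have "\<bar>b * x + c\<bar> > R" by linarith
    then show "\<phi> (b * x + c) = 0" by (rule R(2))
  qed (rule smooth_affine[OF test_fun_smooth[OF assms(1)]])
qed

section \<open>The Fourier transform of a compactly supported distribution\<close>

lemma distribution_add:
  "distribution T \<Longrightarrow> test_fun \<phi> \<Longrightarrow> test_fun \<psi> \<Longrightarrow> T (\<lambda>x. \<phi> x + \<psi> x) = T \<phi> + T \<psi>"
  by (simp add: distribution_def)

lemma distribution_cmult:
  "distribution T \<Longrightarrow> test_fun \<phi> \<Longrightarrow> T (\<lambda>x. c * \<phi> x) = c * T \<phi>"
  by (simp add: distribution_def)

lemma distribution_diff:
  assumes "distribution T" "test_fun \<phi>" "test_fun \<psi>"
  shows "T (\<lambda>x. \<phi> x - \<psi> x) = T \<phi> - T \<psi>"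
  using distribution_add[OF assms(1) test_fun_diff[OF assms(2,3)] assms(3)] by simp

text \<open>
  The difference of the test functions vanishes on the open set \<open>U\<close>, so its closed support misses \<open>K\<close>.
\<close>

lemma distribution_cong_near_support:
  assumes "distribution T" "vanishes_on T (- K)" "open U" "K \<subseteq> U"
    "test_fun \<phi>" "test_fun \<psi>" "\<And>x. x \<in> U \<Longrightarrow> \<phi> x = \<psi> x"
  shows "T \<phi> = T \<psi>"
proof -
  have "{x. \<phi> x - \<psi> x \<noteq> 0} \<subseteq> - U" using assms(7) by auto
  then have "fun_support (\<lambda>x. \<phi> x - \<psi> x) \<subseteq> - U"
    unfolding fun_support_def using assms(3) by (intro closure_minimal) (auto simp: closed_Compl)
  then have "T (\<lambda>x. \<phi> x - \<psi> x) = 0"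
    using assms(2,4) test_fun_diff[OF assms(5,6)] by (auto simp: vanishes_on_def)
  then show ?thesis using distribution_diff[OF assms(1,5,6)] by simp
qed

text \<open>
  Two admissible cutoffs may belong to different sets \<open>K\<close>, and \<open>T\<close> is not known to vanish off the
  intersection.  Instead, both are compared with a third cutoff that equals \<open>1\<close> wherever one of them
  does; each comparison uses only one of the two sets.
\<close>

lemma pairing_eq:
  assumes "distribution T" "compact K" "vanishes_on T (- K)"
    "test_fun \<eta>" "open U" "K \<subseteq> U" "\<And>x. x \<in> U \<Longrightarrow> \<eta> x = 1" "smooth \<psi>"
  shows "pairing T \<psi> = T (\<lambda>x. \<eta> x * \<psi> x)"
  unfolding pairing_def
proof (rule the_equality)
  show "\<exists>K' \<eta>' U. compact K' \<and> vanishes_on T (- K') \<and> test_fun \<eta>' \<and> open U \<and> K' \<subseteq> U \<and>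
      (\<forall>x\<in>U. \<eta>' x = 1) \<and> T (\<lambda>x. \<eta> x * \<psi> x) = T (\<lambda>x. \<eta>' x * \<psi> x)"
    using assms by blast
next
  fix c
  assume "\<exists>K \<eta> U. compact K \<and> vanishes_on T (- K) \<and> test_fun \<eta> \<and> open U \<and> K \<subseteq> U \<and>
      (\<forall>x\<in>U. \<eta> x = 1) \<and> c = T (\<lambda>x. \<eta> x * \<psi> x)"
  then obtain K' \<eta>' U' where *: "vanishes_on T (- K')" "test_fun \<eta>'" "open U'" "K' \<subseteq> U'"
      "\<forall>x\<in>U'. \<eta>' x = 1" "c = T (\<lambda>x. \<eta>' x * \<psi> x)"
    by blast
  obtain R where R: "R > 0" "\<And>x. \<bar>x\<bar> > R \<Longrightarrow> \<eta> x = 0" using test_fun_bound[OF assms(4)] by blast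
  obtain S where S: "S > 0" "\<And>x. \<bar>x\<bar> > S \<Longrightarrow> \<eta>' x = 0" using test_fun_bound[OF *(2)] by blast
  \<comment> \<open>Both cutoffs vanish where the third one is allowed to differ from \<open>1\<close>.\<close>
  define \<theta> where "\<theta> = plateau (max R S)"
  have "\<theta> x = 1" if "x \<in> U \<or> x \<in> U'" for x
  proof -
    have "\<bar>x\<bar> \<le> max R S"
    proof (rule ccontr)
      assume "\<not> \<bar>x\<bar> \<le> max R S"
      then have "\<eta> x = 0" "\<eta>' x = 0" using R(2) S(2) by auto
      then show False using that assms(7) *(5) by auto
    qed
    then show ?thesis by (simp add: \<theta>_def plateau_eq_1)
  qed
  note \<theta> = this
  have \<theta>_test: "test_fun \<theta>" unfolding \<theta>_def by (rule test_fun_plateau)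
  have "T (\<lambda>x. \<eta> x * \<psi> x) = T (\<lambda>x. \<theta> x * \<psi> x)"
    by (rule distribution_cong_near_support[OF assms(1,3,5,6)])
      (simp_all add: assms \<theta> test_fun_mult_smooth \<theta>_test)
  moreover have "T (\<lambda>x. \<eta>' x * \<psi> x) = T (\<lambda>x. \<theta> x * \<psi> x)"
    by (rule distribution_cong_near_support[OF assms(1) *(1,3,4)])
      (use * in \<open>simp_all add: assms \<theta> test_fun_mult_smooth \<theta>_test\<close>)
  ultimately show "c = T (\<lambda>x. \<eta> x * \<psi> x)" using *(6) by simp
qed

lemma compactly_supported_distribution_obtain:
  assumes "compactly_supported_distribution T"
  obtains R0 where "distribution T" "R0 > 0"
    "\<And>\<eta> \<psi>. test_fun \<eta> \<Longrightarrow> (\<And>x. \<bar>x\<bar> < R0 \<Longrightarrow> \<eta> x = 1) \<Longrightarrow> smooth \<psi> \<Longrightarrow> pairing T \<psi> = T (\<lambda>x. \<eta> x * \<psi> x)"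
proof -
  obtain K where K: "compact K" "vanishes_on T (- K)" and T: "distribution T"
    using assms by (auto simp: compactly_supported_distribution_def)
  obtain b where b: "b > 0" "\<And>x. x \<in> K \<Longrightarrow> norm x \<le> b"
    using compact_imp_bounded[OF K(1)] unfolding bounded_pos by blast
  show thesis
  proof (rule that[of "b + 1"])
    fix \<eta> \<psi> assume "test_fun \<eta>" "\<And>x. \<bar>x\<bar> < b + 1 \<Longrightarrow> \<eta> x = 1" "smooth \<psi>"
    then show "pairing T \<psi> = T (\<lambda>x. \<eta> x * \<psi> x)"
      using b by (intro pairing_eq[OF T K, where U = "{- (b + 1)<..<b + 1}"]) (force simp: abs_less_iff)+
  qed (use b T in auto)
qed

lemma fourier_0: "fourier T 0 = total_integral T"
  by (simp add: fourier_def total_integral_def)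

text \<open>
  A cutoff that equals \<open>1\<close> on a large interval still equals \<open>1\<close> near the support after each of the
  finitely many substitutions \<open>u \<mapsto> (u + tau j) / lam\<close>.  Each term of the refinement equation is thus
  again a value of the Fourier transform, and the translation contributes the factor
  \<open>cis (2 * pi * tau j * y / lam)\<close>.
\<close>

theorem fourier_refinement:
  assumes T: "compactly_supported_distribution T" and "lam \<noteq> 0"
    and ref: "satisfies_refinement T lam m a tau"
  shows "fourier T y = mask lam m a tau (y / lam) * fourier T (y / lam)"
proof -
  obtain R0 where D: "distribution T" and "R0 > 0" and
    pair: "\<And>\<eta> \<psi>. test_fun \<eta> \<Longrightarrow> (\<And>x. \<bar>x\<bar> < R0 \<Longrightarrow> \<eta> x = 1) \<Longrightarrow> smooth \<psi> \<Longrightarrow> pairing T \<psi> = T (\<lambda>x. \<eta> x * \<psi> x)"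
    using compactly_supported_distribution_obtain[OF T] by blast
  define e where "e y x = cis (2 * pi * x * y)" for x y
  define R where "R = R0 + (R0 + (\<Sum>j=1..m. \<bar>tau j\<bar>)) / \<bar>lam\<bar>"
  define \<eta> where "\<eta> = plateau R"
  have \<eta>: "test_fun \<eta>" by (simp add: \<eta>_def test_fun_plateau)
  have 1: "\<eta> x = 1" if "\<bar>x\<bar> < R0" for x
  proof -
    have "(R0 + (\<Sum>j=1..m. \<bar>tau j\<bar>)) / \<bar>lam\<bar> \<ge> 0"
      using \<open>R0 > 0\<close> by (intro divide_nonneg_nonneg add_nonneg_nonneg sum_nonneg) auto
    then have "\<bar>x\<bar> \<le> R" using that unfolding R_def by linarith
    then show ?thesis by (simp add: \<eta>_def plateau_eq_1)
  qed
  have 2: "\<eta> ((u + tau j) / lam) = 1" if "\<bar>u\<bar> < R0" "j \<in> {1..m}" for u j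
  proof -
    have "\<bar>tau j\<bar> \<le> (\<Sum>j=1..m. \<bar>tau j\<bar>)" using that(2) by (intro member_le_sum) auto
    then have "\<bar>u + tau j\<bar> \<le> R0 + (\<Sum>j=1..m. \<bar>tau j\<bar>)" using that(1) by linarith
    then have "\<bar>(u + tau j) / lam\<bar> \<le> (R0 + (\<Sum>j=1..m. \<bar>tau j\<bar>)) / \<bar>lam\<bar>"
      by (simp add: abs_divide divide_right_mono)
    then have "\<bar>(u + tau j) / lam\<bar> \<le> R" using \<open>R0 > 0\<close> by (simp add: R_def)
    then show ?thesis by (simp add: \<eta>_def plateau_eq_1)
  qed
  have e: "smooth (e y)" for y unfolding e_def by (rule smooth_character)
  have eq: "affine_comp T lam (tau j) (\<lambda>x. \<eta> x * e y x) =
      cis (2 * pi * tau j * (y / lam)) * fourier T (y / lam) / of_real \<bar>lam\<bar>" if j: "j \<in> {1..m}" for j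
  proof -
    define \<eta>j where "\<eta>j u = \<eta> ((1 / lam) * u + tau j / lam)" for u
    have \<eta>j: "test_fun \<eta>j" unfolding \<eta>j_def using \<open>lam \<noteq> 0\<close> by (intro test_fun_affine[OF \<eta>]) simp
    have "(\<lambda>u. \<eta> ((u + tau j) / lam) * e y ((u + tau j) / lam)) =
        (\<lambda>u. cis (2 * pi * tau j * (y / lam)) * (\<eta>j u * e (y / lam) u))"
      by (auto simp: e_def \<eta>j_def cis_mult add_divide_distrib algebra_simps intro!: ext)
    moreover have "fourier T (y / lam) = T (\<lambda>u. \<eta>j u * e (y / lam) u)"
      unfolding fourier_def e_def
      by (rule pair[OF \<eta>j _ smooth_character])
        (use 2 j in \<open>simp add: \<eta>j_def add_divide_distrib\<close>)
    ultimately show ?thesis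
      by (simp add: affine_comp_def distribution_cmult[OF D test_fun_mult_smooth[OF \<eta>j e]])
  qed
  have "fourier T y = T (\<lambda>x. \<eta> x * e y x)"
    unfolding fourier_def e_def by (rule pair[OF \<eta> 1 smooth_character])
  also have "\<dots> = (\<Sum>j=1..m. a j * affine_comp T lam (tau j) (\<lambda>x. \<eta> x * e y x))"
    using ref test_fun_mult_smooth[OF \<eta> e] by (simp add: satisfies_refinement_def)
  also have "\<dots> = (\<Sum>j=1..m. a j * (cis (2 * pi * tau j * (y / lam)) * fourier T (y / lam) / of_real \<bar>lam\<bar>))"
    by (intro sum.cong refl) (simp add: eq)
  also have "\<dots> = mask lam m a tau (y / lam) * fourier T (y / lam)"
    unfolding mask_def sum_divide_distrib sum_distrib_right by (intro sum.cong refl) simp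
  finally show ?thesis .
qed

lemma test_fun_vector_derivative:
  assumes "test_fun \<phi>"
  shows "test_fun (\<lambda>x. vector_derivative \<phi> (at x))"
proof -
  obtain R where R: "R > 0" "\<And>x. \<bar>x\<bar> > R \<Longrightarrow> \<phi> x = 0" using test_fun_bound[OF assms(1)] by blast
  show ?thesis
  proof (rule test_funI)
    fix x :: real assume x: "\<bar>x\<bar> > R"
    have "((\<lambda>x. 0 :: complex) has_vector_derivative 0) (at x)" by simp
    then have "(\<phi> has_vector_derivative 0) (at x)"
      by (rule has_vector_derivative_transform_within_open[where S = "{x. \<bar>x\<bar> > R}"])
        (use x R in \<open>auto intro!: open_Collect_less continuous_intros\<close>)
    then show "vector_derivative \<phi> (at x) = 0" by (rule vector_derivative_at)
  qed (intro smooth_vector_derivative test_fun_smooth assms)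
qed

lemma iter_deriv_add:
  assumes "smooth f" "smooth g"
  shows "iter_deriv n (\<lambda>x. f x + g x) = (\<lambda>x. iter_deriv n f x + iter_deriv n g x)"
  using assms
proof (induction n arbitrary: f g)
  case (Suc n)
  have "iter_deriv (Suc n) (\<lambda>x. f x + g x) =
      iter_deriv n (\<lambda>x. vector_derivative f (at x) + vector_derivative g (at x))"
    by (intro iter_deriv_Suc_eq has_vector_derivative_add smooth_has_vector_derivative Suc.prems)
  then show ?case
    using Suc.IH[OF smooth_vector_derivative smooth_vector_derivative] Suc.prems
    by (simp add: iter_deriv_Suc)
qed simp

lemma iter_deriv_cmult:
  assumes "smooth f"
  shows "iter_deriv n (\<lambda>x. c * f x) = (\<lambda>x. c * iter_deriv n f x)"
  using assms
proof (induction n arbitrary: f)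
  case (Suc n)
  have "iter_deriv (Suc n) (\<lambda>x. c * f x) = iter_deriv n (\<lambda>x. c * vector_derivative f (at x))"
    by (intro iter_deriv_Suc_eq has_vector_derivative_mult_right smooth_has_vector_derivative Suc.prems)
  then show ?case
    using Suc.IH[OF smooth_vector_derivative] Suc.prems by (simp add: iter_deriv_Suc)
qed simp

lemma test_fun_bounded:
  assumes "test_fun \<phi>"
  obtains B where "B \<ge> 0" "\<And>x. cmod (\<phi> x) \<le> B"
proof -
  obtain R where R: "R > 0" "\<And>x. \<bar>x\<bar> > R \<Longrightarrow> \<phi> x = 0" using test_fun_bound[OF assms(1)] by blast
  have "continuous_on {-R..R} \<phi>"
    using smooth_has_vector_derivative[OF test_fun_smooth[OF assms]]
    by (auto intro!: continuous_at_imp_continuous_on has_vector_derivative_continuous)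
  then have "bounded (\<phi> ` {-R..R})" by (intro compact_imp_bounded compact_continuous_image) auto
  then obtain B where B: "B > 0" "\<And>x. x \<in> {-R..R} \<Longrightarrow> cmod (\<phi> x) \<le> B"
    unfolding bounded_pos by blast
  have "cmod (\<phi> x) \<le> B" for x
    using B(1) B(2)[of x] R(2)[of x] by (cases "\<bar>x\<bar> > R") (auto simp: abs_le_iff not_less)
  then show thesis using B(1) that[of B] by auto
qed

lemma test_fun_iter_deriv: "test_fun \<phi> \<Longrightarrow> test_fun (iter_deriv n \<phi>)"
proof (induction n arbitrary: \<phi>)
  case (Suc n) then show ?case by (simp add: iter_deriv_Suc test_fun_vector_derivative)
qed simp

text \<open>
  Differentiating \<open>\<eta> (e - 1)\<close>, where \<open>e x = cis (2 * pi * x * y)\<close>, gives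
  \<open>\<eta>' (e - 1) + 2 \<pi> \<i> y \<eta> (e - 1) + 2 \<pi> \<i> y \<eta>\<close>.  The first two terms have the original form with one
  derivative less to take, and the last one carries a factor \<open>y\<close>; so the induction needs no Leibniz
  formula.
\<close>

lemma iter_deriv_character_minus_1:
  assumes "test_fun \<eta>"
  shows "\<exists>C\<ge>0. \<forall>y x. \<bar>y\<bar> \<le> 1 \<longrightarrow> cmod (iter_deriv n (\<lambda>x. \<eta> x * (cis (2 * pi * x * y) - 1)) x) \<le> C * \<bar>y\<bar>"
  using assms
proof (induction n arbitrary: \<eta>)
  case 0
  obtain R where R: "R > 0" "\<And>x. \<bar>x\<bar> > R \<Longrightarrow> \<eta> x = 0" using test_fun_bound[OF 0] by blast
  obtain B where B: "B \<ge> 0" "\<And>x. cmod (\<eta> x) \<le> B" using test_fun_bounded[OF 0] by blast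
  have "cmod (\<eta> x * (cis (2 * pi * x * y) - 1)) \<le> (B * (2 * pi * R)) * \<bar>y\<bar>" for x y
  proof (cases "\<bar>x\<bar> > R")
    case False
    have "cmod (cis (2 * pi * x * y) - 1) \<le> \<bar>2 * pi * x * y\<bar>"
      using cmod_cis_diff_le[of "2 * pi * x * y" 0] by simp
    also have "\<dots> \<le> 2 * pi * R * \<bar>y\<bar>"
      using False by (simp add: abs_mult mult_right_mono)
    finally show ?thesis
      using B R mult_mono[OF B(2)[of x], of "cmod (cis (2 * pi * x * y) - 1)" "2 * pi * R * \<bar>y\<bar>"]
      by (simp add: norm_mult mult_ac)
  qed (use R B in simp)
  then show ?case using B R by (intro exI[of _ "B * (2 * pi * R)"]) auto
next
  case (Suc n)
  define \<eta>' where "\<eta>' = (\<lambda>x. vector_derivative \<eta> (at x))"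
  have \<eta>': "test_fun \<eta>'" unfolding \<eta>'_def by (rule test_fun_vector_derivative[OF Suc.prems])
  obtain C1 where C1: "C1 \<ge> 0"
    "\<And>y x. \<bar>y\<bar> \<le> 1 \<Longrightarrow> cmod (iter_deriv n (\<lambda>x. \<eta>' x * (cis (2 * pi * x * y) - 1)) x) \<le> C1 * \<bar>y\<bar>"
    using Suc.IH[OF \<eta>'] by blast
  obtain C2 where C2: "C2 \<ge> 0"
    "\<And>y x. \<bar>y\<bar> \<le> 1 \<Longrightarrow> cmod (iter_deriv n (\<lambda>x. \<eta> x * (cis (2 * pi * x * y) - 1)) x) \<le> C2 * \<bar>y\<bar>"
    using Suc.IH[OF Suc.prems] by blast
  obtain B where B: "B \<ge> 0" "\<And>x. cmod (iter_deriv n \<eta> x) \<le> B"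
    using test_fun_bounded[OF test_fun_iter_deriv[OF Suc.prems]] by blast
  have "cmod (iter_deriv (Suc n) (\<lambda>x. \<eta> x * (cis (2 * pi * x * y) - 1)) x) \<le> (C1 + 2 * pi * (C2 + B)) * \<bar>y\<bar>"
    if y: "\<bar>y\<bar> \<le> 1" for x y
  proof -
    define E where "E = (\<lambda>x. cis (2 * pi * x * y) - 1)"
    define c where "c = 2 * pi * \<i> * y"
    have E: "smooth E" unfolding E_def by (intro smooth_diff smooth_character smooth_const)
    have sm: "smooth \<eta>" "smooth \<eta>'" using Suc.prems \<eta>' by (auto intro: test_fun_smooth)
    have "((\<lambda>x. \<eta> x * E x) has_vector_derivative \<eta>' x * E x + (c * (\<eta> x * E x) + c * \<eta> x)) (at x)" for x
    proof -
      have "(\<eta> has_vector_derivative \<eta>' x) (at x)"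
        unfolding \<eta>'_def by (rule smooth_has_vector_derivative[OF sm(1)])
      moreover have "(E has_vector_derivative c * cis (2 * pi * x * y) - 0) (at x)"
        unfolding E_def c_def
        by (intro has_vector_derivative_diff has_vector_derivative_character has_vector_derivative_const)
      ultimately show ?thesis
        using has_vector_derivative_mult[of \<eta> "\<eta>' x" x UNIV E "c * cis (2 * pi * x * y) - 0"]
        by (simp add: E_def algebra_simps)
    qed
    then have "iter_deriv (Suc n) (\<lambda>x. \<eta> x * E x) =
       iter_deriv n (\<lambda>x. \<eta>' x * E x + (c * (\<eta> x * E x) + c * \<eta> x))"
      by (rule iter_deriv_Suc_eq)
    also have "\<dots> = (\<lambda>x. iter_deriv n (\<lambda>x. \<eta>' x * E x) x +
        (c * iter_deriv n (\<lambda>x. \<eta> x * E x) x + c * iter_deriv n \<eta> x))"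
      using sm E by (simp add: iter_deriv_add iter_deriv_cmult smooth_mult smooth_add smooth_cmult)
    finally have eq: "iter_deriv (Suc n) (\<lambda>x. \<eta> x * E x) x = iter_deriv n (\<lambda>x. \<eta>' x * E x) x +
        (c * iter_deriv n (\<lambda>x. \<eta> x * E x) x + c * iter_deriv n \<eta> x)"
      by simp
    have c: "cmod c = 2 * pi * \<bar>y\<bar>" by (simp add: c_def norm_mult)
    have 1: "cmod (iter_deriv n (\<lambda>x. \<eta>' x * E x) x) \<le> C1 * \<bar>y\<bar>" using C1(2)[OF y] by (simp add: E_def)
    have "cmod (iter_deriv n (\<lambda>x. \<eta> x * E x) x) \<le> C2"
      using C2(2)[OF y, of x] mult_left_mono[OF y C2(1)] by (simp add: E_def)
    then have 2: "cmod (c * iter_deriv n (\<lambda>x. \<eta> x * E x) x) \<le> 2 * pi * \<bar>y\<bar> * C2"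
      unfolding norm_mult c by (intro mult_left_mono) auto
    have 3: "cmod (c * iter_deriv n \<eta> x) \<le> 2 * pi * \<bar>y\<bar> * B"
      unfolding norm_mult c by (intro mult_left_mono B(2)) auto
    have "cmod (iter_deriv (Suc n) (\<lambda>x. \<eta> x * E x) x) \<le>
        C1 * \<bar>y\<bar> + (2 * pi * \<bar>y\<bar> * C2 + 2 * pi * \<bar>y\<bar> * B)"
      unfolding eq using 1 2 3 by (intro norm_triangle_le add_mono) auto
    then show ?thesis by (simp add: E_def algebra_simps)
  qed
  then show ?case using C1 C2 B by (intro exI[of _ "C1 + 2 * pi * (C2 + B)"]) auto
qed

text \<open>
  The defining seminorm estimate of a distribution bounds the difference by finitely many derivatives
  of \<open>\<eta> (e - 1)\<close>, all of which are \<open>O(y)\<close>.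
\<close>

theorem fourier_tendsto_at_0:
  assumes "compactly_supported_distribution T"
  shows "(fourier T \<longlongrightarrow> total_integral T) (at 0)"
proof -
  obtain R0 where D: "distribution T" and "R0 > 0" and
    pair: "\<And>\<eta> \<psi>. test_fun \<eta> \<Longrightarrow> (\<And>x. \<bar>x\<bar> < R0 \<Longrightarrow> \<eta> x = 1) \<Longrightarrow> smooth \<psi> \<Longrightarrow> pairing T \<psi> = T (\<lambda>x. \<eta> x * \<psi> x)"
    using compactly_supported_distribution_obtain[OF assms] by blast
  define \<eta> where "\<eta> = plateau R0"
  have \<eta>: "test_fun \<eta>" "\<And>x. \<bar>x\<bar> < R0 \<Longrightarrow> \<eta> x = 1" "\<And>x. \<bar>x\<bar> > R0 + 1 \<Longrightarrow> \<eta> x = 0"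
    by (auto simp: \<eta>_def test_fun_plateau plateau_eq_1 plateau_eq_0)
  define G where "G y = (\<lambda>x. \<eta> x * (cis (2 * pi * x * y) - 1))" for y
  have G: "test_fun (G y)" "fun_support (G y) \<subseteq> {- (R0 + 1)..R0 + 1}" for y
    unfolding G_def
    by (intro test_fun_mult_smooth smooth_diff smooth_character smooth_const \<eta>(1))
      (intro compact_fun_supportI(2), simp add: \<eta>(3))
  have diff: "fourier T y - total_integral T = T (G y)" for y
  proof -
    have "fourier T y - total_integral T = T (\<lambda>x. \<eta> x * cis (2 * pi * x * y)) - T (\<lambda>x. \<eta> x * 1)"
      unfolding fourier_def total_integral_def
      by (simp only: pair[OF \<eta>(1,2) smooth_character] pair[OF \<eta>(1,2) smooth_const])
    also have "\<dots> = T (\<lambda>x. \<eta> x * cis (2 * pi * x * y) - \<eta> x * 1)"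
      by (intro distribution_diff[symmetric] D test_fun_mult_smooth \<eta> smooth_character smooth_const)
    finally show ?thesis by (simp add: G_def right_diff_distrib)
  qed
  obtain C N where CN: "\<And>\<phi>. test_fun \<phi> \<Longrightarrow> fun_support \<phi> \<subseteq> {- (R0 + 1)..R0 + 1} \<Longrightarrow>
           cmod (T \<phi>) \<le> C * (\<Sum>n\<le>N. SUP x. cmod (iter_deriv n \<phi> x))"
  proof -
    have "compact {- (R0 + 1)..R0 + 1}" by (rule compact_Icc)
    then show ?thesis using D that unfolding distribution_def by blast
  qed
  obtain B where B: "\<And>n. B n \<ge> 0"
    "\<And>n y x. \<bar>y\<bar> \<le> 1 \<Longrightarrow> cmod (iter_deriv n (G y) x) \<le> B n * \<bar>y\<bar>"
    using iter_deriv_character_minus_1[OF \<eta>(1)] unfolding G_def by metis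
  have bound: "cmod (fourier T y - total_integral T) \<le> (\<bar>C\<bar> * (\<Sum>n\<le>N. B n)) * \<bar>y\<bar>" if y: "\<bar>y\<bar> \<le> 1" for y
  proof -
    let ?S = "\<lambda>n. SUP x. cmod (iter_deriv n (G y) x)"
    have S: "?S n \<le> B n * \<bar>y\<bar>" for n by (intro cSUP_least B y) auto
    have S0: "0 \<le> ?S n" for n
    proof -
      have "bdd_above (range (\<lambda>x. cmod (iter_deriv n (G y) x)))" using B(2)[OF y] by (auto intro!: bdd_aboveI2)
      then have "cmod (iter_deriv n (G y) 0) \<le> ?S n" by (intro cSUP_upper) auto
      then show ?thesis by (rule order_trans[OF norm_ge_zero])
    qed
    have "cmod (T (G y)) \<le> C * (\<Sum>n\<le>N. ?S n)" by (rule CN[OF G])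
    also have "\<dots> \<le> \<bar>C\<bar> * (\<Sum>n\<le>N. ?S n)" using S0 by (intro mult_right_mono sum_nonneg) auto
    also have "\<dots> \<le> \<bar>C\<bar> * (\<Sum>n\<le>N. B n * \<bar>y\<bar>)" using S by (intro mult_left_mono sum_mono) auto
    finally show ?thesis by (simp add: diff sum_distrib_right mult.assoc)
  qed
  have "((\<lambda>y. fourier T y - total_integral T) \<longlongrightarrow> 0) (at 0)"
  proof (rule Lim_null_comparison)
    show "\<forall>\<^sub>F y in at 0. norm (fourier T y - total_integral T) \<le> (\<bar>C\<bar> * (\<Sum>n\<le>N. B n)) * \<bar>y\<bar>"
      unfolding eventually_at using bound by (intro exI[of _ 1]) (auto simp: dist_norm)
    show "((\<lambda>y. (\<bar>C\<bar> * (\<Sum>n\<le>N. B n)) * \<bar>y\<bar>) \<longlongrightarrow> 0) (at (0::real))"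
      by (rule tendsto_eq_intros refl | simp)+
  qed
  then show ?thesis by (simp add: LIM_zero_iff)
qed

section \<open>Convergence of logarithmic means from convergence of moments\<close>

text \<open>
  The measure of \<open>{u < \<epsilon>}\<close> is at most a multiple of \<open>\<epsilon>\<close> to the power \<open>1 / n\<close>; parametrising
  the threshold by \<open>\<eta>\<close> avoids the root.
\<close>

definition thin_sublevels :: "'a measure \<Rightarrow> ('a \<Rightarrow> real) \<Rightarrow> real \<Rightarrow> nat \<Rightarrow> real \<Rightarrow> bool" where
  "thin_sublevels M u \<kappa> n C \<longleftrightarrow>
     (\<forall>\<eta>. 0 < \<eta> \<longrightarrow> \<eta> \<le> 1 \<longrightarrow> emeasure M {x \<in> space M. u x < \<kappa> * \<eta> ^ n} \<le> ennreal (C * \<eta>))"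

text \<open>
  If \<open>v\<close> is smaller than the threshold by a factor \<open>exp (- D)\<close>, then it lies below about
  \<open>D / (n ln 2)\<close> of the thresholds on the right.  For \<open>v = 0\<close> it lies below all of them and the right
  side is infinite.
\<close>

lemma abs_ln_truncation_le_suminf:
  fixes v \<kappa> \<eta> :: real
  assumes "v \<ge> 0" "\<kappa> > 0" "\<eta> > 0" "n \<ge> 1"
  shows "ennreal \<bar>ln (max v (\<kappa> * \<eta> ^ n)) - ln v\<bar>
    \<le> of_nat n * suminf (\<lambda>k. indicator {..<\<kappa> * (\<eta> * (1 / 2) ^ k) ^ n} v)"
proof (cases "v < \<kappa> * \<eta> ^ n")
  case False
  then show ?thesis by (simp add: max_def)
next
  case True
  define \<epsilon> where "\<epsilon> = \<kappa> * \<eta> ^ n"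
  have \<epsilon>: "\<epsilon> > 0" using assms by (simp add: \<epsilon>_def)
  define D where "D = \<bar>ln \<epsilon> - ln v\<bar>"
  have threshold: "\<kappa> * (\<eta> * (1 / 2) ^ k) ^ n = \<epsilon> / 2 ^ (k * n)" for k
    by (simp add: \<epsilon>_def power_mult_distrib power_mult[symmetric] power_divide)
  obtain N where N: "D \<le> real n * real N" and small: "\<And>k. k < N \<Longrightarrow> v < \<epsilon> / 2 ^ (k * n)"
  proof (cases "v = 0")
    case True
    obtain N :: nat where N: "D \<le> real N" using real_arch_simple by blast
    also have "\<dots> \<le> real n * real N" using assms(4) by (simp add: mult_le_cancel_right1)
    finally show ?thesis using True \<epsilon> by (intro that[of N]) auto
  next
    case False
    then have v: "v > 0" using assms by simp
    have "ln v < ln \<epsilon>" using v True \<epsilon> by (simp add: \<epsilon>_def[symmetric])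
    then have D: "D = ln \<epsilon> - ln v" "D > 0" by (simp_all add: D_def)
    define N where "N = nat \<lceil>D / (real n * ln 2)\<rceil>"
    have pos: "real n * ln 2 > 0" using assms(4) by simp
    have "D / (real n * ln 2) \<le> real N" unfolding N_def by linarith
    then have "D \<le> real n * ln 2 * real N" using pos by (simp add: field_simps)
    also have "\<dots> \<le> real n * 1 * real N"
      using ln_2_less_1 by (intro mult_right_mono mult_left_mono) auto
    finally have "D \<le> real n * real N" by simp
    moreover have "v < \<epsilon> / 2 ^ (k * n)" if "k < N" for k
    proof -
      have "real k < D / (real n * ln 2)" using that unfolding N_def by linarith
      then have "real (k * n) * ln 2 < ln \<epsilon> - ln v" using pos D by (simp add: field_simps)
      then have "ln v < ln \<epsilon> - ln (2 ^ (k * n))" by (simp add: ln_realpow)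
      also have "\<dots> = ln (\<epsilon> / 2 ^ (k * n))" using \<epsilon> by (simp add: ln_div)
      finally show ?thesis using v \<epsilon> by (subst (asm) ln_less_cancel_iff) auto
    qed
    ultimately show ?thesis by (rule that)
  qed
  have "ennreal D \<le> ennreal (real n * real N)" using N by (simp add: ennreal_leI)
  also have "\<dots> = of_nat n * of_nat N" by (simp add: ennreal_mult ennreal_of_nat_eq_real_of_nat)
  also have "of_nat N = (\<Sum>k<N. 1 :: ennreal)" by simp
  also have "\<dots> = (\<Sum>k<N. indicator {..<\<epsilon> / 2 ^ (k * n)} v)"
    using small by (intro sum.cong) (auto simp: indicator_def)
  also have "of_nat n * \<dots> \<le> of_nat n * suminf (\<lambda>k. indicator {..<\<epsilon> / 2 ^ (k * n)} v)"
    by (intro mult_left_mono sum_le_suminf) auto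
  finally show ?thesis using True by (simp add: D_def threshold \<epsilon>_def[symmetric] max_def)
qed

text \<open>
  Integrating the preceding bound termwise gives a geometric series with ratio \<open>1 / 2\<close>.
\<close>

lemma nn_integral_ln_truncation:
  assumes [measurable]: "u \<in> borel_measurable M"
    and "\<And>x. u x \<ge> 0" "\<kappa> > 0" "n \<ge> 1" "C \<ge> 0" "thin_sublevels M u \<kappa> n C" "0 < \<eta>" "\<eta> \<le> 1"
  shows "(\<integral>\<^sup>+x. ennreal \<bar>ln (max (u x) (\<kappa> * \<eta> ^ n)) - ln (u x)\<bar> \<partial>M) \<le> ennreal (2 * real n * C * \<eta>)"
proof -
  let ?t = "\<lambda>k. \<kappa> * (\<eta> * (1 / 2) ^ k) ^ n"
  have "(\<integral>\<^sup>+x. ennreal \<bar>ln (max (u x) (\<kappa> * \<eta> ^ n)) - ln (u x)\<bar> \<partial>M)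
      \<le> (\<integral>\<^sup>+x. of_nat n * suminf (\<lambda>k. indicator {..<?t k} (u x)) \<partial>M)"
    by (intro nn_integral_mono abs_ln_truncation_le_suminf assms)
  also have "\<dots> = of_nat n * suminf (\<lambda>k. \<integral>\<^sup>+x. indicator {..<?t k} (u x) \<partial>M)"
    by (simp add: nn_integral_cmult nn_integral_suminf)
  also have "\<dots> \<le> of_nat n * suminf (\<lambda>k. ennreal (C * \<eta> * (1 / 2) ^ k))"
  proof (intro mult_left_mono suminf_le)
    fix k
    have "(\<integral>\<^sup>+x. indicator {..<?t k} (u x) \<partial>M) = (\<integral>\<^sup>+x. indicator {x \<in> space M. u x < ?t k} x \<partial>M)"
      by (intro nn_integral_cong) (auto simp: indicator_def)
    also have "\<dots> = emeasure M {x \<in> space M. u x < ?t k}" by simp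
    also have "\<dots> \<le> ennreal (C * (\<eta> * (1 / 2) ^ k))"
    proof -
      have "\<eta> * (1 / 2) ^ k \<le> 1 * 1" using assms(7,8) by (intro mult_mono power_le_one) auto
      then show ?thesis using assms(6,7) unfolding thin_sublevels_def by simp
    qed
    finally show "(\<integral>\<^sup>+x. indicator {..<?t k} (u x) \<partial>M) \<le> ennreal (C * \<eta> * (1 / 2) ^ k)"
      by (simp add: mult.assoc)
  qed auto
  also have "suminf (\<lambda>k. ennreal (C * \<eta> * (1 / 2) ^ k)) = ennreal (C * \<eta> * 2)"
  proof (rule suminf_ennreal_eq)
    show "(\<lambda>k. C * \<eta> * (1 / 2) ^ k) sums (C * \<eta> * 2)"
      using geometric_sums[of "1 / 2 :: real"] by (intro sums_mult) simp
  qed (use assms in auto)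
  also have "of_nat n * ennreal (C * \<eta> * 2) = ennreal (2 * real n * C * \<eta>)"
    using assms by (simp add: ennreal_of_nat_eq_real_of_nat ennreal_mult[symmetric] mult_ac)
  finally show ?thesis .
qed

lemma continuous_ln_max: 
  fixes \<epsilon> :: real assumes "\<epsilon> > 0" shows "continuous_on UNIV (\<lambda>v. ln (max v \<epsilon>))"
  using assms by (intro continuous_intros ballI) (auto simp: max_def)

lemma (in prob_space) integrable_continuous_bounded:
  fixes g :: "real \<Rightarrow> real"
  assumes [measurable]: "u \<in> borel_measurable M" and "\<And>x. 0 \<le> u x" "\<And>x. u x \<le> B"
    and g: "continuous_on UNIV g"
  shows "integrable M (\<lambda>x. g (u x))"
proof -
  have "bounded (g ` {0..B})"
    by (intro compact_imp_bounded compact_continuous_image continuous_on_subset[OF g]) auto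
  then obtain K where "\<And>v. v \<in> {0..B} \<Longrightarrow> norm (g v) \<le> K" unfolding bounded_iff by blast
  moreover have [measurable]: "g \<in> borel_measurable borel"
    by (rule borel_measurable_continuous_onI[OF g])
  ultimately show ?thesis
    using assms(2,3) by (intro integrable_const_bound[where B = K] AE_I2) auto
qed

lemma (in prob_space) integral_ln_truncation:
  assumes [measurable]: "u \<in> borel_measurable M"
    and u: "\<And>x. u x \<ge> 0" "\<And>x. u x \<le> B"
    and "\<kappa> > 0" "n \<ge> 1" "C \<ge> 0" "thin_sublevels M u \<kappa> n C" "0 < \<eta>" "\<eta> \<le> 1"
  shows "integrable M (\<lambda>x. ln (u x))"
    and "\<bar>(\<integral>x. ln (max (u x) (\<kappa> * \<eta> ^ n)) \<partial>M) - (\<integral>x. ln (u x) \<partial>M)\<bar> \<le> 2 * real n * C * \<eta>"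
proof -
  let ?g = "\<lambda>v. ln (max v (\<kappa> * \<eta> ^ n))"
  have g: "integrable M (\<lambda>x. ?g (u x))"
    using assms by (intro integrable_continuous_bounded[OF assms(1) u continuous_ln_max]) simp
  note le = nn_integral_ln_truncation[OF assms(1) u(1) assms(4-9)]
  have d: "integrable M (\<lambda>x. ?g (u x) - ln (u x))"
  proof (rule integrableI_bounded)
    have "(\<integral>\<^sup>+x. ennreal (norm (?g (u x) - ln (u x))) \<partial>M) \<le> ennreal (2 * real n * C * \<eta>)" using le by simp
    then show "(\<integral>\<^sup>+x. ennreal (norm (?g (u x) - ln (u x))) \<partial>M) < \<infinity>"
      by (rule order_le_less_trans) simp
  qed simp
  show "integrable M (\<lambda>x. ln (u x))"
    using Bochner_Integration.integrable_diff[OF g d] by simp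
  then have "(\<integral>x. ?g (u x) \<partial>M) - (\<integral>x. ln (u x) \<partial>M) = (\<integral>x. ?g (u x) - ln (u x) \<partial>M)"
    using g by simp
  also have "\<bar>\<dots>\<bar> \<le> (\<integral>x. \<bar>?g (u x) - ln (u x)\<bar> \<partial>M)"
    using integral_norm_bound[of M "\<lambda>x. ?g (u x) - ln (u x)"] by simp
  also have "\<dots> \<le> 2 * real n * C * \<eta>"
    using assms by (intro integral_real_bounded le) simp
  finally show "\<bar>(\<integral>x. ?g (u x) \<partial>M) - (\<integral>x. ln (u x) \<partial>M)\<bar> \<le> 2 * real n * C * \<eta>" .
qed

text \<open>
  By the Weierstrass approximation theorem on \<open>[0, B]\<close>, \<open>g\<close> may be replaced by a polynomial, whose
  integral is a combination of moments.
\<close>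

lemma tendsto_integral_of_moments:
  fixes g :: "real \<Rightarrow> real"
  assumes M: "\<forall>\<^sub>F R in F. prob_space (M R) \<and> u \<in> borel_measurable (M R)"
    and N: "prob_space N" "U \<in> borel_measurable N"
    and u: "\<And>x. 0 \<le> u x" "\<And>x. u x \<le> B" and U: "\<And>x. 0 \<le> U x" "\<And>x. U x \<le> B"
    and moments: "\<And>k. ((\<lambda>R. \<integral>x. u x ^ k \<partial>M R) \<longlongrightarrow> (\<integral>x. U x ^ k \<partial>N)) F"
    and g: "continuous_on UNIV g"
  shows "((\<lambda>R. \<integral>x. g (u x) \<partial>M R) \<longlongrightarrow> (\<integral>x. g (U x) \<partial>N)) F"
proof (rule tendstoI)
  fix e :: real assume "e > 0"
  obtain p where p: "real_polynomial_function p" "\<And>x. x \<in> {0..B} \<Longrightarrow> \<bar>g x - p x\<bar> < e / 3"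
    using Stone_Weierstrass_real_polynomial_function[of "{0..B}" g "e / 3"]
      continuous_on_subset[OF g] \<open>e > 0\<close> by auto
  obtain a n where p_eq: "p = (\<lambda>x. \<Sum>i\<le>n. a i * x ^ i)"
    using p(1) real_polynomial_function_iff_sum by blast
  have p_cont: "continuous_on UNIV p" unfolding p_eq by (intro continuous_intros)
  have near: "\<bar>(\<integral>x. g (v x) \<partial>L) - (\<integral>x. p (v x) \<partial>L)\<bar> \<le> e / 3"
    and p_int: "(\<integral>x. p (v x) \<partial>L) = (\<Sum>i\<le>n. a i * (\<integral>x. v x ^ i \<partial>L))"
    if L: "prob_space L" "v \<in> borel_measurable L" and v: "\<And>x. 0 \<le> v x" "\<And>x. v x \<le> B" for L and v :: "'x \<Rightarrow> real"
  proof -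
    interpret prob_space L by (rule L)
    note int = integrable_continuous_bounded[OF L(2) v]
    have "(\<integral>x. g (v x) \<partial>L) - (\<integral>x. p (v x) \<partial>L) = (\<integral>x. g (v x) - p (v x) \<partial>L)"
      using int[OF g] int[OF p_cont] by simp
    also have "\<bar>\<dots>\<bar> \<le> (\<integral>x. \<bar>g (v x) - p (v x)\<bar> \<partial>L)"
      using integral_norm_bound[of L "\<lambda>x. g (v x) - p (v x)"] by simp
    also have "\<dots> \<le> (\<integral>x. e / 3 \<partial>L)"
      using int[OF g] int[OF p_cont] p(2) v by (intro integral_mono) (auto intro: less_imp_le)
    finally show "\<bar>(\<integral>x. g (v x) \<partial>L) - (\<integral>x. p (v x) \<partial>L)\<bar> \<le> e / 3"
      by (simp add: prob_space)
    have "integrable L (\<lambda>x. v x ^ i)" for i by (rule int) (intro continuous_intros)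
    then show "(\<integral>x. p (v x) \<partial>L) = (\<Sum>i\<le>n. a i * (\<integral>x. v x ^ i \<partial>L))"
      unfolding p_eq by simp
  qed
  have "((\<lambda>R. \<Sum>i\<le>n. a i * (\<integral>x. u x ^ i \<partial>M R)) \<longlongrightarrow> (\<Sum>i\<le>n. a i * (\<integral>x. U x ^ i \<partial>N))) F"
    by (intro tendsto_intros moments)
  then have "\<forall>\<^sub>F R in F. dist (\<Sum>i\<le>n. a i * (\<integral>x. u x ^ i \<partial>M R)) (\<Sum>i\<le>n. a i * (\<integral>x. U x ^ i \<partial>N)) < e / 3"
    using \<open>e > 0\<close> by (intro tendstoD) auto
  with M show "\<forall>\<^sub>F R in F. dist (\<integral>x. g (u x) \<partial>M R) (\<integral>x. g (U x) \<partial>N) < e"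
  proof eventually_elim
    case (elim R)
    then have R: "prob_space (M R)" "u \<in> borel_measurable (M R)" by auto
    show ?case
      using elim(2) near[OF R u] near[OF N U] unfolding p_int[OF R u] p_int[OF N U] dist_real_def
      by linarith
  qed
qed

text \<open>
  A continuous function between the indicators of \<open>{v < \<epsilon>}\<close> and \<open>{v < 2 \<epsilon>}\<close> transports the bound
  to the limit at the cost of doubling the threshold, that is of replacing \<open>\<eta>\<close> by at most \<open>2 \<eta>\<close>.
  When \<open>2 \<eta>\<close> exceeds \<open>1\<close> the bound on the total mass is used, which is the reason for the summand \<open>2\<close>.
\<close>

lemma thin_sublevels_limit:
  assumes F: "F \<noteq> bot"
    and M: "\<forall>\<^sub>F R in F. prob_space (M R) \<and> u \<in> borel_measurable (M R) \<and> thin_sublevels (M R) u \<kappa> n C"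
    and N: "prob_space N" "U \<in> borel_measurable N"
    and u: "\<And>x. 0 \<le> u x" "\<And>x. u x \<le> B" and U: "\<And>x. 0 \<le> U x" "\<And>x. U x \<le> B"
    and moments: "\<And>k. ((\<lambda>R. \<integral>x. u x ^ k \<partial>M R) \<longlongrightarrow> (\<integral>x. U x ^ k \<partial>N)) F"
    and "\<kappa> > 0" "n \<ge> 1" "C \<ge> 0"
  shows "thin_sublevels N U \<kappa> n (2 * C + 2)"
  unfolding thin_sublevels_def
proof (intro allI impI)
  fix \<eta> :: real assume \<eta>: "0 < \<eta>" "\<eta> \<le> 1"
  interpret N: prob_space N by (rule N)
  note [measurable] = N(2)
  show "emeasure N {x \<in> space N. U x < \<kappa> * \<eta> ^ n} \<le> ennreal ((2 * C + 2) * \<eta>)"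
  proof (cases "\<eta> \<le> 1 / 2")
    case False
    have "0 \<le> C * \<eta>" using \<eta> \<open>C \<ge> 0\<close> by simp
    then have "(1 :: real) \<le> (2 * C + 2) * \<eta>" using False by (simp add: algebra_simps)
    then have "ennreal 1 \<le> ennreal ((2 * C + 2) * \<eta>)" by (rule ennreal_leI)
    moreover have "emeasure N {x \<in> space N. U x < \<kappa> * \<eta> ^ n} \<le> ennreal 1"
      using N.emeasure_le_1 by simp
    ultimately show ?thesis by (rule order_trans[rotated])
  next
    case True
    define \<epsilon> where "\<epsilon> = \<kappa> * \<eta> ^ n"
    have \<epsilon>: "\<epsilon> > 0" using \<eta> \<open>\<kappa> > 0\<close> by (simp add: \<epsilon>_def)
    define \<phi> where "\<phi> v = max 0 (min 1 (2 - v / \<epsilon>))" for v :: real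
    have \<phi>: "continuous_on UNIV \<phi>" unfolding \<phi>_def using \<epsilon> by (intro continuous_intros) auto
    have "2 * \<epsilon> \<le> \<kappa> * (2 * \<eta>) ^ n"
    proof -
      have "(2::real) ^ 1 \<le> 2 ^ n" using \<open>n \<ge> 1\<close> by (intro power_increasing) auto
      then show ?thesis using \<eta> \<open>\<kappa> > 0\<close> by (simp add: \<epsilon>_def power_mult_distrib)
    qed
    then have \<phi>_0: "\<phi> v = 0" if "\<not> v < \<kappa> * (2 * \<eta>) ^ n" for v
    proof -
      have "v \<ge> 2 * \<epsilon>" using that \<open>2 * \<epsilon> \<le> _\<close> by linarith
      then have "v / \<epsilon> \<ge> 2" using \<epsilon> by (simp add: field_simps)
      then show ?thesis by (simp add: \<phi>_def)
    qed
    have \<phi>_1: "\<phi> v = 1" if "v < \<epsilon>" for v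
    proof -
      have "v / \<epsilon> \<le> 1" using that \<epsilon> by (simp add: field_simps)
      then show ?thesis by (simp add: \<phi>_def)
    qed
    have \<phi>_01: "0 \<le> \<phi> v" "\<phi> v \<le> 1" for v by (auto simp: \<phi>_def)
    have "((\<lambda>R. \<integral>x. \<phi> (u x) \<partial>M R) \<longlongrightarrow> (\<integral>x. \<phi> (U x) \<partial>N)) F"
      using M by (intro tendsto_integral_of_moments[OF _ N u U moments \<phi>]) (auto elim: eventually_mono)
    moreover have "\<forall>\<^sub>F R in F. (\<integral>x. \<phi> (u x) \<partial>M R) \<le> 2 * C * \<eta>"
      using M
    proof eventually_elim
      case (elim R)
      interpret prob_space "M R" using elim by simp
      have [measurable]: "u \<in> borel_measurable (M R)" using elim by simp
      let ?S = "{x \<in> space (M R). u x < \<kappa> * (2 * \<eta>) ^ n}"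
      have "(\<integral>x. \<phi> (u x) \<partial>M R) \<le> (\<integral>x. indicator ?S x \<partial>M R)"
      proof (rule integral_mono)
        show "integrable (M R) (\<lambda>x. \<phi> (u x))" by (intro integrable_continuous_bounded[OF _ u \<phi>]) simp
        show "integrable (M R) (indicator ?S :: _ \<Rightarrow> real)"
          by (rule integrable_real_indicator) (auto simp: emeasure_eq_measure)
        show "\<phi> (u x) \<le> indicator ?S x" if "x \<in> space (M R)" for x
          using that \<phi>_0[of "u x"] \<phi>_01(2)[of "u x"] by (simp add: indicator_def)
      qed
      also have "\<dots> = measure (M R) ?S" by simp
      also have "\<dots> \<le> C * (2 * \<eta>)"
      proof -
        have "emeasure (M R) ?S \<le> ennreal (C * (2 * \<eta>))"
          using elim[THEN conjunct2, THEN conjunct2, unfolded thin_sublevels_def, rule_format, of "2 * \<eta>"]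
            \<eta> True by simp
        moreover have "0 \<le> C * (2 * \<eta>)" using \<eta> \<open>C \<ge> 0\<close> by simp
        ultimately show ?thesis unfolding emeasure_eq_measure by (subst (asm) ennreal_le_iff)
      qed
      finally show ?case by simp
    qed
    ultimately have le: "(\<integral>x. \<phi> (U x) \<partial>N) \<le> 2 * C * \<eta>"
      using F by (intro tendsto_upperbound)
    have "measure N {x \<in> space N. U x < \<epsilon>} = (\<integral>x. indicator {x \<in> space N. U x < \<epsilon>} x \<partial>N)" by simp
    also have "\<dots> \<le> (\<integral>x. \<phi> (U x) \<partial>N)"
    proof (rule integral_mono)
      show "integrable N (\<lambda>x. \<phi> (U x))" by (intro N.integrable_continuous_bounded[OF _ U \<phi>]) simp
      show "integrable N (indicator {x \<in> space N. U x < \<epsilon>} :: _ \<Rightarrow> real)"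
        by (rule integrable_real_indicator) (auto simp: N.emeasure_eq_measure)
      show "indicator {x \<in> space N. U x < \<epsilon>} x \<le> \<phi> (U x)" if "x \<in> space N" for x
        using that \<phi>_1[of "U x"] \<phi>_01(1)[of "U x"] by (simp add: indicator_def)
    qed
    also have "\<dots> \<le> (2 * C + 2) * \<eta>" using le \<eta> by (simp add: algebra_simps)
    finally show ?thesis by (simp add: N.emeasure_eq_measure \<epsilon>_def ennreal_leI)
  qed
qed

text \<open>
  The truncated logarithms \<open>ln (max v \<epsilon>)\<close> are continuous, so their integrals converge; the error of
  the truncation is small uniformly along the filter and also in the limit.
\<close>

theorem tendsto_integral_ln_of_moments:
  assumes F: "F \<noteq> bot"
    and M: "\<forall>\<^sub>F R in F. prob_space (M R) \<and> u \<in> borel_measurable (M R) \<and> thin_sublevels (M R) u \<kappa> n C"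
    and N: "prob_space N" "U \<in> borel_measurable N"
    and u: "\<And>x. 0 \<le> u x" "\<And>x. u x \<le> B" and U: "\<And>x. 0 \<le> U x" "\<And>x. U x \<le> B"
    and moments: "\<And>k. ((\<lambda>R. \<integral>x. u x ^ k \<partial>M R) \<longlongrightarrow> (\<integral>x. U x ^ k \<partial>N)) F"
    and pos: "\<kappa> > 0" "n \<ge> 1" "C \<ge> 0"
  shows "((\<lambda>R. \<integral>x. ln (u x) \<partial>M R) \<longlongrightarrow> (\<integral>x. ln (U x) \<partial>N)) F"
proof (rule tendstoI)
  fix e :: real assume "e > 0"
  define \<eta> where "\<eta> = min 1 (e / (2 * real n * (2 * C + 2) * 4))"
  have \<eta>: "0 < \<eta>" "\<eta> \<le> 1" using \<open>e > 0\<close> pos by (auto simp: \<eta>_def intro!: divide_pos_pos mult_pos_pos)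
  have "\<eta> \<le> e / (2 * real n * (2 * C + 2) * 4)" by (simp add: \<eta>_def)
  then have e1: "2 * real n * (2 * C + 2) * \<eta> \<le> e / 4"
    using pos by (simp add: pos_le_divide_eq mult_ac)
  moreover have "2 * real n * C * \<eta> \<le> 2 * real n * (2 * C + 2) * \<eta>"
    using pos \<eta> by (intro mult_right_mono mult_left_mono) auto
  ultimately have e2: "2 * real n * C * \<eta> \<le> e / 4" by linarith
  let ?g = "\<lambda>v. ln (max v (\<kappa> * \<eta> ^ n))"
  note thinN = thin_sublevels_limit[OF F M N u U moments pos]
  have "\<bar>(\<integral>x. ?g (U x) \<partial>N) - (\<integral>x. ln (U x) \<partial>N)\<bar> \<le> 2 * real n * (2 * C + 2) * \<eta>"
    using pos \<eta> by (intro prob_space.integral_ln_truncation(2)[OF N U]) (auto intro: thinN)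
  then have dN: "\<bar>(\<integral>x. ?g (U x) \<partial>N) - (\<integral>x. ln (U x) \<partial>N)\<bar> \<le> e / 4" using e1 by linarith
  have "((\<lambda>R. \<integral>x. ?g (u x) \<partial>M R) \<longlongrightarrow> (\<integral>x. ?g (U x) \<partial>N)) F"
    using M pos \<eta> by (intro tendsto_integral_of_moments[OF _ N u U moments continuous_ln_max])
      (auto elim: eventually_mono)
  then have "\<forall>\<^sub>F R in F. dist (\<integral>x. ?g (u x) \<partial>M R) (\<integral>x. ?g (U x) \<partial>N) < e / 4"
    using \<open>e > 0\<close> by (intro tendstoD) auto
  with M show "\<forall>\<^sub>F R in F. dist (\<integral>x. ln (u x) \<partial>M R) (\<integral>x. ln (U x) \<partial>N) < e"
  proof eventually_elim
    case (elim R)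
    then have "\<bar>(\<integral>x. ?g (u x) \<partial>M R) - (\<integral>x. ln (u x) \<partial>M R)\<bar> \<le> 2 * real n * C * \<eta>"
      using pos \<eta> by (intro prob_space.integral_ln_truncation(2)[OF _ _ u]) auto
    then show ?case using elim dN e2 \<open>e > 0\<close> unfolding dist_real_def by linarith
  qed
qed

section \<open>Sublevel sets of exponential sums\<close>

text \<open>
  Working with intervals of any kind, rather than with closed ones, makes it unnecessary to name the
  end points of the pieces in the induction below.
\<close>

lemma interval_sublevel_of_monotone:
  fixes h :: "real \<Rightarrow> real"
  assumes S: "is_interval S" and mono: "\<And>x y. x \<in> S \<Longrightarrow> y \<in> S \<Longrightarrow> x \<le> y \<Longrightarrow> h x \<le> h y"
  shows "is_interval {x \<in> S. h x \<le> c}" "is_interval {x \<in> S. h x \<ge> c}"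
proof -
  note S = S[unfolded is_interval_1, rule_format]
  show "is_interval {x \<in> S. h x \<le> c}" unfolding is_interval_1
  proof safe
    fix a b x assume *: "a \<in> S" "b \<in> S" "h b \<le> c" "a \<le> x" "x \<le> b"
    show "x \<in> S" by (rule S[of a b]) (use * in auto)
    then show "h x \<le> c" using mono[of x b] * by linarith
  qed
  show "is_interval {x \<in> S. h x \<ge> c}" unfolding is_interval_1
  proof safe
    fix a b x assume *: "a \<in> S" "b \<in> S" "c \<le> h a" "a \<le> x" "x \<le> b"
    show "x \<in> S" by (rule S[of a b]) (use * in auto)
    then show "c \<le> h x" using mono[of a x] * by linarith
  qed
qed

text \<open>
  The sublevel estimate of van der Corput, by induction on \<open>k\<close>.  Since \<open>g k\<close> increases at rate at
  least \<open>c\<close>, it is smaller than \<open>c \<eta>\<close> in absolute value only on a set of diameter at most \<open>2 \<eta>\<close>.  The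
  rest consists of two intervals on which \<open>g k\<close> is at least \<open>c \<eta>\<close> or at most \<open>- c \<eta>\<close>, and the
  induction hypothesis applies to \<open>g\<close> or to \<open>- g\<close> with \<open>c \<eta>\<close> for \<open>c\<close>.
\<close>

lemma emeasure_sublevel_le:
  fixes g :: "nat \<Rightarrow> real \<Rightarrow> real"
  assumes deriv: "\<And>i x. (g i has_real_derivative g (Suc i) x) (at x)"
    and S: "is_interval S" "S \<in> sets borel"
    and c: "c > 0" "\<And>x. x \<in> S \<Longrightarrow> g k x \<ge> c" and \<eta>: "0 < \<eta>"
  shows "emeasure lborel {x \<in> S. \<bar>g 0 x\<bar> < c * \<eta> ^ k} \<le> ennreal ((4 * 2 ^ k - 4) * \<eta>)"
  using assms
proof (induction k arbitrary: g S c)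
  case 0
  have "{x \<in> S. \<bar>g 0 x\<bar> < c * \<eta> ^ 0} = {}" using 0(5) by force
  then show ?case by (simp only: emeasure_empty zero_le)
next
  case (Suc k)
  note deriv = Suc.prems(1) and S = Suc.prems(2,3) and c = Suc.prems(4,5)
  have meas [measurable]: "g i \<in> borel_measurable borel" for i
    by (intro borel_measurable_continuous_onI continuous_at_imp_continuous_on ballI DERIV_isCont[OF deriv])
  note [measurable] = S(2)
  let ?h = "g k"
  have incr: "?h y - ?h x \<ge> c * (y - x)" if "x \<in> S" "y \<in> S" "x \<le> y" for x y
  proof (cases "x = y")
    case False
    then have "x < y" using that by simp
    then obtain z where z: "x < z" "z < y" "?h y - ?h x = (y - x) * g (Suc k) z"
      using MVT2[of x y ?h "g (Suc k)"] deriv by blast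
    have "z \<in> S" using mem_is_interval_1_I[OF S(1) that(1,2), of z] z by simp
    then have "g (Suc k) z \<ge> c" by (rule c(2))
    then show ?thesis using z \<open>x < y\<close> by (simp add: mult.commute[of c] mult_left_mono)
  qed simp
  have mono: "?h x \<le> ?h y" if "x \<in> S" "y \<in> S" "x \<le> y" for x y
  proof -
    have "0 \<le> c * (y - x)" using c(1) that by simp
    then show ?thesis using incr[OF that] by linarith
  qed
  let ?E = "\<lambda>S. {x \<in> S. \<bar>g 0 x\<bar> < c * \<eta> ^ Suc k}"
  define L where "L = {x \<in> S. ?h x \<le> - (c * \<eta>)}"
  define M where "M = {x \<in> S. \<bar>?h x\<bar> < c * \<eta>}"
  define R where "R = {x \<in> S. ?h x \<ge> c * \<eta>}"
  have [measurable]: "L \<in> sets borel" "M \<in> sets borel" "R \<in> sets borel"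
    unfolding L_def M_def R_def by measurable
  have c\<eta>: "c * \<eta> > 0" using c \<eta> by simp
  have R_le: "emeasure lborel (?E R) \<le> ennreal ((4 * 2 ^ k - 4) * \<eta>)"
  proof -
    have "emeasure lborel {x \<in> R. \<bar>g 0 x\<bar> < (c * \<eta>) * \<eta> ^ k} \<le> ennreal ((4 * 2 ^ k - 4) * \<eta>)"
      by (rule Suc.IH[where g = g, OF deriv _ _ c\<eta> _ \<eta>])
        (use interval_sublevel_of_monotone(2)[OF S(1) mono] in \<open>auto simp: R_def\<close>)
    then show ?thesis by (simp add: mult.assoc)
  qed
  have L_le: "emeasure lborel (?E L) \<le> ennreal ((4 * 2 ^ k - 4) * \<eta>)"
  proof -
    have "emeasure lborel {x \<in> L. \<bar>- g 0 x\<bar> < (c * \<eta>) * \<eta> ^ k} \<le> ennreal ((4 * 2 ^ k - 4) * \<eta>)"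
    proof (rule Suc.IH[where g = "\<lambda>i x. - g i x", OF _ _ _ c\<eta> _ \<eta>])
      show "((\<lambda>x. - g i x) has_real_derivative - g (Suc i) x) (at x)" for i x
        by (intro DERIV_minus deriv)
    qed (use interval_sublevel_of_monotone(1)[OF S(1) mono] in \<open>auto simp: L_def\<close>)
    then show ?thesis by (simp add: mult.assoc)
  qed
  have M_le: "emeasure lborel (?E M) \<le> ennreal (4 * \<eta>)"
  proof (cases "M = {}")
    case False
    then obtain x0 where x0: "x0 \<in> M" by blast
    have "?E M \<subseteq> {x0 - 2 * \<eta>..x0 + 2 * \<eta>}"
    proof safe
      fix x assume "x \<in> M"
      then have *: "x \<in> S" "x0 \<in> S" "\<bar>?h x\<bar> < c * \<eta>" "\<bar>?h x0\<bar> < c * \<eta>" using x0 by (auto simp: M_def)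
      have "c * \<bar>x - x0\<bar> \<le> c * (2 * \<eta>)"
      proof (cases "x \<le> x0")
        case True
        then have "\<bar>x - x0\<bar> = x0 - x" by simp
        then show ?thesis using incr[OF *(1,2) True] *(3,4) by (simp add: abs_less_iff)
      next
        case False
        then have "x0 \<le> x" "\<bar>x - x0\<bar> = x - x0" by simp_all
        then show ?thesis using incr[OF *(2,1)] *(3,4) by (simp add: abs_less_iff)
      qed
      then have "\<bar>x - x0\<bar> \<le> 2 * \<eta>" using c(1) by simp
      then show "x \<in> {x0 - 2 * \<eta>..x0 + 2 * \<eta>}" by (simp add: abs_le_iff)
    qed
    then have "emeasure lborel (?E M) \<le> emeasure lborel {x0 - 2 * \<eta>..x0 + 2 * \<eta>}"
      by (rule emeasure_mono) simp
    then show ?thesis using \<eta> by simp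
  qed simp
  have "emeasure lborel (?E S) \<le> emeasure lborel (?E L) + emeasure lborel (?E M) + emeasure lborel (?E R)"
  proof -
    have eq: "?E S = (?E L \<union> ?E M) \<union> ?E R" unfolding L_def M_def R_def by auto
    have [measurable]: "?E L \<in> sets lborel" "?E M \<in> sets lborel" "?E R \<in> sets lborel" by simp_all
    have 1: "emeasure lborel ((?E L \<union> ?E M) \<union> ?E R) \<le> emeasure lborel (?E L \<union> ?E M) + emeasure lborel (?E R)"
      by (rule emeasure_subadditive) simp_all
    have 2: "emeasure lborel (?E L \<union> ?E M) \<le> emeasure lborel (?E L) + emeasure lborel (?E M)"
      by (rule emeasure_subadditive) simp_all
    show ?thesis unfolding eq by (rule order_trans[OF 1 add_right_mono[OF 2]])
  qed
  also have "\<dots> \<le> ennreal ((4 * 2 ^ k - 4) * \<eta>) + ennreal (4 * \<eta>) + ennreal ((4 * 2 ^ k - 4) * \<eta>)"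
    by (intro add_mono L_le M_le R_le)
  also have "\<dots> = ennreal ((4 * 2 ^ Suc k - 4) * \<eta>)"
  proof -
    have "(1::real) \<le> 2 ^ k" by simp
    then have "0 \<le> (4 * 2 ^ k - 4) * \<eta>" using \<eta> by (intro mult_nonneg_nonneg) linarith+
    then show ?thesis using \<eta> by (simp add: ennreal_plus[symmetric] algebra_simps del: ennreal_plus)
  qed
  finally show ?case .
qed

text \<open>
  The \<open>k\<close>-th derivative of the exponential sum with coefficients \<open>b j\<close> and frequencies \<open>\<omega> j\<close>; the sum
  itself is the case \<open>k = 0\<close>.
\<close>

definition exp_sum :: "'j set \<Rightarrow> ('j \<Rightarrow> complex) \<Rightarrow> ('j \<Rightarrow> real) \<Rightarrow> nat \<Rightarrow> real \<Rightarrow> complex" where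
  "exp_sum J b \<omega> k x = (\<Sum>j\<in>J. b j * (\<i> * \<omega> j) ^ k * cis (\<omega> j * x))"

lemma exp_sum_has_vector_derivative:
  "(exp_sum J b \<omega> k has_vector_derivative exp_sum J b \<omega> (Suc k) x) (at x)"
proof -
  have "((\<lambda>x. \<Sum>j\<in>J. b j * (\<i> * \<omega> j) ^ k * cis (\<omega> j * x)) has_vector_derivative
      (\<Sum>j\<in>J. b j * (\<i> * \<omega> j) ^ k * ((\<i> * \<omega> j) * cis (\<omega> j * x)))) (at x)"
    by (intro has_vector_derivative_sum has_vector_derivative_mult_right has_vector_derivative_cis_mult)
  then show ?thesis by (simp add: exp_sum_def[abs_def] mult_ac)
qed

lemma continuous_on_exp_sum: "continuous_on S (exp_sum J b \<omega> k)"
  by (intro continuous_at_imp_continuous_on ballI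
      has_vector_derivative_continuous[OF exp_sum_has_vector_derivative])

lemma borel_measurable_exp_sum [measurable]: "exp_sum J b \<omega> k \<in> borel_measurable borel"
  by (intro borel_measurable_continuous_onI continuous_on_exp_sum)

lemma exp_sum_lipschitz:
  "cmod (exp_sum J b \<omega> k x - exp_sum J b \<omega> k y) \<le> (\<Sum>j\<in>J. cmod (b j) * \<bar>\<omega> j\<bar> ^ Suc k) * \<bar>x - y\<bar>"
proof -
  have "exp_sum J b \<omega> k x - exp_sum J b \<omega> k y =
      (\<Sum>j\<in>J. b j * (\<i> * \<omega> j) ^ k * (cis (\<omega> j * x) - cis (\<omega> j * y)))"
    by (simp add: exp_sum_def sum_subtractf right_diff_distrib)
  also have "cmod \<dots> \<le> (\<Sum>j\<in>J. cmod (b j) * \<bar>\<omega> j\<bar> ^ Suc k * \<bar>x - y\<bar>)"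
  proof (intro sum_norm_le)
    fix j
    have "cmod (cis (\<omega> j * x) - cis (\<omega> j * y)) \<le> \<bar>\<omega> j\<bar> * \<bar>x - y\<bar>"
      using cmod_cis_diff_le[of "\<omega> j * x" "\<omega> j * y"] by (simp add: right_diff_distrib[symmetric] abs_mult)
    then have "cmod (b j) * \<bar>\<omega> j\<bar> ^ k * cmod (cis (\<omega> j * x) - cis (\<omega> j * y))
        \<le> cmod (b j) * \<bar>\<omega> j\<bar> ^ k * (\<bar>\<omega> j\<bar> * \<bar>x - y\<bar>)"
      by (intro mult_left_mono) auto
    then show "cmod (b j * (\<i> * \<omega> j) ^ k * (cis (\<omega> j * x) - cis (\<omega> j * y)))
        \<le> cmod (b j) * \<bar>\<omega> j\<bar> ^ Suc k * \<bar>x - y\<bar>"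
      by (simp add: norm_mult norm_power mult_ac)
  qed
  finally show ?thesis by (simp add: sum_distrib_right)
qed

text \<open>
  Let \<open>p\<close> vanish at all \<open>\<i> \<omega> j\<close> with \<open>j \<noteq> j0\<close> but not at \<open>\<i> \<omega> j0\<close>.  Applying the differential
  operator \<open>p (d/dx)\<close>, of order less than \<open>card J\<close>, leaves only the term for \<open>j0\<close>, whose modulus
  does not depend on \<open>x\<close>.
\<close>

lemma exp_sum_some_derivative_large:
  assumes "finite J" "j0 \<in> J" "inj_on \<omega> J" "b j0 \<noteq> 0"
  obtains \<delta> where "\<delta> > 0" "\<And>x. \<exists>k<card J. cmod (exp_sum J b \<omega> k x) \<ge> \<delta>"
proof -
  \<comment> \<open>A multiple of the Lagrange interpolation polynomial for the node \<open>j0\<close>.\<close>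
  define p where "p = (\<Prod>j\<in>J - {j0}. [:- (\<i> * \<omega> j), 1:])"
  have deg: "degree p < card J"
  proof -
    have "degree p \<le> (\<Sum>j\<in>J - {j0}. degree [:- (\<i> * \<omega> j), 1:])"
      using degree_prod_sum_le[of "J - {j0}" "\<lambda>j. [:- (\<i> * \<omega> j), 1:]"] assms(1)
      by (simp add: p_def o_def)
    also have "\<dots> = card J - 1" using assms by simp
    also have "\<dots> < card J" using card_gt_0_iff[of J] assms by auto
    finally show ?thesis .
  qed
  have root: "poly p (\<i> * \<omega> j) = 0" if "j \<in> J" "j \<noteq> j0" for j
    unfolding p_def poly_prod using that assms(1) by (intro prod_zero) auto
  have nonroot: "poly p (\<i> * \<omega> j0) \<noteq> 0"
    unfolding p_def poly_prod using assms by (auto simp: inj_on_def)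
  have key: "(\<Sum>k<card J. coeff p k * exp_sum J b \<omega> k x) = b j0 * poly p (\<i> * \<omega> j0) * cis (\<omega> j0 * x)" for x
  proof -
    have poly: "poly p z = (\<Sum>k<card J. coeff p k * z ^ k)" for z
      unfolding poly_altdef using deg
      by (intro sum.mono_neutral_left) (auto simp: coeff_eq_0)
    have "(\<Sum>k<card J. coeff p k * exp_sum J b \<omega> k x) =
        (\<Sum>j\<in>J. \<Sum>k<card J. b j * cis (\<omega> j * x) * (coeff p k * (\<i> * \<omega> j) ^ k))"
      unfolding exp_sum_def sum_distrib_left by (subst sum.swap) (simp add: mult_ac)
    also have "\<dots> = (\<Sum>j\<in>J. b j * cis (\<omega> j * x) * poly p (\<i> * \<omega> j))"
      by (simp add: poly sum_distrib_left)
    also have "\<dots> = (\<Sum>j\<in>{j0}. b j * cis (\<omega> j * x) * poly p (\<i> * \<omega> j))"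
      using assms root by (intro sum.mono_neutral_right) auto
    finally show ?thesis by simp
  qed
  define \<delta> where "\<delta> = cmod (b j0 * poly p (\<i> * \<omega> j0)) / ((\<Sum>k<card J. cmod (coeff p k)) + 1)"
  have pos: "(\<Sum>k<card J. cmod (coeff p k)) + 1 > 0" by (intro add_nonneg_pos sum_nonneg) auto
  have num: "cmod (b j0 * poly p (\<i> * \<omega> j0)) > 0" using assms(4) nonroot by simp
  show thesis
  proof (rule that)
    show \<delta>: "\<delta> > 0" unfolding \<delta>_def by (rule divide_pos_pos[OF num pos])
    fix x
    show "\<exists>k<card J. cmod (exp_sum J b \<omega> k x) \<ge> \<delta>"
    proof (rule ccontr)
      assume "\<not> (\<exists>k<card J. cmod (exp_sum J b \<omega> k x) \<ge> \<delta>)"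
      then have small: "k < card J \<Longrightarrow> cmod (exp_sum J b \<omega> k x) \<le> \<delta>" for k by force
      have "cmod (b j0 * poly p (\<i> * \<omega> j0)) = cmod (\<Sum>k<card J. coeff p k * exp_sum J b \<omega> k x)"
        unfolding key by (simp add: norm_mult)
      also have "\<dots> \<le> (\<Sum>k<card J. cmod (coeff p k) * \<delta>)"
        using small by (intro sum_norm_le) (simp add: norm_mult mult_left_mono)
      also have "\<dots> < \<delta> * ((\<Sum>k<card J. cmod (coeff p k)) + 1)"
        using \<delta> by (simp add: sum_distrib_right sum_distrib_left distrib_left mult.commute)
      also have "\<dots> = cmod (b j0 * poly p (\<i> * \<omega> j0))" using pos by (simp add: \<delta>_def)
      finally show False by simp
    qed
  qed
qed

text \<open>
  On an interval of fixed length the large derivative keeps its direction up to a factor \<open>1 / 2\<close>, so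
  after rotation the sublevel estimate applies to its real part.  The order \<open>k\<close> of the derivative
  depends on the interval; the exponent \<open>card J\<close> serves for all of them.
\<close>

lemma exp_sum_local_sublevel:
  assumes "finite J" "j0 \<in> J" "inj_on \<omega> J" "b j0 \<noteq> 0"
  obtains \<kappa> h C where "\<kappa> > 0" "h > 0" "C \<ge> 0"
    "\<And>p \<eta>. 0 < \<eta> \<Longrightarrow> \<eta> \<le> 1 \<Longrightarrow>
      emeasure lborel {x \<in> {p..p + h}. cmod (exp_sum J b \<omega> 0 x) < \<kappa> * \<eta> ^ card J} \<le> ennreal (C * \<eta>)"
proof -
  obtain \<delta> where \<delta>: "\<delta> > 0" "\<And>x. \<exists>k<card J. cmod (exp_sum J b \<omega> k x) \<ge> \<delta>"
    using exp_sum_some_derivative_large[where b = b, OF assms] by blast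
  define \<Lambda> where "\<Lambda> = (\<Sum>k<card J. \<Sum>j\<in>J. cmod (b j) * \<bar>\<omega> j\<bar> ^ Suc k) + 1"
  have \<Lambda>: "\<Lambda> > 0" unfolding \<Lambda>_def by (intro add_nonneg_pos sum_nonneg) auto
  have lip: "cmod (exp_sum J b \<omega> k x - exp_sum J b \<omega> k y) \<le> \<Lambda> * \<bar>x - y\<bar>" if "k < card J" for k x y
  proof -
    have "(\<Sum>j\<in>J. cmod (b j) * \<bar>\<omega> j\<bar> ^ Suc k) \<le> \<Lambda> - 1"
      unfolding \<Lambda>_def using that
      by (simp, intro member_le_sum[of k "{..<card J}" "\<lambda>k. \<Sum>j\<in>J. cmod (b j) * (\<bar>\<omega> j\<bar> * \<bar>\<omega> j\<bar> ^ k)"])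
        (auto intro!: sum_nonneg)
    then have "(\<Sum>j\<in>J. cmod (b j) * \<bar>\<omega> j\<bar> ^ Suc k) * \<bar>x - y\<bar> \<le> \<Lambda> * \<bar>x - y\<bar>"
      by (intro mult_right_mono) auto
    then show ?thesis using exp_sum_lipschitz[of J b \<omega> k x y] by linarith
  qed
  define h where "h = \<delta> / (2 * \<Lambda>)"
  have h: "h > 0" "\<Lambda> * h = \<delta> / 2" using \<delta> \<Lambda> by (auto simp: h_def)
  show thesis
  proof (rule that[of "\<delta> / 2" h "4 * 2 ^ card J"])
    fix p \<eta> :: real assume \<eta>: "0 < \<eta>" "\<eta> \<le> 1"
    obtain k where k: "k < card J" "cmod (exp_sum J b \<omega> k p) \<ge> \<delta>" using \<delta>(2) by blast
    \<comment> \<open>The rotation that makes the large derivative positive at the left end point.\<close>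
    define w where "w = cnj (sgn (exp_sum J b \<omega> k p))"
    define g where "g i x = Re (w * exp_sum J b \<omega> i x)" for i x
    have w: "cmod w = 1" using k(2) \<delta>(1) by (auto simp: w_def norm_sgn)
    have gp: "g k p = cmod (exp_sum J b \<omega> k p)"
    proof -
      have "w * exp_sum J b \<omega> k p = of_real (cmod (exp_sum J b \<omega> k p))"
        using k(2) \<delta>(1)
        by (simp add: w_def sgn_div_norm scaleR_conv_of_real complex_norm_square[symmetric] field_simps power2_eq_square)
      then show ?thesis by (simp add: g_def)
    qed
    have deriv: "(g i has_real_derivative g (Suc i) x) (at x)" for i x
      unfolding g_def has_real_derivative_iff_has_vector_derivative
      by (intro bounded_linear.has_vector_derivative[OF bounded_linear_Re]
          has_vector_derivative_mult_right exp_sum_has_vector_derivative)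
    have lower: "g k x \<ge> \<delta> / 2" if "x \<in> {p..p + h}" for x
    proof -
      have "\<bar>g k p - g k x\<bar> \<le> cmod (w * (exp_sum J b \<omega> k p - exp_sum J b \<omega> k x))"
        using abs_Re_le_cmod[of "w * (exp_sum J b \<omega> k p - exp_sum J b \<omega> k x)"]
        by (simp add: g_def right_diff_distrib)
      also have "\<dots> \<le> \<Lambda> * \<bar>p - x\<bar>" using lip[OF k(1)] w by (simp add: norm_mult)
      also have "\<dots> \<le> \<Lambda> * h" using that \<Lambda> by (intro mult_left_mono) auto
      finally show ?thesis using gp k(2) h(2) by linarith
    qed
    have [measurable]: "g 0 \<in> borel_measurable borel"
      unfolding g_def by measurable
    have "{x \<in> {p..p + h}. cmod (exp_sum J b \<omega> 0 x) < \<delta> / 2 * \<eta> ^ card J}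
        \<subseteq> {x \<in> {p..p + h}. \<bar>g 0 x\<bar> < \<delta> / 2 * \<eta> ^ k}"
    proof -
      have "\<bar>g 0 x\<bar> \<le> cmod (exp_sum J b \<omega> 0 x)" for x
        unfolding g_def using abs_Re_le_cmod[of "w * exp_sum J b \<omega> 0 x"] w by (simp add: norm_mult)
      moreover have "\<delta> / 2 * \<eta> ^ card J \<le> \<delta> / 2 * \<eta> ^ k"
        using \<delta> \<eta> k(1) by (intro mult_left_mono power_decreasing) auto
      ultimately show ?thesis by (smt (verit) Collect_mono)
    qed
    then have "emeasure lborel {x \<in> {p..p + h}. cmod (exp_sum J b \<omega> 0 x) < \<delta> / 2 * \<eta> ^ card J}
        \<le> emeasure lborel {x \<in> {p..p + h}. \<bar>g 0 x\<bar> < \<delta> / 2 * \<eta> ^ k}"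
      by (rule emeasure_mono) measurable
    also have "\<dots> \<le> ennreal ((4 * 2 ^ k - 4) * \<eta>)"
      using \<delta>(1) lower by (intro emeasure_sublevel_le deriv \<eta>) (auto simp: is_interval_cc)
    also have "\<dots> \<le> ennreal (4 * 2 ^ card J * \<eta>)"
    proof (intro ennreal_leI mult_right_mono)
      have "(2 :: real) ^ k \<le> 2 ^ card J" using k(1) by (intro power_increasing) auto
      then show "4 * 2 ^ k - 4 \<le> 4 * (2 :: real) ^ card J" by linarith
    qed (use \<eta> in auto)
    finally show "emeasure lborel {x \<in> {p..p + h}. cmod (exp_sum J b \<omega> 0 x) < \<delta> / 2 * \<eta> ^ card J}
        \<le> ennreal (4 * 2 ^ card J * \<eta>)" .
  qed (use \<delta> h in auto)
qed

text \<open>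
  Cover \<open>[-R, R]\<close> by at most \<open>2 R / h + 1 \<le> 3 R / h\<close> intervals of length \<open>h\<close>.
\<close>

lemma emeasure_Icc_le_of_local:
  fixes A :: "real set"
  assumes [measurable]: "A \<in> sets borel" and "h > 0" "R \<ge> h" "D \<ge> 0"
    and local: "\<And>p. emeasure lborel ({p..p + h} \<inter> A) \<le> ennreal D"
  shows "emeasure lborel ({-R..R} \<inter> A) \<le> ennreal (3 * R / h * D)"
proof -
  define N where "N = nat \<lceil>2 * R / h\<rceil>"
  have pos: "2 * R / h > 0" using assms by (intro divide_pos_pos) auto
  have N: "2 * R / h \<le> real N" "real N < 2 * R / h + 1"
    using pos unfolding N_def by linarith+
  have N': "2 * R \<le> real N * h" using N(1) \<open>h > 0\<close> by (simp add: field_simps)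
  have "real N \<le> 3 * R / h"
  proof -
    have "1 \<le> R / h" using assms by simp
    then show ?thesis using N(2) by simp
  qed
  have "{-R..R} \<inter> A \<subseteq> (\<Union>i<N. {- R + i * h..(- R + i * h) + h} \<inter> A)"
  proof safe
    fix x assume x: "x \<in> {-R..R}" "x \<in> A"
    show "x \<in> (\<Union>i<N. {- R + i * h..(- R + i * h) + h} \<inter> A)"
    \<comment> \<open>For \<open>x = R\<close> the rounded-down quotient used below may be \<open>N\<close>, which is out of range.\<close>
    proof (cases "x = R")
      case True
      have "N > 0" using N(1) pos by (cases N) auto
      then have "real (N - 1) = real N - 1" by simp
      have "- R + real (N - 1) * h \<le> R"
      proof -
        have "(real N - 1) * h \<le> 2 * R"
          using N(2) \<open>h > 0\<close> by (simp add: field_simps)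
        then show ?thesis using \<open>real (N - 1) = _\<close> by simp
      qed
      moreover have "R \<le> - R + real (N - 1) * h + h"
        using N' \<open>real (N - 1) = _\<close> by (simp add: algebra_simps)
      ultimately show ?thesis using True x(2) \<open>N > 0\<close> by (intro UN_I[of "N - 1"]) auto
    next
      case False
      define i where "i = nat \<lfloor>(x + R) / h\<rfloor>"
      have "(x + R) / h \<ge> 0" using x assms by (intro divide_nonneg_pos) auto
      then have i: "real i \<le> (x + R) / h" "(x + R) / h < real i + 1" unfolding i_def by linarith+
      have "(x + R) / h < 2 * R / h" using x False \<open>h > 0\<close> by (intro divide_strict_right_mono) auto
      then have "i < N" using i N by linarith
      moreover have "real i * h \<le> x + R" "x + R \<le> real i * h + h"
        using i \<open>h > 0\<close> by (simp_all add: field_simps)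
      ultimately show ?thesis using x(2) by (intro UN_I[of i]) auto
    qed
  qed
  then have "emeasure lborel ({-R..R} \<inter> A) \<le> emeasure lborel (\<Union>i<N. {- R + i * h..(- R + i * h) + h} \<inter> A)"
    by (rule emeasure_mono) measurable
  also have "\<dots> \<le> (\<Sum>i<N. emeasure lborel ({- R + i * h..(- R + i * h) + h} \<inter> A))"
    by (intro emeasure_subadditive_finite) auto
  also have "\<dots> \<le> (\<Sum>i<N. ennreal D)" by (intro sum_mono local)
  also have "\<dots> = ennreal (real N * D)"
    using \<open>D \<ge> 0\<close> by (simp add: ennreal_mult ennreal_of_nat_eq_real_of_nat)
  also have "\<dots> \<le> ennreal (3 * R / h * D)"
    using \<open>real N \<le> _\<close> \<open>D \<ge> 0\<close> by (intro ennreal_leI mult_right_mono) auto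
  finally show ?thesis .
qed

text \<open>
  On each interval of length \<open>h\<close> the zero set lies in all sublevel sets.
\<close>

lemma exp_sum_AE_nonzero:
  assumes "finite J" "j0 \<in> J" "inj_on \<omega> J" "b j0 \<noteq> 0"
  shows "AE x in lborel. exp_sum J b \<omega> 0 x \<noteq> 0"
proof -
  obtain \<kappa> h C where pos: "\<kappa> > 0" "h > 0" "C \<ge> 0" and
    local: "\<And>p \<eta>. 0 < \<eta> \<Longrightarrow> \<eta> \<le> 1 \<Longrightarrow>
      emeasure lborel {x \<in> {p..p + h}. cmod (exp_sum J b \<omega> 0 x) < \<kappa> * \<eta> ^ card J} \<le> ennreal (C * \<eta>)"
    by (rule exp_sum_local_sublevel[where b = b, OF assms]) (rule that)
  let ?Z = "{x. exp_sum J b \<omega> 0 x = 0}"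
  have Z [measurable]: "?Z \<in> sets borel" by measurable
  have "emeasure lborel ({p..p + h} \<inter> ?Z) \<le> ennreal 0" for p
  proof (rule ennreal_le_epsilon)
    fix e :: real assume "e > 0"
    define \<eta> where "\<eta> = min 1 (e / (C + 1))"
    have \<eta>: "0 < \<eta>" "\<eta> \<le> 1" using \<open>e > 0\<close> pos by (auto simp: \<eta>_def)
    have "{p..p + h} \<inter> ?Z \<subseteq> {x \<in> {p..p + h}. cmod (exp_sum J b \<omega> 0 x) < \<kappa> * \<eta> ^ card J}"
      using pos \<eta> by auto
    then have "emeasure lborel ({p..p + h} \<inter> ?Z) \<le> ennreal (C * \<eta>)"
      by (intro order_trans[OF emeasure_mono local[OF \<eta>]]) (auto intro!: borel_measurable_exp_sum)
    also have "C * \<eta> \<le> (C + 1) * (e / (C + 1))"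
      using pos \<eta> by (intro mult_mono) (auto simp: \<eta>_def)
    finally show "emeasure lborel ({p..p + h} \<inter> ?Z) \<le> ennreal 0 + ennreal e"
      using pos by (simp add: ennreal_leI)
  qed
  then have null: "emeasure lborel ({-R..R} \<inter> ?Z) = 0" if "R \<ge> h" for R
    using emeasure_Icc_le_of_local[OF Z pos(2) that, of 0] by simp
  have "?Z = (\<Union>n::nat. {- (h + n)..h + n} \<inter> ?Z)"
  proof -
    have "\<exists>n::nat. x \<in> {- (h + n)..h + n}" for x
    proof -
      obtain n :: nat where "\<bar>x\<bar> \<le> n" using real_arch_simple by blast
      then show ?thesis using pos by (intro exI[of _ n]) (auto simp: abs_le_iff)
    qed
    then show ?thesis by blast
  qed
  moreover have "(\<Union>n::nat. {- (h + n)..h + n} \<inter> ?Z) \<in> null_sets lborel"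
  proof (rule null_sets_UN)
    show "{- (h + n)..h + n} \<inter> ?Z \<in> null_sets lborel" for n :: nat
      using null[of "h + real n"] by (simp add: null_sets_def)
  qed
  ultimately have "?Z \<in> null_sets lborel" by simp
  then show ?thesis by (rule AE_I') auto
qed

text \<open>
  The local estimates summed over \<open>[-R, R]\<close>.  They are stated for the squared modulus, which is a
  trigonometric polynomial; this doubles the exponent.
\<close>

theorem exp_sum_thin_sublevels:
  assumes "finite J" "j0 \<in> J" "inj_on \<omega> J" "b j0 \<noteq> 0"
  obtains \<kappa> C h where "\<kappa> > 0" "C \<ge> 0" "h > 0"
    "\<And>R. R \<ge> h \<Longrightarrow> thin_sublevels (uniform_measure lborel {-R..R})
      (\<lambda>x. (cmod (exp_sum J b \<omega> 0 x))\<^sup>2) \<kappa> (2 * card J) C"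
proof -
  obtain \<kappa> h C where pos: "\<kappa> > 0" "h > 0" "C \<ge> 0" and
    local: "\<And>p \<eta>. 0 < \<eta> \<Longrightarrow> \<eta> \<le> 1 \<Longrightarrow>
      emeasure lborel {x \<in> {p..p + h}. cmod (exp_sum J b \<omega> 0 x) < \<kappa> * \<eta> ^ card J} \<le> ennreal (C * \<eta>)"
    by (rule exp_sum_local_sublevel[where b = b, OF assms]) (rule that)
  show thesis
  proof (rule that[of "\<kappa>\<^sup>2" "3 / (2 * h) * C" h])
    fix R assume R: "R \<ge> h"
    show "thin_sublevels (uniform_measure lborel {-R..R})
      (\<lambda>x. (cmod (exp_sum J b \<omega> 0 x))\<^sup>2) (\<kappa>\<^sup>2) (2 * card J) (3 / (2 * h) * C)"
      unfolding thin_sublevels_def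
    proof (intro allI impI)
      fix \<eta> :: real assume \<eta>: "0 < \<eta>" "\<eta> \<le> 1"
      let ?A = "{x. cmod (exp_sum J b \<omega> 0 x) < \<kappa> * \<eta> ^ card J}"
      have A [measurable]: "?A \<in> sets borel" by measurable
      have "{x \<in> space (uniform_measure lborel {-R..R}). (cmod (exp_sum J b \<omega> 0 x))\<^sup>2 < \<kappa>\<^sup>2 * \<eta> ^ (2 * card J)} = ?A"
      proof -
        have "\<kappa>\<^sup>2 * \<eta> ^ (2 * card J) = (\<kappa> * \<eta> ^ card J)\<^sup>2"
          by (simp add: power_mult_distrib power_mult[symmetric] mult.commute)
        moreover have "0 < \<kappa> * \<eta> ^ card J" using pos \<eta> by simp
        ultimately show ?thesis by (auto intro: power_strict_mono dest: power_less_imp_less_base)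
      qed
      then have "emeasure (uniform_measure lborel {-R..R})
          {x \<in> space (uniform_measure lborel {-R..R}). (cmod (exp_sum J b \<omega> 0 x))\<^sup>2 < \<kappa>\<^sup>2 * \<eta> ^ (2 * card J)}
          = emeasure lborel ({-R..R} \<inter> ?A) / ennreal (2 * R)"
        using R pos by simp
      also have "\<dots> \<le> ennreal (3 * R / h * (C * \<eta>)) / ennreal (2 * R)"
      proof (intro divide_right_mono_ennreal emeasure_Icc_le_of_local A pos R)
        show "emeasure lborel ({p..p + h} \<inter> ?A) \<le> ennreal (C * \<eta>)" for p
          using local[OF \<eta>, of p] by (simp add: Int_def)
      qed (use pos \<eta> in auto)
      also have "\<dots> = ennreal (3 / (2 * h) * C * \<eta>)"
        using R pos \<eta> by (simp add: divide_ennreal)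
      finally show "emeasure (uniform_measure lborel {-R..R})
          {x \<in> space (uniform_measure lborel {-R..R}). (cmod (exp_sum J b \<omega> 0 x))\<^sup>2 < \<kappa>\<^sup>2 * \<eta> ^ (2 * card J)}
          \<le> ennreal (3 / (2 * h) * C * \<eta>)" .
    qed
  qed (use pos in auto)
qed

section \<open>Means of trigonometric polynomials along a line in the torus\<close>

text \<open>
  Generated by monomials, so that each property below needs checking only for a single character.
\<close>

inductive trig_poly :: "nat \<Rightarrow> ((nat \<Rightarrow> real) \<Rightarrow> complex) \<Rightarrow> bool" for d where
  monomial: "trig_poly d (\<lambda>t. c * cis (2 * pi * (\<Sum>i<d. of_int (e i) * t i)))" for c and e :: "nat \<Rightarrow> int"
| add: "trig_poly d F \<Longrightarrow> trig_poly d G \<Longrightarrow> trig_poly d (\<lambda>t. F t + G t)"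

lemma trig_poly_const: "trig_poly d (\<lambda>t. c)"
  using trig_poly.monomial[of d c "\<lambda>_. 0"] by simp

lemma trig_poly_mult:
  assumes "trig_poly d F" "trig_poly d G"
  shows "trig_poly d (\<lambda>t. F t * G t)"
  using assms(1)
proof induction
  case (monomial c e)
  show ?case using assms(2)
  proof induction
    case (monomial c' e')
    have "(\<lambda>t. c * cis (2 * pi * (\<Sum>i<d. of_int (e i) * t i)) * (c' * cis (2 * pi * (\<Sum>i<d. of_int (e' i) * t i))))
      = (\<lambda>t. (c * c') * cis (2 * pi * (\<Sum>i<d. of_int (e i + e' i) * t i)))"
    proof
      fix t :: "nat \<Rightarrow> real"
      have "2 * pi * (\<Sum>i<d. of_int (e i + e' i) * t i) =
          2 * pi * (\<Sum>i<d. of_int (e i) * t i) + 2 * pi * (\<Sum>i<d. of_int (e' i) * t i)"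
        by (simp add: sum.distrib distrib_left distrib_right)
      then show "c * cis (2 * pi * (\<Sum>i<d. of_int (e i) * t i)) * (c' * cis (2 * pi * (\<Sum>i<d. of_int (e' i) * t i)))
        = (c * c') * cis (2 * pi * (\<Sum>i<d. of_int (e i + e' i) * t i))"
        by (simp only: cis_mult[symmetric]) (simp add: mult_ac)
    qed
    then show ?case using trig_poly.monomial[of d "c * c'" "\<lambda>i. e i + e' i"] by simp
  next
    case (add F G)
    then show ?case using trig_poly.add[OF add.IH] by (simp add: distrib_left)
  qed
next
  case (add F1 F2)
  then show ?case using trig_poly.add[OF add.IH] by (simp add: distrib_right)
qed

lemma trig_poly_cnj:
  assumes "trig_poly d F" shows "trig_poly d (\<lambda>t. cnj (F t))"
  using assms
proof induction
  case (monomial c e)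
  show ?case
    using trig_poly.monomial[of d "cnj c" "\<lambda>i. - e i"] by (simp add: cis_cnj sum_negf)
next
  case (add F G)
  then show ?case using trig_poly.add[OF add.IH] by simp
qed

lemma trig_poly_power: "trig_poly d F \<Longrightarrow> trig_poly d (\<lambda>t. F t ^ k)"
  by (induction k) (auto intro: trig_poly_const trig_poly_mult)

lemma trig_poly_sum:
  assumes "finite S" "\<And>x. x \<in> S \<Longrightarrow> trig_poly d (F x)"
  shows "trig_poly d (\<lambda>t. \<Sum>x\<in>S. F x t)"
  using assms by (induction S) (auto intro: trig_poly_const trig_poly.add)

lemma trig_poly_bounded:
  assumes "trig_poly d F" obtains B where "\<And>t. cmod (F t) \<le> B"
proof -
  have "\<exists>B. \<forall>t. cmod (F t) \<le> B"
    using assms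
  proof induction
    case (monomial c e)
    show ?case by (rule exI[of _ "cmod c"]) (simp add: norm_mult)
  next
    case (add F G)
    then show ?case by (meson add_mono norm_triangle_le)
  qed
  then show thesis using that by blast
qed

lemma measurable_trig_poly:
  assumes "trig_poly d F" "\<And>i. i < d \<Longrightarrow> (\<lambda>x. \<theta> x i) \<in> borel_measurable M"
  shows "(\<lambda>x. F (\<theta> x)) \<in> borel_measurable M"
  using assms(1)
proof induction
  case (monomial c e)
  have "(\<lambda>x. \<Sum>i<d. of_int (e i) * \<theta> x i) \<in> borel_measurable M"
    using assms(2) by (intro borel_measurable_sum borel_measurable_times) auto
  moreover have "cis \<in> borel_measurable borel"
    by (intro borel_measurable_continuous_onI continuous_intros)
  ultimately show ?case by measurable
qed (rule borel_measurable_add)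

lemma integrable_trig_poly:
  assumes "trig_poly d F" "prob_space M" "\<And>i. i < d \<Longrightarrow> (\<lambda>x. \<theta> x i) \<in> borel_measurable M"
  shows "integrable M (\<lambda>x. F (\<theta> x))"
proof -
  interpret prob_space M by fact
  obtain B where "\<And>t. cmod (F t) \<le> B" using trig_poly_bounded[OF assms(1)] by blast
  then show ?thesis
    by (intro integrable_const_bound[where B = B] measurable_trig_poly[OF assms(1)] assms(3)) auto
qed

lemma cis_sum: "finite S \<Longrightarrow> cis (\<Sum>i\<in>S. f i) = (\<Prod>i\<in>S. cis (f i))"
  by (induction S rule: finite_induct) (simp_all add: cis_mult[symmetric])

lemma laurent_monomial_cis:
  fixes e :: "nat \<Rightarrow>\<^sub>0 int"
  assumes "Poly_Mapping.keys e \<subseteq> {..<d}"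
  shows "(\<Prod>i\<in>Poly_Mapping.keys e. cis (\<theta> i) powi Poly_Mapping.lookup e i) =
    cis (\<Sum>i<d. of_int (Poly_Mapping.lookup e i) * \<theta> i)"
proof -
  have "(\<Prod>i\<in>Poly_Mapping.keys e. cis (\<theta> i) powi Poly_Mapping.lookup e i) =
      cis (\<Sum>i\<in>Poly_Mapping.keys e. of_int (Poly_Mapping.lookup e i) * \<theta> i)"
    by (simp add: cis_sum cis_power_int)
  also have "(\<Sum>i\<in>Poly_Mapping.keys e. of_int (Poly_Mapping.lookup e i) * \<theta> i) =
      (\<Sum>i<d. of_int (Poly_Mapping.lookup e i) * \<theta> i)"
    using assms by (intro sum.mono_neutral_left) (auto simp: in_keys_iff)
  finally show ?thesis .
qed

lemma trig_poly_laurent_eval: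
  assumes "laurent_in_vars d P"
  shows "trig_poly d (\<lambda>t. laurent_eval P (\<lambda>i. cis (2 * pi * t i)))"
proof -
  have "trig_poly d (\<lambda>t. \<Sum>e\<in>Poly_Mapping.keys P. Poly_Mapping.lookup P e *
      cis (2 * pi * (\<Sum>i<d. of_int (Poly_Mapping.lookup e i) * t i)))"
    by (intro trig_poly_sum trig_poly.monomial) simp
  also have "(\<lambda>t. \<Sum>e\<in>Poly_Mapping.keys P. Poly_Mapping.lookup P e *
      cis (2 * pi * (\<Sum>i<d. of_int (Poly_Mapping.lookup e i) * t i))) =
      (\<lambda>t. laurent_eval P (\<lambda>i. cis (2 * pi * t i)))"
    unfolding laurent_eval_def
  proof (intro ext sum.cong refl arg_cong2[where f = "(*)"])
    fix t :: "nat \<Rightarrow> real" and e assume "e \<in> Poly_Mapping.keys P"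
    then have "Poly_Mapping.keys e \<subseteq> {..<d}" using assms by (auto simp: laurent_in_vars_def)
    then show "cis (2 * pi * (\<Sum>i<d. of_int (Poly_Mapping.lookup e i) * t i)) =
        (\<Prod>i\<in>Poly_Mapping.keys e. cis (2 * pi * t i) powi Poly_Mapping.lookup e i)"
      by (simp only: laurent_monomial_cis sum_distrib_left mult_ac)
  qed
  finally show ?thesis .
qed

text \<open>
  The unit cube with Lebesgue measure, which represents the torus \<open>\<real>\<^sup>d / \<int>\<^sup>d\<close> as far as
  integration is concerned.
\<close>

definition torus :: "nat \<Rightarrow> (nat \<Rightarrow> real) measure" where
  "torus d = restrict_space (\<Pi>\<^sub>M i\<in>{..<d}. lborel) (\<Pi>\<^sub>E i\<in>{..<d}. {0..1})"

lemma cube_sets: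
  fixes d :: nat
  shows "(\<Pi>\<^sub>E i\<in>{..<d}. {0..1::real}) \<in> sets (\<Pi>\<^sub>M i\<in>{..<d}. lborel)"
  by (intro sets_PiM_I_finite) auto

lemma cube_sets':
  fixes d :: nat
  shows "(\<Pi>\<^sub>E i\<in>{..<d}. {0..1::real}) \<inter> space (\<Pi>\<^sub>M i\<in>{..<d}. lborel) \<in> sets (\<Pi>\<^sub>M i\<in>{..<d}. lborel)"
  using cube_sets by (intro sets.Int) auto

lemma product_sigma_finite_lborel: "product_sigma_finite (\<lambda>i. lborel :: real measure)"
  by (simp add: product_sigma_finite_def sigma_finite_lborel)

lemma integral_torus:
  fixes F :: "(nat \<Rightarrow> real) \<Rightarrow> 'b :: {banach, second_countable_topology}"
  shows "(\<integral>t. F t \<partial>torus d) = (LINT t : (\<Pi>\<^sub>E i\<in>{..<d}. {0..1}) | (\<Pi>\<^sub>M i\<in>{..<d}. lborel). F t)"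
  unfolding torus_def set_lebesgue_integral_def by (rule integral_restrict_space[OF cube_sets'])

lemma prob_space_torus: "prob_space (torus d)"
proof
  interpret product_sigma_finite "\<lambda>i::nat. lborel :: real measure" by (rule product_sigma_finite_lborel)
  have "emeasure (torus d) (space (torus d)) = emeasure (\<Pi>\<^sub>M i\<in>{..<d}. lborel) (\<Pi>\<^sub>E i\<in>{..<d}. {0..1::real})"
  proof -
    have "(\<Pi>\<^sub>E i\<in>{..<d}. {0..1::real}) \<inter> space (\<Pi>\<^sub>M i\<in>{..<d}. lborel) = (\<Pi>\<^sub>E i\<in>{..<d}. {0..1::real})"
      by (auto simp: space_PiM PiE_iff)
    then show ?thesis
      unfolding torus_def using cube_sets'[of d]
      by (subst emeasure_restrict_space) (simp_all add: space_restrict_space)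
  qed
  also have "\<dots> = (\<Prod>i<d. emeasure lborel {0..1::real})" by (rule emeasure_PiM) auto
  finally show "emeasure (torus d) (space (torus d)) = 1" by simp
qed

lemma measurable_torus_component: "i < d \<Longrightarrow> (\<lambda>t. t i) \<in> borel_measurable (torus d)"
  unfolding torus_def by (intro measurable_restrict_space1) measurable

lemma has_bochner_integral_cis:
  assumes "\<omega> \<noteq> 0" "a \<le> b"
  shows "has_bochner_integral lborel (\<lambda>x. indicator {a..b} x *\<^sub>R cis (\<omega> * x))
    ((cis (\<omega> * b) - cis (\<omega> * a)) / (\<i> * \<omega>))"
proof -
  have deriv: "((\<lambda>x. cis (\<omega> * x) / (\<i> * \<omega>)) has_vector_derivative cis (\<omega> * x)) (at x within {a..b})" for x
  proof -
    have "((\<lambda>x. cis (\<omega> * x) / (\<i> * \<omega>)) has_vector_derivative (\<i> * \<omega>) * cis (\<omega> * x) / (\<i> * \<omega>)) (at x)"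
      by (intro has_vector_derivative_divide has_vector_derivative_cis_mult)
    then show ?thesis using assms(1) by (simp add: has_vector_derivative_at_within)
  qed
  have "continuous_on {a..b} (\<lambda>x. cis (\<omega> * x))" by (intro continuous_intros)
  from has_bochner_integral_FTC_Icc[OF assms(2) deriv this]
  show ?thesis by (simp add: diff_divide_distrib)
qed

text \<open>
  The integral is a product of integrals over \<open>[0, 1]\<close>, and a non-trivial character has mean \<open>0\<close>.
\<close>

lemma integral_torus_monomial:
  fixes e :: "nat \<Rightarrow> int"
  shows "(\<integral>t. c * cis (2 * pi * (\<Sum>i<d. of_int (e i) * t i)) \<partial>torus d) = (if \<forall>i<d. e i = 0 then c else 0)"
proof (cases "\<forall>i<d. e i = 0")
  case True
  interpret prob_space "torus d" by (rule prob_space_torus)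
  have "(\<integral>t. c * cis (2 * pi * (\<Sum>i<d. of_int (e i) * t i)) \<partial>torus d) = (\<integral>t. c \<partial>torus d)"
    using True by (intro Bochner_Integration.integral_cong) auto
  then show ?thesis using True by (simp add: prob_space)
next
  case False
  interpret product_sigma_finite "\<lambda>i::nat. lborel :: real measure" by (rule product_sigma_finite_lborel)
  define f where "f i x = indicator {0..1} x *\<^sub>R cis (2 * pi * of_int (e i) * x)" for i :: nat and x :: real
  have f: "has_bochner_integral lborel (f i) (if e i = 0 then 1 else 0)" for i
  proof (cases "e i = 0")
    case True
    have "has_bochner_integral lborel (\<lambda>x. indicator {0..1::real} x *\<^sub>R (1::complex)) (measure lborel {0..1::real} *\<^sub>R 1)"
      by (intro has_bochner_integral_scaleR_left has_bochner_integral_real_indicator) auto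
    then show ?thesis using True by (simp add: f_def[abs_def])
  next
    case False
    have "cis (2 * pi * of_int (e i) * 1) = 1" by (metis cis_multiple_2pi mult.right_neutral Ints_of_int)
    with has_bochner_integral_cis[of "2 * pi * of_int (e i)" 0 1] False
    show ?thesis by (simp add: f_def[abs_def])
  qed
  have ind: "indicator (\<Pi>\<^sub>E i\<in>{..<d}. {0..1}) t *\<^sub>R cis (2 * pi * (\<Sum>i<d. of_int (e i) * t i)) = (\<Prod>i<d. f i (t i))"
    if "t \<in> space (\<Pi>\<^sub>M i\<in>{..<d}. lborel)" for t :: "nat \<Rightarrow> real"
  proof (cases "\<forall>i<d. t i \<in> {0..1}")
    case True
    then have "t \<in> (\<Pi>\<^sub>E i\<in>{..<d}. {0..1})" using that by (auto simp: space_PiM PiE_iff)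
    moreover have "(\<Prod>i<d. f i (t i)) = (\<Prod>i<d. cis (2 * pi * of_int (e i) * t i))"
      using True by (intro prod.cong) (auto simp: f_def)
    ultimately show ?thesis by (simp add: cis_sum sum_distrib_left mult_ac)
  next
    case out: False
    then obtain i where i: "i < d" "t i \<notin> {0..1}" by blast
    then have "t \<notin> (\<Pi>\<^sub>E i\<in>{..<d}. {0..1})" by (auto simp: PiE_iff)
    moreover have "f i (t i) = 0" using i by (simp add: f_def)
    ultimately show ?thesis using i(1) by (auto intro!: prod_zero[symmetric])
  qed
  have "(\<integral>t. c * cis (2 * pi * (\<Sum>i<d. of_int (e i) * t i)) \<partial>torus d) =
      c * (\<integral>t. cis (2 * pi * (\<Sum>i<d. of_int (e i) * t i)) \<partial>torus d)" by simp
  also have "(\<integral>t. cis (2 * pi * (\<Sum>i<d. of_int (e i) * t i)) \<partial>torus d) =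
      (\<integral>t. (\<Prod>i<d. f i (t i)) \<partial>(\<Pi>\<^sub>M i\<in>{..<d}. lborel))"
    unfolding integral_torus set_lebesgue_integral_def
    by (intro Bochner_Integration.integral_cong ind refl)
  also have "\<dots> = (\<Prod>i<d. integral\<^sup>L lborel (f i))"
    using f by (intro product_integral_prod) (auto simp: has_bochner_integral_iff)
  also have "\<dots> = (\<Prod>i<d. if e i = 0 then 1 else 0)"
    using f by (simp add: has_bochner_integral_iff)
  also have "\<dots> = 0" using False by (auto intro!: prod_zero)
  finally show ?thesis unfolding if_not_P[OF False] by simp
qed

lemma integral_uniform_measure_Icc:
  fixes g :: "real \<Rightarrow> 'b :: {banach, second_countable_topology}"
  assumes "R > 0" and [measurable]: "g \<in> borel_measurable borel"
  shows "(\<integral>y. g y \<partial>uniform_measure lborel {-R..R}) = (1 / (2 * R)) *\<^sub>R (LBINT y:{-R..R}. g y)"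
    and "integrable (uniform_measure lborel {-R..R}) g \<longleftrightarrow> set_integrable lborel {-R..R} g"
proof -
  have eq: "uniform_measure lborel {-R..R} = density lborel (\<lambda>x. ennreal (indicator {-R..R} x / (2 * R)))"
    unfolding uniform_measure_def
  proof (intro arg_cong2[where f = density] refl ext)
    fix x
    have "(indicator {-R..R} x :: ennreal) = ennreal (indicator {-R..R} x)" by (simp add: indicator_def)
    then show "indicator {-R..R} x / emeasure lborel {-R..R} = ennreal (indicator {-R..R} x / (2 * R))"
      using assms(1) by (simp add: divide_ennreal)
  qed
  have "(\<integral>y. g y \<partial>uniform_measure lborel {-R..R}) = (\<integral>y. (indicator {-R..R} y / (2 * R)) *\<^sub>R g y \<partial>lborel)"
    unfolding eq using assms by (subst integral_density) auto
  also have "\<dots> = (\<integral>y. (1 / (2 * R)) *\<^sub>R (indicator {-R..R} y *\<^sub>R g y) \<partial>lborel)"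
    by (intro Bochner_Integration.integral_cong refl) simp
  also have "\<dots> = (1 / (2 * R)) *\<^sub>R (LBINT y:{-R..R}. g y)"
    unfolding set_lebesgue_integral_def by (rule integral_scaleR_right)
  finally show "(\<integral>y. g y \<partial>uniform_measure lborel {-R..R}) = (1 / (2 * R)) *\<^sub>R (LBINT y:{-R..R}. g y)" .
  have "integrable (uniform_measure lborel {-R..R}) g \<longleftrightarrow> integrable lborel (\<lambda>y. (indicator {-R..R} y / (2 * R)) *\<^sub>R g y)"
    unfolding eq using assms by (subst integrable_density) auto
  also have "\<dots> \<longleftrightarrow> set_integrable lborel {-R..R} g"
    unfolding set_integrable_def
  proof
    assume "integrable lborel (\<lambda>y. (indicator {-R..R} y / (2 * R)) *\<^sub>R g y)"
    then have "integrable lborel (\<lambda>y. (2 * R) *\<^sub>R ((indicator {-R..R} y / (2 * R)) *\<^sub>R g y))"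
      by (intro integrable_scaleR_right)
    then show "integrable lborel (\<lambda>y. indicator {-R..R} y *\<^sub>R g y)" using assms(1) by simp
  next
    assume "integrable lborel (\<lambda>y. indicator {-R..R} y *\<^sub>R g y)"
    then have "integrable lborel (\<lambda>y. (1 / (2 * R)) *\<^sub>R (indicator {-R..R} y *\<^sub>R g y))"
      by (intro integrable_scaleR_right)
    then show "integrable lborel (\<lambda>y. (indicator {-R..R} y / (2 * R)) *\<^sub>R g y)" by simp
  qed
  finally show "integrable (uniform_measure lborel {-R..R}) g \<longleftrightarrow> set_integrable lborel {-R..R} g" .
qed

lemma prob_space_uniform_Icc: "R > 0 \<Longrightarrow> prob_space (uniform_measure lborel {-R..R :: real})"
  by (intro prob_space_uniform_measure) auto

lemma mean_cis_tendsto_0: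
  assumes "\<omega> \<noteq> 0"
  shows "((\<lambda>R. \<integral>y. cis (\<omega> * y) \<partial>uniform_measure lborel {-R..R}) \<longlongrightarrow> 0) at_top"
proof (rule Lim_null_comparison)
  have cis_meas: "(\<lambda>y. cis (\<omega> * y)) \<in> borel_measurable borel"
    by (intro borel_measurable_continuous_onI continuous_intros)
  show "\<forall>\<^sub>F R in at_top. norm (\<integral>y. cis (\<omega> * y) \<partial>uniform_measure lborel {-R..R}) \<le> (1 / \<bar>\<omega>\<bar>) * inverse R"
    using eventually_gt_at_top[of 0]
  proof eventually_elim
    case (elim R)
    have "(LBINT y:{-R..R}. cis (\<omega> * y)) = (cis (\<omega> * R) - cis (\<omega> * - R)) / (\<i> * \<omega>)"
      using has_bochner_integral_cis[OF assms, of "-R" R] elim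
      by (simp add: set_lebesgue_integral_def has_bochner_integral_iff)
    also have "norm \<dots> \<le> 2 / \<bar>\<omega>\<bar>"
      using norm_triangle_ineq4[of "cis (\<omega> * R)" "cis (\<omega> * - R)"]
      by (simp add: norm_divide norm_mult divide_right_mono)
    finally have "norm (LBINT y:{-R..R}. cis (\<omega> * y)) / (2 * R) \<le> 2 / \<bar>\<omega>\<bar> / (2 * R)"
      using elim by (intro divide_right_mono) auto
    also have "2 / \<bar>\<omega>\<bar> / (2 * R) = (1 / \<bar>\<omega>\<bar>) * inverse R" using elim assms by (simp add: field_simps)
    finally show ?case
      unfolding integral_uniform_measure_Icc(1)[OF elim cis_meas] using elim by simp
  qed
  show "((\<lambda>R. (1 / \<bar>\<omega>\<bar>) * inverse R) \<longlongrightarrow> 0) at_top"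
    by (rule tendsto_mult_right_zero[OF tendsto_inverse_0_at_top[OF filterlim_ident]])
qed

interpretation rat_real: vector_space "\<lambda>q x. real_of_rat q * x"
  by standard (simp_all add: of_rat_add of_rat_mult algebra_simps)

text \<open>
  With coefficients attached to indices, an integer relation between the \<open>r i\<close> can be fed in directly,
  and rescaling all \<open>r i\<close> by a common factor visibly preserves independence.
\<close>

lemma Q_independent_image_iff:
  fixes r :: "nat \<Rightarrow> real"
  assumes "inj_on r {..<d}"
  shows "Q_independent (r ` {..<d}) \<longleftrightarrow>
    (\<forall>u. (\<Sum>i<d. of_rat (u i) * r i) = 0 \<longrightarrow> (\<forall>i<d. u i = 0))"
proof -
  have *: "(\<Sum>v\<in>r ` {..<d}. of_rat (u v) * v) = (\<Sum>i<d. of_rat (u (r i)) * r i)" for u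
    using assms by (simp add: sum.reindex)
  show ?thesis
  proof
    assume ind: "Q_independent (r ` {..<d})"
    show "\<forall>u. (\<Sum>i<d. of_rat (u i) * r i) = 0 \<longrightarrow> (\<forall>i<d. u i = 0)"
    proof (intro allI impI)
      fix u i assume sum0: "(\<Sum>i<d. of_rat (u i) * r i) = 0" and i: "i < d"
      \<comment> \<open>Coefficients attached to vectors, which determine their indices.\<close>
      define w where "w v = u (inv_into {..<d} r v)" for v
      have w: "w (r i) = u i" if "i < d" for i using assms that by (simp add: w_def)
      have "(\<Sum>v\<in>r ` {..<d}. of_rat (w v) * v) = 0"
        unfolding * using sum0 w by simp
      then have "w (r i) = 0" using rat_real.independentD[OF ind _ subset_refl, of w "r i"] i by simp
      then show "u i = 0" using w[OF i] by simp
    qed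
  next
    assume R: "\<forall>u. (\<Sum>i<d. of_rat (u i) * r i) = 0 \<longrightarrow> (\<forall>i<d. u i = 0)"
    have "\<not> (\<exists>u. (\<exists>v\<in>r ` {..<d}. u v \<noteq> 0) \<and> (\<Sum>v\<in>r ` {..<d}. of_rat (u v) * v) = 0)"
    proof
      assume "\<exists>u. (\<exists>v\<in>r ` {..<d}. u v \<noteq> 0) \<and> (\<Sum>v\<in>r ` {..<d}. of_rat (u v) * v) = 0"
      then obtain u i where "i < d" "u (r i) \<noteq> 0" "(\<Sum>i<d. of_rat (u (r i)) * r i) = 0"
        unfolding * by blast
      then show False using R[rule_format, of "\<lambda>i. u (r i)" i] by blast
    qed
    then show "Q_independent (r ` {..<d})" by (subst rat_real.dependent_finite) auto
  qed
qed

text \<open>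
  On the line a monomial becomes the character of frequency \<open>2 \<pi> \<Sum> e i r i\<close>.  Independence makes this
  frequency non-zero unless all \<open>e i\<close> vanish; its mean then tends to \<open>0\<close>, which is also the integral
  over the torus.
\<close>

lemma mean_trig_poly:
  assumes "trig_poly d F" "inj_on r {..<d}" "Q_independent (r ` {..<d})"
  shows "((\<lambda>R. \<integral>y. F (\<lambda>i. r i * y) \<partial>uniform_measure lborel {-R..R}) \<longlongrightarrow> (\<integral>t. F t \<partial>torus d)) at_top"
  using assms(1)
proof induction
  case (monomial c e)
  define \<omega> where "\<omega> = 2 * pi * (\<Sum>i<d. of_int (e i) * r i)"
  have arg: "2 * pi * (\<Sum>i<d. of_int (e i) * (r i * y)) = \<omega> * y" for y
    by (simp add: \<omega>_def sum_distrib_left sum_distrib_right mult_ac)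
  show ?case
  proof (cases "\<forall>i<d. e i = 0")
    case True
    then have "\<omega> = 0" by (simp add: \<omega>_def)
    have "\<forall>\<^sub>F R in at_top. c = (\<integral>y. c * cis (\<omega> * y) \<partial>uniform_measure lborel {-R..R})"
      using eventually_gt_at_top[of 0]
    proof eventually_elim
      case (elim R)
      interpret prob_space "uniform_measure lborel {-R..R}" by (rule prob_space_uniform_Icc[OF elim])
      show ?case using \<open>\<omega> = 0\<close> prob_space by simp
    qed
    then have "((\<lambda>R. \<integral>y. c * cis (\<omega> * y) \<partial>uniform_measure lborel {-R..R}) \<longlongrightarrow> c) at_top"
      by (rule Lim_transform_eventually[OF tendsto_const])
    then show ?thesis unfolding arg integral_torus_monomial if_P[OF True] .
  next
    case False
    have "\<omega> \<noteq> 0"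
    proof
      assume "\<omega> = 0"
      then have "(\<Sum>i<d. of_rat (of_int (e i)) * r i) = 0" by (simp add: \<omega>_def)
      then have "\<forall>i<d. (of_int (e i) :: rat) = 0"
        using assms(3)[unfolded Q_independent_image_iff[OF assms(2)], rule_format, of "\<lambda>i. of_int (e i)"] by blast
      then show False using False by simp
    qed
    have "((\<lambda>R. c * (\<integral>y. cis (\<omega> * y) \<partial>uniform_measure lborel {-R..R})) \<longlongrightarrow> c * 0) at_top"
      by (intro tendsto_mult_left mean_cis_tendsto_0 \<open>\<omega> \<noteq> 0\<close>)
    then show ?thesis unfolding arg integral_torus_monomial if_not_P[OF False] by simp
  qed
next
  case (add F G)
  have FG: "trig_poly d F" "trig_poly d G" using add.hyps by simp_all
  have torus: "(\<integral>t. F t + G t \<partial>torus d) = (\<integral>t. F t \<partial>torus d) + (\<integral>t. G t \<partial>torus d)"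
    by (intro Bochner_Integration.integral_add prob_space_torus measurable_torus_component
        FG[THEN integrable_trig_poly[where \<theta> = "\<lambda>t. t"]])
  have "\<forall>\<^sub>F R in at_top. (\<integral>y. F (\<lambda>i. r i * y) \<partial>uniform_measure lborel {-R..R}) + (\<integral>y. G (\<lambda>i. r i * y) \<partial>uniform_measure lborel {-R..R})
      = (\<integral>y. F (\<lambda>i. r i * y) + G (\<lambda>i. r i * y) \<partial>uniform_measure lborel {-R..R})"
    using eventually_gt_at_top[of 0]
  proof eventually_elim
    case (elim R)
    show ?case
      by (intro Bochner_Integration.integral_add[symmetric] prob_space_uniform_Icc elim
          FG[THEN integrable_trig_poly[where \<theta> = "\<lambda>y i. r i * y"]]) simp_all
  qed
  then show ?case unfolding torus
    by (rule Lim_transform_eventually[OF tendsto_add[OF add.IH]])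
qed

section \<open>Logarithmic means of exponential sums\<close>

lemma ln_square: "x \<ge> 0 \<Longrightarrow> ln (x\<^sup>2) = 2 * ln x" for x :: real
  by (cases "x = 0") (simp_all add: ln_realpow)

lemma exp_sum_bounded: "cmod (exp_sum J b \<omega> 0 x) \<le> (\<Sum>j\<in>J. cmod (b j))"
  unfolding exp_sum_def by (intro sum_norm_le) (simp add: norm_mult)

text \<open>
  The sublevel estimate is available only on intervals that are not too short, hence the detour over
  a larger interval.
\<close>

lemma ln_exp_sum_set_integrable:
  assumes "finite J" "j0 \<in> J" "inj_on \<omega> J" "b j0 \<noteq> 0"
  shows "set_integrable lborel {-R..R} (\<lambda>y. ln (cmod (exp_sum J b \<omega> 0 y)))"
proof -
  obtain \<kappa> C h where pos: "\<kappa> > 0" "C \<ge> 0" "h > 0" and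
    thin: "\<And>R. R \<ge> h \<Longrightarrow> thin_sublevels (uniform_measure lborel {-R..R})
      (\<lambda>x. (cmod (exp_sum J b \<omega> 0 x))\<^sup>2) \<kappa> (2 * card J) C"
    by (rule exp_sum_thin_sublevels[where b = b, OF assms]) (rule that)
  define S where "S = max h \<bar>R\<bar>"
  have S: "S \<ge> h" "S > 0" "{-R..R} \<subseteq> {-S..S}" using pos by (auto simp: S_def)
  have card: "2 * card J \<ge> 1" using assms card_gt_0_iff[of J] by auto
  interpret prob_space "uniform_measure lborel {-S..S}" by (rule prob_space_uniform_Icc[OF S(2)])
  have "integrable (uniform_measure lborel {-S..S}) (\<lambda>y. ln ((cmod (exp_sum J b \<omega> 0 y))\<^sup>2))"
    by (rule integral_ln_truncation(1)[where B = "(\<Sum>j\<in>J. cmod (b j))\<^sup>2" and \<eta> = 1, OF _ _ _ pos(1) card pos(2) thin[OF S(1)]])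
      (auto intro!: power_mono exp_sum_bounded)
  then have "set_integrable lborel {-S..S} (\<lambda>y. ln ((cmod (exp_sum J b \<omega> 0 y))\<^sup>2))"
    by (subst (asm) integral_uniform_measure_Icc(2)) (auto intro: S)
  then have "set_integrable lborel {-S..S} (\<lambda>y. (1 / 2) * ln ((cmod (exp_sum J b \<omega> 0 y))\<^sup>2))"
    by (rule set_integrable_mult_right)
  then have "set_integrable lborel {-S..S} (\<lambda>y. ln (cmod (exp_sum J b \<omega> 0 y)))"
    by (simp add: ln_square)
  then show ?thesis by (rule set_integrable_subset) (use S in auto)
qed

text \<open>
  The powers of \<open>\<bar>P\<bar>\<^sup>2 = P * cnj P\<close> are trigonometric polynomials, so their means converge to
  the moments on the torus.
\<close>

theorem mean_ln_exp_sum_tendsto: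
  assumes J: "finite J" "j0 \<in> J" "inj_on \<omega> J" "b j0 \<noteq> 0"
    and P: "laurent_in_vars d P" and r: "inj_on r {..<d}" "Q_independent (r ` {..<d})"
    and eval: "\<And>y. exp_sum J b \<omega> 0 y = laurent_eval P (\<lambda>i. cis (2 * pi * r i * y))"
  shows "((\<lambda>R. (LBINT y:{-R..R}. ln (cmod (exp_sum J b \<omega> 0 y))) / (2 * R))
    \<longlongrightarrow> ln (laurent_mahler d P)) at_top"
proof -
  define A where "A = exp_sum J b \<omega> 0"
  define F where "F t = laurent_eval P (\<lambda>i. cis (2 * pi * t i))" for t
  define u where "u y = (cmod (A y))\<^sup>2" for y
  define U where "U t = (cmod (F t))\<^sup>2" for t
  have F: "trig_poly d F" unfolding F_def[abs_def] by (rule trig_poly_laurent_eval[OF P])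
  have A_F: "A y = F (\<lambda>i. r i * y)" for y by (simp add: A_def F_def eval mult.assoc)
  have u_U: "u y = U (\<lambda>i. r i * y)" for y by (simp add: u_def U_def A_F)
  obtain B where B: "\<And>t. cmod (F t) \<le> B" using trig_poly_bounded[OF F] by blast
  have U: "0 \<le> U t" "U t \<le> B\<^sup>2" for t unfolding U_def using B by (auto intro!: power_mono)
  have u: "0 \<le> u y" "u y \<le> B\<^sup>2" for y unfolding u_U by (rule U)+
  have [measurable]: "A \<in> borel_measurable borel" unfolding A_def by (rule borel_measurable_exp_sum)
  have u_meas [measurable]: "u \<in> borel_measurable borel" unfolding u_def[abs_def] by measurable
  have "F \<in> borel_measurable (torus d)"
    using measurable_trig_poly[OF F, of "\<lambda>t. t" "torus d"] measurable_torus_component by simp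
  then have U_meas: "U \<in> borel_measurable (torus d)" unfolding U_def[abs_def] by measurable
  have moments: "((\<lambda>R. \<integral>y. u y ^ k \<partial>uniform_measure lborel {-R..R}) \<longlongrightarrow> (\<integral>t. U t ^ k \<partial>torus d)) at_top" for k
  proof -
    have "trig_poly d (\<lambda>t. (F t * cnj (F t)) ^ k)"
      by (intro trig_poly_power trig_poly_mult trig_poly_cnj F)
    moreover have "(\<lambda>t. (F t * cnj (F t)) ^ k) = (\<lambda>t. complex_of_real (U t ^ k))"
      by (simp add: U_def complex_norm_square[symmetric])
    ultimately have "trig_poly d (\<lambda>t. complex_of_real (U t ^ k))" by simp
    from mean_trig_poly[OF this r]
    show ?thesis unfolding u_U[symmetric] integral_complex_of_real tendsto_of_real_iff .
  qed
  obtain \<kappa> C h where pos: "\<kappa> > 0" "C \<ge> 0" "h > 0" and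
    thin: "\<And>R. R \<ge> h \<Longrightarrow> thin_sublevels (uniform_measure lborel {-R..R})
      (\<lambda>x. (cmod (exp_sum J b \<omega> 0 x))\<^sup>2) \<kappa> (2 * card J) C"
    by (rule exp_sum_thin_sublevels[where b = b, OF J]) (rule that)
  have card: "2 * card J \<ge> 1" using J card_gt_0_iff[of J] by auto
  have M: "\<forall>\<^sub>F R in at_top. prob_space (uniform_measure lborel {-R..R}) \<and>
      u \<in> borel_measurable (uniform_measure lborel {-R..R}) \<and>
      thin_sublevels (uniform_measure lborel {-R..R}) u \<kappa> (2 * card J) C"
    using eventually_ge_at_top[of h]
  proof eventually_elim
    case (elim R)
    then show ?case using thin[OF elim] pos by (simp add: u_def[abs_def] A_def prob_space_uniform_Icc)
  qed
  have "((\<lambda>R. \<integral>y. ln (u y) \<partial>uniform_measure lborel {-R..R}) \<longlongrightarrow> (\<integral>t. ln (U t) \<partial>torus d)) at_top"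
    by (rule tendsto_integral_ln_of_moments[OF _ M prob_space_torus U_meas u U moments pos(1) card pos(2)]) simp
  then have "((\<lambda>R. (1 / 2) * (\<integral>y. ln (u y) \<partial>uniform_measure lborel {-R..R})) \<longlongrightarrow> (1 / 2) * (\<integral>t. ln (U t) \<partial>torus d)) at_top"
    by (rule tendsto_mult_left)
  moreover have "(1 / 2) * (\<integral>t. ln (U t) \<partial>torus d) = ln (laurent_mahler d P)"
    by (simp add: U_def ln_square integral_torus laurent_mahler_def F_def)
  moreover have "\<forall>\<^sub>F R in at_top. (1 / 2) * (\<integral>y. ln (u y) \<partial>uniform_measure lborel {-R..R}) =
      (LBINT y:{-R..R}. ln (cmod (A y))) / (2 * R)"
    using eventually_gt_at_top[of 0]
  proof eventually_elim
    case (elim R)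
    then show ?case
      by (subst integral_uniform_measure_Icc(1)) (simp_all add: u_def ln_square)
  qed
  ultimately show ?thesis unfolding A_def by (simp add: Lim_transform_eventually)
qed

section \<open>The Mahler measure as a logarithmic mean\<close>

text \<open>
  Summing over a common finite set of exponents makes the additivity of evaluation visible.
\<close>

lemma laurent_eval_superset:
  assumes "finite K" "Poly_Mapping.keys P \<subseteq> K"
  shows "laurent_eval P z = (\<Sum>e\<in>K. Poly_Mapping.lookup P e *
        (\<Prod>i\<in>Poly_Mapping.keys e. z i powi Poly_Mapping.lookup e i))"
  unfolding laurent_eval_def using assms by (intro sum.mono_neutral_left) (auto simp: in_keys_iff)

lemma laurent_eval_add: "laurent_eval (P + Q) z = laurent_eval P z + laurent_eval Q z"
proof -
  let ?K = "Poly_Mapping.keys P \<union> Poly_Mapping.keys Q"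
  have "finite ?K" by simp
  then show ?thesis
    using keys_add[of P Q]
    by (simp add: laurent_eval_superset[of ?K] lookup_add distrib_right sum.distrib)
qed

lemma laurent_eval_single:
  "laurent_eval (Poly_Mapping.single e c) z = c * (\<Prod>i\<in>Poly_Mapping.keys e. z i powi Poly_Mapping.lookup e i)"
  by (simp add: laurent_eval_superset[of "{e}"])

lemma laurent_eval_sum:
  assumes "finite J"
  shows "laurent_eval (\<Sum>j\<in>J. P j) z = (\<Sum>j\<in>J. laurent_eval (P j) z)"
  using assms by (induction J) (simp_all add: laurent_eval_add, simp add: laurent_eval_def)

lemma laurent_in_vars_sum:
  assumes "finite J" "\<And>j. j \<in> J \<Longrightarrow> laurent_in_vars d (P j)"
  shows "laurent_in_vars d (\<Sum>j\<in>J. P j)"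
  using assms
proof (induction J)
  case (insert j J)
  then show ?case using keys_add[of "P j" "\<Sum>j\<in>J. P j"] by (auto simp: laurent_in_vars_def)
qed (simp add: laurent_in_vars_def)

lemma common_denominator:
  assumes "finite (Q :: rat set)"
  obtains N :: int where "N > 0" "\<And>q. q \<in> Q \<Longrightarrow> of_int N * q \<in> \<int>"
proof -
  have "\<exists>N::int. N > 0 \<and> (\<forall>q\<in>Q. of_int N * q \<in> \<int>)"
    using assms
  proof (induction Q)
    case empty
    show ?case by (rule exI[of _ 1]) simp
  next
    case (insert q Q)
    then obtain N :: int where N: "N > 0" "\<forall>q\<in>Q. of_int N * q \<in> \<int>" by blast
    obtain a b where q: "q = Rat.Fract a b" "b > 0" by (cases q) blast
    have "of_int (N * b) * q = of_int (N * a)" using q by (simp add: Fract_of_int_quotient)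
    then have "of_int (N * b) * q \<in> \<int>" by (simp only: Ints_of_int)
    moreover have "of_int (N * b) * p \<in> \<int>" if "p \<in> Q" for p
    proof -
      have "of_int (N * b) * p = of_int b * (of_int N * p)" by simp
      then show ?thesis using N(2) that by (simp only: Ints_mult Ints_of_int)
    qed
    ultimately show ?case using N(1) q(2) by (intro exI[of _ "N * b"]) auto
  qed
  then show thesis using that by blast
qed

text \<open>
  An independent subset of maximal cardinality spans \<open>S\<close>.
\<close>

lemma Q_rank_basis:
  assumes "finite S"
  obtains B where "B \<subseteq> S" "Q_independent B" "card B = Q_rank S" "S \<subseteq> rat_real.span B"
proof -
  let ?C = "{card B | B. B \<subseteq> S \<and> Q_independent B}"
  have "?C \<subseteq> {..card S}" using card_mono[OF assms] by auto
  then have fin: "finite ?C" by (rule finite_subset) simp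
  have "{} \<subseteq> S \<and> Q_independent {}" using rat_real.independent_empty by simp
  then have "card ({} :: real set) \<in> ?C" by blast
  then have "Q_rank S \<in> ?C" unfolding Q_rank_def by (intro Max_in fin) auto
  then obtain B where B: "B \<subseteq> S" "Q_independent B" "card B = Q_rank S" by auto
  have "x \<in> rat_real.span B" if "x \<in> S" for x
  proof (rule ccontr)
    assume x: "x \<notin> rat_real.span B"
    then have "x \<notin> B" using rat_real.span_base by blast
    have "Q_independent (insert x B)" by (rule rat_real.independent_insertI[OF x B(2)])
    then have "card (insert x B) \<in> ?C" using B(1) that by blast
    then have "card (insert x B) \<le> Q_rank S" unfolding Q_rank_def by (rule Max_ge[OF fin])
    then show False using \<open>x \<notin> B\<close> finite_subset[OF B(1) assms] B(3) by simp
  qed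
  then show thesis using B that by blast
qed

text \<open>
  Divide the elements of a rational basis by a common denominator of all coordinates.
\<close>

lemma integer_basis:
  assumes "finite S"
  obtains r z where "inj_on r {..<Q_rank S}" "Q_independent (r ` {..<Q_rank S})"
    "\<And>x. x \<in> S \<Longrightarrow> x = (\<Sum>i<Q_rank S. of_int (z x i :: int) * r i)"
proof -
  let ?d = "Q_rank S"
  obtain B where B: "B \<subseteq> S" "Q_independent B" "card B = ?d" "S \<subseteq> rat_real.span B"
    using Q_rank_basis[OF assms] by blast
  have finB: "finite B" by (rule finite_subset[OF B(1) assms])
  obtain r0 where r0: "bij_betw r0 {..<?d} B"
    using ex_bij_betw_nat_finite[OF finB] B(3) by (auto simp: atLeast0LessThan)
  have inj0: "inj_on r0 {..<?d}" and im0: "r0 ` {..<?d} = B" using r0 by (auto simp: bij_betw_def)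
  have "\<exists>q. x = (\<Sum>i<?d. of_rat (q i) * r0 i)" if "x \<in> S" for x
  proof -
    have "x \<in> range (\<lambda>u. \<Sum>v\<in>B. of_rat (u v) * v)"
      using that B(4) unfolding rat_real.span_finite[OF finB] by blast
    then obtain u where "x = (\<Sum>v\<in>B. of_rat (u v) * v)" by blast
    also have "\<dots> = (\<Sum>i<?d. of_rat (u (r0 i)) * r0 i)"
      unfolding im0[symmetric] using inj0 by (simp add: sum.reindex)
    finally show ?thesis by (intro exI[of _ "\<lambda>i. u (r0 i)"])
  qed
  then obtain q where q: "\<And>x. x \<in> S \<Longrightarrow> x = (\<Sum>i<?d. of_rat (q x i) * r0 i)" by metis
  have "finite ((\<lambda>(x, i). q x i) ` (S \<times> {..<?d}))" using assms by simp
  then obtain N :: int where N: "N > 0" "\<And>x i. x \<in> S \<Longrightarrow> i < ?d \<Longrightarrow> of_int N * q x i \<in> \<int>"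
    by (rule common_denominator) auto
  define z :: "real \<Rightarrow> nat \<Rightarrow> int" where "z x i = \<lfloor>of_int N * q x i\<rfloor>" for x i
  have z: "of_int N * q x i = of_int (z x i)" if "x \<in> S" "i < ?d" for x i
    using N(2)[OF that] by (simp add: z_def)
  define r where "r i = r0 i / of_int N" for i
  have N0: "(of_int N :: real) \<noteq> 0" using N(1) by simp
  have inj: "inj_on r {..<?d}" using inj0 N0 by (auto simp: inj_on_def r_def)
  show thesis
  proof (rule that[OF inj])
    show "Q_independent (r ` {..<?d})"
      unfolding Q_independent_image_iff[OF inj]
    proof (intro allI impI)
      fix u i assume sum0: "(\<Sum>i<?d. of_rat (u i) * r i) = 0" and i: "i < ?d"
      have "(\<Sum>i<?d. of_rat (u i) * r0 i) = of_int N * (\<Sum>i<?d. of_rat (u i) * r i)"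
        using N0 by (simp add: r_def sum_distrib_left)
      then have "(\<Sum>i<?d. of_rat (u i) * r0 i) = 0" using sum0 by simp
      then show "u i = 0"
        using B(2) i Q_independent_image_iff[OF inj0] unfolding im0 by blast
    qed
    fix x assume x: "x \<in> S"
    have "x = (\<Sum>i<?d. of_rat (q x i) * r0 i)" by (rule q[OF x])
    also have "\<dots> = (\<Sum>i<?d. of_int (z x i) * r i)"
    proof (intro sum.cong refl)
      fix i assume "i \<in> {..<?d}"
      then have "real_of_rat (of_int N * q x i) = of_int (z x i)" using z[OF x, of i] by simp
      then show "of_rat (q x i) * r0 i = of_int (z x i) * r i"
        using N0 by (simp add: r_def of_rat_mult field_simps)
    qed
    finally show "x = (\<Sum>i<?d. of_int (z x i) * r i)" .
  qed
qed

text \<open>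
  The integer coordinates of the frequencies are the exponents of \<open>P\<close>.  If two frequencies had the same
  coordinates their coefficients would be added, which is harmless.
\<close>

lemma exp_sum_laurent_representation:
  assumes "finite J"
  obtains P r where "laurent_in_vars (Q_rank (\<tau> ` J)) P" "inj_on r {..<Q_rank (\<tau> ` J)}"
    "Q_independent (r ` {..<Q_rank (\<tau> ` J)})"
    "\<And>y. exp_sum J b (\<lambda>j. 2 * pi * \<tau> j) 0 y = laurent_eval P (\<lambda>i. cis (2 * pi * r i * y))"
proof -
  define d where "d = Q_rank (\<tau> ` J)"
  obtain r z where r: "inj_on r {..<d}" "Q_independent (r ` {..<d})"
    and z: "\<And>x. x \<in> \<tau> ` J \<Longrightarrow> x = (\<Sum>i<d. of_int (z x i :: int) * r i)"
    using integer_basis[of "\<tau> ` J"] assms unfolding d_def by blast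
  define E :: "'a \<Rightarrow> nat \<Rightarrow>\<^sub>0 int" where "E j = (\<Sum>i<d. Poly_Mapping.single i (z (\<tau> j) i))" for j
  have lookup_E: "Poly_Mapping.lookup (E j) i = z (\<tau> j) i" if "i < d" for i j
    using that by (simp add: E_def lookup_sum lookup_single when_def)
  have keys_E: "Poly_Mapping.keys (E j) \<subseteq> {..<d}" for j
    by (auto simp: E_def in_keys_iff lookup_sum lookup_single when_def split: if_splits)
  define P where "P = (\<Sum>j\<in>J. Poly_Mapping.single (E j) (b j))"
  have "laurent_in_vars d P"
    unfolding P_def using assms keys_E by (intro laurent_in_vars_sum) (auto simp: laurent_in_vars_def)
  moreover have "exp_sum J b (\<lambda>j. 2 * pi * \<tau> j) 0 y = laurent_eval P (\<lambda>i. cis (2 * pi * r i * y))" for y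
  proof -
    have "laurent_eval P (\<lambda>i. cis (2 * pi * r i * y)) = (\<Sum>j\<in>J. b j * cis (\<Sum>i<d. of_int (z (\<tau> j) i) * (2 * pi * r i * y)))"
      unfolding P_def laurent_eval_sum[OF assms] laurent_eval_single
      using lookup_E by (simp add: laurent_monomial_cis[OF keys_E])
    also have "\<dots> = (\<Sum>j\<in>J. b j * cis (2 * pi * \<tau> j * y))"
    proof (intro sum.cong refl arg_cong2[where f = "(*)"] arg_cong[where f = cis])
      fix j assume "j \<in> J"
      then have "\<tau> j = (\<Sum>i<d. of_int (z (\<tau> j) i) * r i)" by (intro z) auto
      then have "2 * pi * \<tau> j * y = 2 * pi * (\<Sum>i<d. of_int (z (\<tau> j) i) * r i) * y" by simp
      then show "(\<Sum>i<d. of_int (z (\<tau> j) i) * (2 * pi * r i * y)) = 2 * pi * \<tau> j * y"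
        by (simp add: sum_distrib_left sum_distrib_right mult_ac)
    qed
    finally show ?thesis by (simp add: exp_sum_def)
  qed
  ultimately show thesis using r that unfolding d_def by blast
qed

text \<open>
  The Mahler measure is defined as the unique common value over all representations.  There is one by
  \<open>exp_sum_laurent_representation\<close>, and all values agree because each of them is determined by the
  limit on the left, which does not mention the representation.
\<close>

theorem mean_ln_tendsto_mahler_measure:
  assumes J: "finite J" "j0 \<in> J" "inj_on \<tau> J" "b j0 \<noteq> 0"
  defines "A \<equiv> exp_sum J b (\<lambda>j. 2 * pi * \<tau> j) 0"
  shows "((\<lambda>R. (LBINT y:{-R..R}. ln (cmod (A y))) / (2 * R)) \<longlongrightarrow> ln (mahler_measure (\<tau> ` J) A)) at_top"
proof -
  let ?d = "Q_rank (\<tau> ` J)"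
  let ?G = "\<lambda>R. (LBINT y:{-R..R}. ln (cmod (A y))) / (2 * R)"
  have inj: "inj_on (\<lambda>j. 2 * pi * \<tau> j) J" using J(3) by (auto simp: inj_on_def)
  have lim: "(?G \<longlongrightarrow> ln (laurent_mahler ?d P)) at_top"
    if "laurent_in_vars ?d P" "inj_on r {..<?d}" "Q_independent (r ` {..<?d})"
      "\<And>y. A y = laurent_eval P (\<lambda>i. cis (2 * pi * r i * y))" for P r
    unfolding A_def
    by (rule mean_ln_exp_sum_tendsto[where b = b, OF J(1,2) inj J(4) that(1-3)]) (use that(4) in \<open>simp add: A_def\<close>)
  obtain P r where P: "laurent_in_vars ?d P" "inj_on r {..<?d}" "Q_independent (r ` {..<?d})"
    "\<And>y. A y = laurent_eval P (\<lambda>i. cis (2 * pi * r i * y))"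
    using exp_sum_laurent_representation[OF J(1), of \<tau> b] unfolding A_def by metis
  have "mahler_measure (\<tau> ` J) A = laurent_mahler ?d P"
    unfolding mahler_measure_def Let_def
  proof (rule the_equality)
    show "\<exists>Q s. laurent_in_vars ?d Q \<and> inj_on s {..<?d} \<and> Q_independent (s ` {..<?d}) \<and>
        (\<forall>y. A y = laurent_eval Q (\<lambda>i. cis (2 * pi * s i * y))) \<and> laurent_mahler ?d P = laurent_mahler ?d Q"
      using P by (intro exI[of _ P] exI[of _ r]) auto
  next
    fix M assume "\<exists>Q s. laurent_in_vars ?d Q \<and> inj_on s {..<?d} \<and> Q_independent (s ` {..<?d}) \<and>
        (\<forall>y. A y = laurent_eval Q (\<lambda>i. cis (2 * pi * s i * y))) \<and> M = laurent_mahler ?d Q"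
    then obtain Q s where Q: "laurent_in_vars ?d Q" "inj_on s {..<?d}" "Q_independent (s ` {..<?d})"
        "\<And>y. A y = laurent_eval Q (\<lambda>i. cis (2 * pi * s i * y))" and M: "M = laurent_mahler ?d Q"
      by blast
    have "ln (laurent_mahler ?d Q) = ln (laurent_mahler ?d P)"
      using lim[OF Q] lim[OF P] by (rule tendsto_unique[rotated]) simp
    then show "M = laurent_mahler ?d P" by (simp add: M laurent_mahler_def)
  qed
  then show ?thesis using lim[OF P] by simp
qed

section \<open>Growth of a function satisfying a refinement equation\<close>

text \<open>
  Beyond some \<open>a\<close>, each multiplication of \<open>L\<close> by \<open>s\<close> changes \<open>H\<close> by less than \<open>\<epsilon>\<close>.  As \<open>L\<close> is reached
  from \<open>[a, s a]\<close>, where \<open>H\<close> is bounded, in at most \<open>ln L / ln s\<close> steps, \<open>H L\<close> is at most a constant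
  plus \<open>\<epsilon> ln L / ln s\<close>.
\<close>

lemma tendsto_over_ln_of_increments:
  fixes H :: "real \<Rightarrow> real"
  assumes s: "s > 1" and inc: "((\<lambda>L. H (s * L) - H L) \<longlongrightarrow> 0) at_top"
    and bdd: "\<And>a. a \<ge> 1 \<Longrightarrow> \<exists>K. \<forall>L\<in>{a..s * a}. \<bar>H L\<bar> \<le> K"
  shows "((\<lambda>L. H L / ln L) \<longlongrightarrow> 0) at_top"
proof (rule tendstoI)
  fix e :: real assume e: "e > 0"
  have ln_s: "ln s > 0" using s by simp
  define \<epsilon> where "\<epsilon> = e / 2 * ln s"
  have \<epsilon>: "\<epsilon> > 0" using e ln_s by (simp add: \<epsilon>_def)
  have "\<forall>\<^sub>F L in at_top. \<bar>H (s * L) - H L\<bar> < \<epsilon>" using tendstoD[OF inc \<epsilon>] by (simp add: dist_real_def)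
  then obtain a0 where a0: "\<And>L. L \<ge> a0 \<Longrightarrow> \<bar>H (s * L) - H L\<bar> < \<epsilon>"
    unfolding eventually_at_top_linorder by blast
  define a where "a = max 1 a0"
  have a: "a \<ge> 1" "\<And>L. L \<ge> a \<Longrightarrow> \<bar>H (s * L) - H L\<bar> < \<epsilon>" using a0 by (auto simp: a_def)
  obtain K where K: "\<And>L. L \<in> {a..s * a} \<Longrightarrow> \<bar>H L\<bar> \<le> K" using bdd[OF a(1)] by blast
  have steps: "\<bar>H L\<bar> \<le> K + n * \<epsilon>" if "a * s ^ n \<le> L" "L \<le> a * s ^ Suc n" for n L
    using that
  proof (induction n arbitrary: L)
    case 0
    then show ?case using K[of L] by (simp add: mult.commute)
  next
    case (Suc n)
    have L: "a * s ^ n \<le> L / s" "L / s \<le> a * s ^ Suc n" using Suc.prems s by (simp_all add: field_simps)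
    have "1 \<le> s ^ n" using s by simp
    then have "a * 1 \<le> a * s ^ n" using a(1) by (intro mult_left_mono) auto
    then have "\<bar>H (s * (L / s)) - H (L / s)\<bar> < \<epsilon>" using L by (intro a(2)) linarith
    then have "\<bar>H L - H (L / s)\<bar> < \<epsilon>" using s by simp
    then show ?case using Suc.IH[OF L] by (simp add: distrib_right)
  qed
  have bound: "\<bar>H L\<bar> \<le> K + e / 2 * ln L" if "L \<ge> a" for L
  proof -
    have pos: "L > 0" "a > 0" "L / a \<ge> 1" using that a(1) by auto
    define n where "n = nat \<lfloor>ln (L / a) / ln s\<rfloor>"
    have "ln (L / a) / ln s \<ge> 0" using pos ln_s by (intro divide_nonneg_pos) auto
    then have n: "real n \<le> ln (L / a) / ln s" "ln (L / a) / ln s < real n + 1" unfolding n_def by linarith+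
    have "ln (s ^ n) \<le> ln (L / a)" using n(1) ln_s s by (simp add: ln_realpow pos_le_divide_eq)
    then have "s ^ n \<le> L / a" using s pos by (subst (asm) ln_le_cancel_iff) auto
    moreover have "ln (L / a) \<le> ln (s ^ Suc n)"
    proof -
      have "ln (L / a) < (real n + 1) * ln s" using n(2) ln_s by (simp add: pos_divide_less_eq)
      also have "\<dots> = ln (s ^ Suc n)" using s by (subst ln_realpow) (auto simp: algebra_simps)
      finally show ?thesis by simp
    qed
    then have "L / a \<le> s ^ Suc n" using s pos by (subst (asm) ln_le_cancel_iff) auto
    ultimately have "\<bar>H L\<bar> \<le> K + n * \<epsilon>" using pos by (intro steps) (simp_all add: field_simps)
    also have "real n * \<epsilon> \<le> ln L / ln s * \<epsilon>"
    proof (rule mult_right_mono)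
      have "ln (L / a) \<le> ln L" using pos a(1) by (simp add: ln_div)
      then have "ln (L / a) / ln s \<le> ln L / ln s" using ln_s by (intro divide_right_mono) auto
      then show "real n \<le> ln L / ln s" using n(1) by linarith
    qed (use \<epsilon> in simp)
    also have "ln L / ln s * \<epsilon> = e / 2 * ln L" using ln_s by (simp add: \<epsilon>_def)
    finally show ?thesis by simp
  qed
  have "\<forall>\<^sub>F L in at_top. ln L > max 0 (2 * K / e)"
    using filterlim_at_top_dense[THEN iffD1, OF ln_at_top] by blast
  with eventually_ge_at_top[of a] show "\<forall>\<^sub>F L in at_top. dist (H L / ln L) 0 < e"
  proof eventually_elim
    case (elim L)
    then have ln: "ln L > 0" "2 * K / e < ln L" by auto
    then have "K < e / 2 * ln L" using e by (simp add: field_simps)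
    then have "\<bar>H L\<bar> < e * ln L" using bound[OF elim(1)] by linarith
    then show ?case using ln(1) by (simp add: dist_real_def abs_divide pos_divide_less_eq)
  qed
qed

lemma set_integral_scale:
  fixes g :: "real \<Rightarrow> real"
  assumes "c \<noteq> 0"
  shows "set_integrable lborel {-L..L} (\<lambda>y. g (y / c)) \<longleftrightarrow> set_integrable lborel {-(L / \<bar>c\<bar>)..L / \<bar>c\<bar>} g"
    and "(LBINT y:{-L..L}. g (y / c)) = \<bar>c\<bar> * (LBINT y:{-(L / \<bar>c\<bar>)..L / \<bar>c\<bar>}. g y)"
proof -
  let ?f = "\<lambda>y. indicator {-L..L} y *\<^sub>R g (y / c)"
  have "c * x \<in> {-L..L} \<longleftrightarrow> x \<in> {-(L / \<bar>c\<bar>)..L / \<bar>c\<bar>}" for x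
  proof -
    have "c * x \<in> {-L..L} \<longleftrightarrow> \<bar>c\<bar> * \<bar>x\<bar> \<le> L" by (auto simp: abs_le_iff abs_mult[symmetric])
    also have "\<dots> \<longleftrightarrow> \<bar>x\<bar> \<le> L / \<bar>c\<bar>" using assms by (simp add: pos_le_divide_eq mult.commute)
    finally show ?thesis by (auto simp: abs_le_iff)
  qed
  then have eq: "?f (0 + c * x) = indicator {-(L / \<bar>c\<bar>)..L / \<bar>c\<bar>} x *\<^sub>R g x" for x
    using assms by (simp add: indicator_def)
  show "set_integrable lborel {-L..L} (\<lambda>y. g (y / c)) \<longleftrightarrow> set_integrable lborel {-(L / \<bar>c\<bar>)..L / \<bar>c\<bar>} g"
    using lborel_integrable_real_affine_iff[OF assms, of ?f 0] unfolding eq set_integrable_def by simp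
  show "(LBINT y:{-L..L}. g (y / c)) = \<bar>c\<bar> * (LBINT y:{-(L / \<bar>c\<bar>)..L / \<bar>c\<bar>}. g y)"
    using lborel_integral_real_affine[OF assms, of ?f 0] unfolding eq set_lebesgue_integral_def by simp
qed

text \<open>
  The functional equation gives \<open>J (s * L) = G L + J L\<close> for the means \<open>J\<close> and \<open>G\<close> of \<open>ln \<bar>\<Phi>\<bar>\<close> and
  \<open>ln \<bar>A\<bar>\<close>, where \<open>s = \<bar>lam\<bar>\<close>.  Subtracting \<open>\<mu> / ln s * ln L\<close> from \<open>J\<close> leaves a function whose
  increments tend to \<open>0\<close>.  Iterating the equation also shows that \<open>\<Phi>\<close> is measurable and almost
  everywhere non-zero, and that \<open>ln \<bar>\<Phi>\<bar>\<close> is integrable on bounded intervals.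
\<close>

theorem mean_ln_of_refinement:
  fixes \<Phi> A :: "real \<Rightarrow> complex"
  assumes lam: "\<bar>lam\<bar> > 1" and refine: "\<And>y. \<Phi> y = A (y / lam) * \<Phi> (y / lam)"
    and \<Phi>_0: "\<Phi> 0 = 1" "(\<Phi> \<longlongrightarrow> 1) (at 0)"
    and A_meas [measurable]: "A \<in> borel_measurable borel" and A_nz: "AE y in lborel. A y \<noteq> 0"
    and A_int: "\<And>R. set_integrable lborel {-R..R} (\<lambda>y. ln (cmod (A y)))"
    and mean: "((\<lambda>R. (LBINT y:{-R..R}. ln (cmod (A y))) / (2 * R)) \<longlongrightarrow> \<mu>) at_top"
  shows "((\<lambda>L. (LBINT y:{-L..L}. ln (cmod (\<Phi> y))) / (2 * L * ln L)) \<longlongrightarrow> \<mu> / ln \<bar>lam\<bar>) at_top"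
proof -
  have lam0: "lam \<noteq> 0" using lam by auto
  define s where "s = \<bar>lam\<bar>"
  have s: "s > 1" using lam by (simp add: s_def)
  have iterate: "\<Phi> y = (\<Prod>k<n. A (y / lam ^ Suc k)) * \<Phi> (y / lam ^ n)" for n y
  proof (induction n)
    case (Suc n)
    have "\<Phi> (y / lam ^ n) = A (y / lam ^ Suc n) * \<Phi> (y / lam ^ Suc n)"
      using refine[of "y / lam ^ n"] by (simp add: mult.commute)
    then show ?case using Suc by simp
  qed simp
  have tail: "(\<lambda>n. \<Phi> (y / lam ^ n)) \<longlonglongrightarrow> 1" for y
  proof -
    have "(\<lambda>n. (1 / lam) ^ n) \<longlonglongrightarrow> 0" using lam by (intro LIMSEQ_power_zero) simp
    then have "(\<lambda>n. y * (1 / lam) ^ n) \<longlonglongrightarrow> 0" by (rule tendsto_mult_right_zero)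
    moreover have "isCont \<Phi> 0" using \<Phi>_0 by (simp add: isCont_def)
    ultimately have "(\<lambda>n. \<Phi> (y * (1 / lam) ^ n)) \<longlonglongrightarrow> \<Phi> 0" using isCont_tendsto_compose by blast
    then show ?thesis by (simp add: \<Phi>_0 power_one_over)
  qed
  have tail_nz: "\<forall>\<^sub>F n in sequentially. \<Phi> (y / lam ^ n) \<noteq> 0" for y
    by (rule tendsto_imp_eventually_ne[OF tail]) simp
  have \<Phi>_meas [measurable]: "\<Phi> \<in> borel_measurable borel"
  proof (rule borel_measurable_LIMSEQ_metric)
    show "(\<lambda>y. \<Prod>k<n. A (y / lam ^ Suc k)) \<in> borel_measurable borel" for n by measurable
    fix y
    have "(\<lambda>n. \<Phi> y / \<Phi> (y / lam ^ n)) \<longlonglongrightarrow> \<Phi> y / 1"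
      by (intro tendsto_divide tendsto_const tail) simp
    moreover have "\<forall>\<^sub>F n in sequentially. \<Phi> y / \<Phi> (y / lam ^ n) = (\<Prod>k<n. A (y / lam ^ Suc k))"
      using tail_nz[of y]
    proof eventually_elim
      case (elim n)
      then show ?case by (subst iterate[of y n]) simp
    qed
    ultimately show "(\<lambda>n. \<Prod>k<n. A (y / lam ^ Suc k)) \<longlonglongrightarrow> \<Phi> y"
      using Lim_transform_eventually by fastforce
  qed
  have scaled_nz: "AE y in lborel. A (y / lam ^ Suc k) \<noteq> 0" for k
    using AE_borel_affine[of "1 / lam ^ Suc k" "\<lambda>y. A y \<noteq> 0" 0] A_nz lam0 by simp
  have \<Phi>_nz: "AE y in lborel. \<Phi> y \<noteq> 0"
  proof -
    have "AE y in lborel. \<forall>k. A (y / lam ^ Suc k) \<noteq> 0" by (intro AE_all_countable[THEN iffD2] allI scaled_nz)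
    then show ?thesis
    proof eventually_elim
      case (elim y)
      obtain n where "\<Phi> (y / lam ^ n) \<noteq> 0" using tail_nz[of y] eventually_happens'[OF sequentially_bot] by blast
      then show ?case using elim by (subst iterate[of y n]) simp
    qed
  qed
  let ?a = "\<lambda>y. ln (cmod (A y))" and ?\<phi> = "\<lambda>y. ln (cmod (\<Phi> y))"
  have split: "AE y in lborel. ?\<phi> y = ?a (y / lam) + ?\<phi> (y / lam)"
    using scaled_nz[of 0] \<Phi>_nz
  proof eventually_elim
    case (elim y)
    have "\<Phi> (y / lam) \<noteq> 0" using elim(2) refine[of y] by auto
    then show ?case using elim(1) by (subst refine) (simp add: norm_mult ln_mult)
  qed
  obtain \<delta> where \<delta>: "\<delta> > 0" "\<And>y. \<bar>y\<bar> \<le> \<delta> \<Longrightarrow> cmod (\<Phi> y - 1) \<le> 1 / 2"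
  proof -
    have "\<forall>\<^sub>F y in at 0. dist (\<Phi> y) 1 < 1 / 2" by (rule tendstoD[OF \<Phi>_0(2)]) simp
    then obtain d where d: "d > 0" "\<And>y. y \<noteq> 0 \<Longrightarrow> \<bar>y\<bar> < d \<Longrightarrow> cmod (\<Phi> y - 1) < 1 / 2"
      unfolding eventually_at by (auto simp: dist_norm)
    have "cmod (\<Phi> y - 1) \<le> 1 / 2" if "\<bar>y\<bar> \<le> d / 2" for y
      using d(1) d(2)[of y] that \<Phi>_0(1) by (cases "y = 0") auto
    then show ?thesis using that[of "d / 2"] d(1) by simp
  qed
  have small: "\<bar>?\<phi> y\<bar> \<le> 1" if "\<bar>y\<bar> \<le> \<delta>" for y
  proof -
    have "cmod (\<Phi> y) \<le> 1 + 1 / 2" "1 - 1 / 2 \<le> cmod (\<Phi> y)"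
      using \<delta>(2)[OF that] norm_triangle_ineq2[of "\<Phi> y" 1] norm_triangle_ineq3[of "\<Phi> y" 1] by (simp_all add: abs_le_iff)
    then have b: "1 / 2 \<le> cmod (\<Phi> y)" "cmod (\<Phi> y) \<le> 3 / 2" by simp_all
    have "ln (1 / 2) \<le> ?\<phi> y" using b by (intro ln_mono) auto
    moreover have "?\<phi> y \<le> cmod (\<Phi> y) - 1" using b by (intro ln_le_minus_one) linarith
    ultimately show ?thesis using b ln_2_less_1 by (simp add: ln_div abs_le_iff)
  qed
  have int: "set_integrable lborel {-L..L} ?\<phi>" if "L \<le> \<delta> * s ^ n" for n L
    using that
  proof (induction n arbitrary: L)
    case 0
    show ?case unfolding set_integrable_def
      by (rule integrableI_bounded_set_indicator[where B = 1])
        (use 0 small in \<open>auto simp: abs_le_iff emeasure_lborel_Icc_eq\<close>)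
  next
    case (Suc n)
    have "L / s \<le> \<delta> * s ^ n" using Suc.prems s by (simp add: field_simps)
    then have "set_integrable lborel {-L..L} (\<lambda>y. ?\<phi> (y / lam))"
      using Suc.IH[of "L / s"] by (subst set_integral_scale[OF lam0]) (simp add: s_def)
    moreover have "set_integrable lborel {-L..L} (\<lambda>y. ?a (y / lam))"
      by (subst set_integral_scale[OF lam0]) (rule A_int)
    ultimately have "set_integrable lborel {-L..L} (\<lambda>y. ?a (y / lam) + ?\<phi> (y / lam))"
      by (intro set_integral_add)
    moreover have "set_integrable lborel {-L..L} ?\<phi> \<longleftrightarrow> set_integrable lborel {-L..L} (\<lambda>y. ?a (y / lam) + ?\<phi> (y / lam))"
      unfolding set_integrable_def
    proof (rule integrable_cong_AE)
      show "AE y in lborel. indicat_real {-L..L} y *\<^sub>R ?\<phi> y = indicat_real {-L..L} y *\<^sub>R (?a (y / lam) + ?\<phi> (y / lam))"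
        using split by eventually_elim simp
    qed measurable
    ultimately show ?case by simp
  qed
  have \<phi>_int: "set_integrable lborel {-L..L} ?\<phi>" for L
  proof -
    obtain n where "L / \<delta> < s ^ n" using real_arch_pow[OF s] by blast
    then show ?thesis using \<delta>(1) by (intro int[of L n]) (simp add: pos_divide_less_eq mult.commute)
  qed
  define J where "J L = (LBINT y:{-L..L}. ?\<phi> y) / (2 * L)" for L
  define G where "G L = (LBINT y:{-L..L}. ?a y) / (2 * L)" for L
  have J_rec: "J (s * L) = G L + J L" if "L > 0" for L
  proof -
    have L: "s * L / \<bar>lam\<bar> = L" using lam0 by (simp add: s_def)
    have "(LBINT y:{-(s * L)..s * L}. ?\<phi> y) = (LBINT y:{-(s * L)..s * L}. ?a (y / lam) + ?\<phi> (y / lam))"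
      unfolding set_lebesgue_integral_def
    proof (rule integral_cong_AE)
      show "AE y in lborel. indicat_real {-(s * L)..s * L} y *\<^sub>R ?\<phi> y =
          indicat_real {-(s * L)..s * L} y *\<^sub>R (?a (y / lam) + ?\<phi> (y / lam))"
        using split by eventually_elim simp
    qed measurable
    also have "\<dots> = (LBINT y:{-(s * L)..s * L}. ?a (y / lam)) + (LBINT y:{-(s * L)..s * L}. ?\<phi> (y / lam))"
      by (intro set_integral_add; subst set_integral_scale[OF lam0]) (rule A_int \<phi>_int)+
    also have "\<dots> = s * (LBINT y:{-L..L}. ?a y) + s * (LBINT y:{-L..L}. ?\<phi> y)"
      unfolding set_integral_scale(2)[OF lam0, where g = ?a] set_integral_scale(2)[OF lam0, where g = ?\<phi>] L
      by (simp add: s_def)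
    finally show ?thesis using that s by (simp add: J_def G_def field_simps)
  qed
  \<comment> \<open>The subtracted term grows by exactly \<open>\<mu>\<close> when \<open>L\<close> is multiplied by \<open>s\<close>.\<close>
  define H where "H L = J L - \<mu> / ln s * ln L" for L
  have ln_s: "ln s > 0" using s by simp
  have "((\<lambda>L. H L / ln L) \<longlongrightarrow> 0) at_top"
  proof (rule tendsto_over_ln_of_increments[OF s])
    have "((\<lambda>L. G L - \<mu>) \<longlongrightarrow> \<mu> - \<mu>) at_top"
      unfolding G_def by (intro tendsto_diff mean tendsto_const)
    moreover have "\<forall>\<^sub>F L in at_top. G L - \<mu> = H (s * L) - H L"
      using eventually_gt_at_top[of 0]
    proof eventually_elim
      case (elim L)
      have "ln (s * L) = ln s + ln L" using s elim by (simp add: ln_mult)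
      then show ?case using ln_s by (simp add: H_def J_rec[OF elim] distrib_left)
    qed
    ultimately show "((\<lambda>L. H (s * L) - H L) \<longlongrightarrow> 0) at_top"
      by (simp add: Lim_transform_eventually)
  next
    fix a :: real assume a: "a \<ge> 1"
    define W where "W = (\<integral>y. indicator {-(s * a)..s * a} y *\<^sub>R \<bar>?\<phi> y\<bar> \<partial>lborel)"
    have "\<bar>H L\<bar> \<le> W + \<bar>\<mu> / ln s\<bar> * ln (s * a)" if L: "L \<in> {a..s * a}" for L
    proof -
      have "norm (LBINT y:{-L..L}. ?\<phi> y) \<le> W"
        unfolding W_def set_lebesgue_integral_def
      proof (rule order_trans[OF integral_norm_bound], rule integral_mono)
        show "integrable lborel (\<lambda>y. norm (indicat_real {-L..L} y *\<^sub>R ?\<phi> y))"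
          using \<phi>_int[of L] by (intro integrable_norm) (simp add: set_integrable_def)
        show "integrable lborel (\<lambda>y. indicat_real {-(s * a)..s * a} y *\<^sub>R \<bar>?\<phi> y\<bar>)"
          using set_integrable_abs[OF \<phi>_int[of "s * a"]] by (simp add: set_integrable_def)
        show "norm (indicat_real {-L..L} y *\<^sub>R ?\<phi> y) \<le> indicat_real {-(s * a)..s * a} y *\<^sub>R \<bar>?\<phi> y\<bar>" for y
          using L by (auto simp: indicator_def)
      qed
      moreover have "1 \<le> 2 * L" using L a by simp
      ultimately have "\<bar>J L\<bar> \<le> W"
        using frac_le[of W "\<bar>LBINT y:{-L..L}. ?\<phi> y\<bar>" 1 "2 * L"]
        by (simp add: J_def abs_divide)
      moreover have "\<bar>\<mu> / ln s * ln L\<bar> \<le> \<bar>\<mu> / ln s\<bar> * ln (s * a)"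
        unfolding abs_mult using L a by (intro mult_left_mono) (auto intro!: ln_mono)
      ultimately show ?thesis unfolding H_def by linarith
    qed
    then show "\<exists>K. \<forall>L\<in>{a..s * a}. \<bar>H L\<bar> \<le> K" by blast
  qed
  then have "((\<lambda>L. H L / ln L + \<mu> / ln s) \<longlongrightarrow> 0 + \<mu> / ln s) at_top"
    by (intro tendsto_add tendsto_const)
  moreover have "\<forall>\<^sub>F L in at_top. H L / ln L + \<mu> / ln s = (LBINT y:{-L..L}. ?\<phi> y) / (2 * L * ln L)"
    using eventually_gt_at_top[of 1]
  proof eventually_elim
    case (elim L)
    then have "ln L > 0" by simp
    then show ?case by (simp add: H_def J_def diff_divide_distrib)
  qed
  ultimately show ?thesis by (simp add: s_def Lim_transform_eventually)
qed

section \<open>The mean of the logarithm of the Fourier transform\<close>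

theorem theorem2:
  fixes lam :: real and m :: nat and a :: "nat \<Rightarrow> complex" and tau :: "nat \<Rightarrow> real"
    and f :: "(real \<Rightarrow> complex) \<Rightarrow> complex"
  assumes "lam \<notin> {-1..1}"
    and "m \<ge> 1"
    and "\<And>j. j \<in> {1..m} \<Longrightarrow> a j \<noteq> 0"
    and "(\<Sum>j=1..m. a j) = complex_of_real \<bar>lam\<bar>"
    and "strict_mono_on {1..m} tau"
    and "compactly_supported_distribution f"
    and "total_integral f = 1"
    and "satisfies_refinement f lam m a tau"
  shows "((\<lambda>L. (LBINT y:{-L..L}. ln (cmod (fourier f y))) / (2 * L * ln L))
           \<longlongrightarrow> - rho lam m a tau) at_top"
proof -
  have lam: "\<bar>lam\<bar> > 1" using assms(1) by (auto simp: abs_if)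
  define A where "A = mask lam m a tau"
  define b where "b j = a j / complex_of_real \<bar>lam\<bar>" for j
  have A_eq: "A = exp_sum {1..m} b (\<lambda>j. 2 * pi * tau j) 0"
    by (auto simp: A_def b_def mask_def exp_sum_def sum_divide_distrib)
  have J: "finite {1..m}" "1 \<in> {1..m}" "inj_on tau {1..m}" "b 1 \<noteq> 0"
    using assms(2,3,5) lam by (auto simp: b_def strict_mono_on_imp_inj_on)
  have J': "inj_on (\<lambda>j. 2 * pi * tau j) {1..m}"
    by (rule inj_onI, rule inj_onD[OF J(3)]) simp_all
  have "((\<lambda>L. (LBINT y:{-L..L}. ln (cmod (fourier f y))) / (2 * L * ln L))
      \<longlongrightarrow> ln (mahler_measure (tau ` {1..m}) A) / ln \<bar>lam\<bar>) at_top"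
  proof (rule mean_ln_of_refinement[OF lam])
    show "fourier f y = A (y / lam) * fourier f (y / lam)" for y
      unfolding A_def by (rule fourier_refinement[OF assms(6) _ assms(8)]) (use lam in auto)
    show "fourier f 0 = 1" using assms(7) by (simp add: fourier_0)
    show "(fourier f \<longlongrightarrow> 1) (at 0)" using fourier_tendsto_at_0[OF assms(6)] assms(7) by simp
    show "A \<in> borel_measurable borel" unfolding A_eq by (rule borel_measurable_exp_sum)
    show "AE y in lborel. A y \<noteq> 0" unfolding A_eq by (rule exp_sum_AE_nonzero[where b = b, OF J(1,2) J' J(4)])
    show "set_integrable lborel {-R..R} (\<lambda>y. ln (cmod (A y)))" for R
      unfolding A_eq by (rule ln_exp_sum_set_integrable[where b = b, OF J(1,2) J' J(4)])
    show "((\<lambda>R. (LBINT y:{-R..R}. ln (cmod (A y))) / (2 * R)) \<longlongrightarrow> ln (mahler_measure (tau ` {1..m}) A)) at_top"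
      unfolding A_eq by (rule mean_ln_tendsto_mahler_measure[where b = b, OF J])
  qed
  then show ?thesis by (simp add: rho_def A_def)
qed

end
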